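(* Let $\varepsilon\in\{+1,-1\}$, let $m>2$ and $k$ be integers, and let $\mathcal{M}=(M,g)$ be a harmonic space whose density function satisfies $\Theta_{\mathcal{M}}=\Theta_\varepsilon(m,k)$, where $\Theta_{+}(m,k)(r)=\sin(r)^{m-1}\cos(r)^k$ and $\Theta_{-}(m,k)(r)=\sinh(r)^{m-1}\cosh(r)^k$. Let $\lambda$ be an eigenvalue of the reduced Jacobi operator $\tilde{\mathcal{J}}_{\mathcal{M}}(\xi)$ for some unit tangent vector $\xi$ of $\mathcal{M}$. Then $$\frac{m+3k-1}{m-1}-\mathcal{E}(m,k)\le\varepsilon\lambda\le\frac{m+3k-1}{m-1}+\mathcal{E}(m,k),\qquad \mathcal{E}(m,k):=\frac{3m-6}{m-1}\sqrt{\frac{k(m-1-k)}{m-2}}.$$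
   Context: Let $\mathcal{M}=(M,g)$ be a (smooth) Riemannian manifold with Riemannian measure $\operatorname{dvol}_{\mathcal{M}}$. For $P\in M$ write $\xi\in T_PM$ in polar coordinates $\xi=r\theta$, $r=\|\xi\|>0$, $\|\theta\|=1$. The density $\Theta_{\mathcal{M}}(P;\xi)$ is defined for small $\xi\neq0$ by $\exp_P^*\operatorname{dvol}_{\mathcal{M}}=\Theta_{\mathcal{M}}(P;\xi)\,dr\,d\theta$, where $d\theta$ is the standard measure on the unit sphere of $T_PM$; equivalently $\Theta_{\mathcal{M}}(P;\xi)=r^{\dim(M)-1}\sqrt{\det(g_{ij}(\xi))}$ in geodesic normal coordinates at $P$. $\mathcal{M}$ is a harmonic space if $\Theta_{\mathcal{M}}(P;\xi)$ depends only on $\|\xi\|$, in which case one writes $\Theta_{\mathcal{M}}(r)$, $r=\|\xi\|$. The equality $\Theta_{\mathcal{M}}=\Theta_\varepsilon(m,k)$ is as functions of $r$ for small $r>0$ (and it forces $\dim M=m$ and $0\le k\le m-1$). No completeness is assumed. Subscripts $\varepsilon=\pm$ are identified with the signs $\pm1$. With $R(\xi,\eta)=\nabla_\xi\nabla_\eta-\nabla_\eta\nabla_\xi-\nabla_{[\xi,\eta]}$, the Jacobi operator is the self-adjoint operator $\mathcal{J}_{\mathcal{M}}(\xi)\eta=R(\eta,\xi)\xi$; it preserves $\xi^\perp$, and the reduced Jacobi operator $\tilde{\mathcal{J}}_{\mathcal{M}}(\xi)$ is its restriction to $\xi^\perp$. *)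

theory Defs
  imports "HOL-Analysis.Analysis"
begin

subsection \<open>Smooth maps between open subsets of Euclidean spaces\<close>

fun Ck_on :: "nat \<Rightarrow> 'a::euclidean_space set \<Rightarrow> ('a \<Rightarrow> 'b::real_normed_vector) \<Rightarrow> bool" where
  "Ck_on 0 S f \<longleftrightarrow> continuous_on S f"
| "Ck_on (Suc k) S f \<longleftrightarrow>
     (\<forall>x\<in>S. f differentiable (at x)) \<and> (\<forall>v. Ck_on k S (\<lambda>x. frechet_derivative f (at x) v))"

text \<open>Only used for open \<open>S\<close>.\<close>

definition smooth_on :: "'a::euclidean_space set \<Rightarrow> ('a \<Rightarrow> 'b::real_normed_vector) \<Rightarrow> bool" where
  "smooth_on S f \<longleftrightarrow> (\<forall>k. Ck_on k S f)"

definition jacobian :: "(real^'n \<Rightarrow> real^'n) \<Rightarrow> real^'n \<Rightarrow> real^'n^'n" where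
  "jacobian f x = matrix (frechet_derivative f (at x))"

subsection \<open>Smooth manifolds with a Riemannian metric\<close>

record ('a, 'n::finite) chart =
  chart_dom :: "'a set"
  chart_map :: "'a \<Rightarrow> real^'n"

definition chart_im :: "('a, 'n::finite) chart \<Rightarrow> (real^'n) set" where
  "chart_im c = chart_map c ` chart_dom c"

definition chart_inv :: "('a, 'n::finite) chart \<Rightarrow> real^'n \<Rightarrow> 'a" where
  "chart_inv c = inv_into (chart_dom c) (chart_map c)"

definition is_chart :: "'a topology \<Rightarrow> ('a, 'n::finite) chart \<Rightarrow> bool" where
  "is_chart X c \<longleftrightarrow> openin X (chart_dom c) \<and> open (chart_im c) \<and>
     homeomorphic_map (subtopology X (chart_dom c)) (top_of_set (chart_im c)) (chart_map c)"

definition transition :: "('a, 'n::finite) chart \<Rightarrow> ('a, 'n) chart \<Rightarrow> real^'n \<Rightarrow> real^'n" where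
  "transition c d = chart_map d \<circ> chart_inv c"

definition compatible :: "('a, 'n::finite) chart \<Rightarrow> ('a, 'n) chart \<Rightarrow> bool" where
  "compatible c d \<longleftrightarrow>
     smooth_on (chart_map c ` (chart_dom c \<inter> chart_dom d)) (transition c d) \<and>
     smooth_on (chart_map d ` (chart_dom c \<inter> chart_dom d)) (transition d c)"

text \<open>\<open>metric M c x\<close> is the matrix \<open>(g\<^sub>i\<^sub>j(x))\<close> of the metric in the chart \<open>c\<close>, as a function of
  the coordinates \<open>x\<close>.\<close>

record ('a, 'n::finite) riemannian =
  space_top :: "'a topology"
  atlas :: "('a, 'n) chart set"
  metric :: "('a, 'n) chart \<Rightarrow> real^'n \<Rightarrow> real^'n^'n"

definition smooth_manifold :: "'a topology \<Rightarrow> ('a, 'n::finite) chart set \<Rightarrow> bool" where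
  "smooth_manifold X A \<longleftrightarrow>
     Hausdorff_space X \<and> second_countable X \<and>
     (\<forall>c\<in>A. is_chart X c) \<and> (\<Union>c\<in>A. chart_dom c) = topspace X \<and>
     (\<forall>c\<in>A. \<forall>d\<in>A. compatible c d)"

definition riemannian_manifold :: "('a, 'n::finite) riemannian \<Rightarrow> bool" where
  "riemannian_manifold M \<longleftrightarrow>
     smooth_manifold (space_top M) (atlas M) \<and>
     (\<forall>c\<in>atlas M. smooth_on (chart_im c) (metric M c)) \<and>
     (\<forall>c\<in>atlas M. \<forall>x\<in>chart_im c. transpose (metric M c x) = metric M c x \<and>
        (\<forall>v. v \<noteq> 0 \<longrightarrow> v \<bullet> (metric M c x *v v) > 0)) \<and>
     (\<forall>c\<in>atlas M. \<forall>d\<in>atlas M. \<forall>p\<in>chart_dom c \<inter> chart_dom d.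
        metric M c (chart_map c p) =
          transpose (jacobian (transition c d) (chart_map c p)) **
          metric M d (chart_map d p) ** jacobian (transition c d) (chart_map c p))"

definition smooth_chart :: "('a, 'n::finite) riemannian \<Rightarrow> ('a, 'n) chart \<Rightarrow> bool" where
  "smooth_chart M c \<longleftrightarrow> is_chart (space_top M) c \<and> (\<forall>d\<in>atlas M. compatible c d)"

text \<open>A tangent vector at \<open>p\<close> is represented by its components, an element of \<open>real^'n\<close>, in the
  chart \<open>chart_at M p\<close> chosen once and for all at \<open>p\<close>.\<close>

definition chart_at :: "('a, 'n::finite) riemannian \<Rightarrow> 'a \<Rightarrow> ('a, 'n) chart" where
  "chart_at M p = (SOME c. c \<in> atlas M \<and> p \<in> chart_dom c)"

definition inner_at :: "('a, 'n::finite) riemannian \<Rightarrow> 'a \<Rightarrow> real^'n \<Rightarrow> real^'n \<Rightarrow> real" where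
  "inner_at M p u v = u \<bullet> (metric M (chart_at M p) (chart_map (chart_at M p) p) *v v)"

definition norm_at :: "('a, 'n::finite) riemannian \<Rightarrow> 'a \<Rightarrow> real^'n \<Rightarrow> real" where
  "norm_at M p u = sqrt (inner_at M p u u)"

text \<open>The matrix of the metric in an arbitrary chart compatible with the atlas, at the
  coordinates \<open>x\<close>.\<close>

definition metric_in :: "('a, 'n::finite) riemannian \<Rightarrow> ('a, 'n) chart \<Rightarrow> real^'n \<Rightarrow> real^'n^'n" where
  "metric_in M c x =
     (let q = chart_inv c x; d = chart_at M q; J = jacobian (transition c d) x
      in transpose J ** metric M d (chart_map d q) ** J)"

subsection \<open>Levi-Civita connection and curvature in coordinates\<close>

text \<open>\<open>G\<close> is a matrix-valued function of the coordinates; vector fields are functions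
  \<open>real^'n \<Rightarrow> real^'n\<close>.\<close>

definition metric_partial :: "(real^'n \<Rightarrow> real^'n^'n) \<Rightarrow> real^'n \<Rightarrow> 'n \<Rightarrow> 'n \<Rightarrow> 'n \<Rightarrow> real" where
  "metric_partial G x i j l = frechet_derivative G (at x) (axis i 1) $ j $ l"

definition christoffel :: "(real^'n \<Rightarrow> real^'n^'n) \<Rightarrow> real^'n \<Rightarrow> 'n \<Rightarrow> 'n \<Rightarrow> 'n \<Rightarrow> real" where
  "christoffel G x k i j =
     (1/2) * (\<Sum>l\<in>UNIV. matrix_inv (G x) $ k $ l *
       (metric_partial G x i j l + metric_partial G x j i l - metric_partial G x l i j))"

definition christoffel_vec :: "(real^'n \<Rightarrow> real^'n^'n) \<Rightarrow> real^'n \<Rightarrow> real^'n \<Rightarrow> real^'n \<Rightarrow> real^'n" where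
  "christoffel_vec G x u v = (\<chi> k. \<Sum>i\<in>UNIV. \<Sum>j\<in>UNIV. christoffel G x k i j * u $ i * v $ j)"

definition nabla ::
  "(real^'n \<Rightarrow> real^'n^'n) \<Rightarrow> (real^'n \<Rightarrow> real^'n) \<Rightarrow> (real^'n \<Rightarrow> real^'n) \<Rightarrow> real^'n \<Rightarrow> real^'n" where
  "nabla G X Y x = frechet_derivative Y (at x) (X x) + christoffel_vec G x (X x) (Y x)"

definition lie_bracket ::
  "(real^'n \<Rightarrow> real^'n) \<Rightarrow> (real^'n \<Rightarrow> real^'n) \<Rightarrow> real^'n \<Rightarrow> real^'n" where
  "lie_bracket X Y x = frechet_derivative Y (at x) (X x) - frechet_derivative X (at x) (Y x)"

definition curvature_field ::
  "(real^'n \<Rightarrow> real^'n^'n) \<Rightarrow> (real^'n \<Rightarrow> real^'n) \<Rightarrow> (real^'n \<Rightarrow> real^'n) \<Rightarrow> (real^'n \<Rightarrow> real^'n)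
     \<Rightarrow> real^'n \<Rightarrow> real^'n" where
  "curvature_field G X Y Z x =
     nabla G X (nabla G Y Z) x - nabla G Y (nabla G X Z) x - nabla G (lie_bracket X Y) Z x"

text \<open>\<open>R\<close> is a tensor, so its value on tangent vectors at \<open>p\<close> may be computed with the extensions
  having constant components.\<close>

definition curvature_at ::
  "('a, 'n::finite) riemannian \<Rightarrow> 'a \<Rightarrow> real^'n \<Rightarrow> real^'n \<Rightarrow> real^'n \<Rightarrow> real^'n" where
  "curvature_at M p u v w =
     curvature_field (metric M (chart_at M p)) (\<lambda>_. u) (\<lambda>_. v) (\<lambda>_. w) (chart_map (chart_at M p) p)"

definition jacobi_op :: "('a, 'n::finite) riemannian \<Rightarrow> 'a \<Rightarrow> real^'n \<Rightarrow> real^'n \<Rightarrow> real^'n" where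
  "jacobi_op M p \<xi> \<eta> = curvature_at M p \<eta> \<xi> \<xi>"

definition reduced_jacobi_eigenvalue ::
  "('a, 'n::finite) riemannian \<Rightarrow> 'a \<Rightarrow> real^'n \<Rightarrow> real \<Rightarrow> bool" where
  "reduced_jacobi_eigenvalue M p \<xi> \<mu> \<longleftrightarrow>
     (\<exists>\<eta>. \<eta> \<noteq> 0 \<and> inner_at M p \<xi> \<eta> = 0 \<and> jacobi_op M p \<xi> \<eta> = \<mu> *\<^sub>R \<eta>)"

subsection \<open>Geodesics, exponential map and normal coordinates\<close>

definition geodesic_on :: "('a, 'n::finite) riemannian \<Rightarrow> (real \<Rightarrow> 'a) \<Rightarrow> real set \<Rightarrow> bool" where
  "geodesic_on M \<gamma> I \<longleftrightarrow>
     continuous_map (top_of_set I) (space_top M) \<gamma> \<and>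
     (\<forall>c\<in>atlas M. \<exists>v. \<forall>t\<in>I. \<gamma> t \<in> chart_dom c \<longrightarrow>
        ((chart_map c \<circ> \<gamma>) has_vector_derivative v t) (at t) \<and>
        (v has_vector_derivative
           - christoffel_vec (metric M c) (chart_map c (\<gamma> t)) (v t) (v t)) (at t))"

definition exp_rel :: "('a, 'n::finite) riemannian \<Rightarrow> 'a \<Rightarrow> real^'n \<Rightarrow> 'a \<Rightarrow> bool" where
  "exp_rel M p \<xi> q \<longleftrightarrow>
     (\<exists>\<gamma> a b. a < 0 \<and> 1 < b \<and> geodesic_on M \<gamma> {a<..<b} \<and> \<gamma> 0 = p \<and>
        ((chart_map (chart_at M p) \<circ> \<gamma>) has_vector_derivative \<xi>) (at 0) \<and> \<gamma> 1 = q)"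

definition exp_map :: "('a, 'n::finite) riemannian \<Rightarrow> 'a \<Rightarrow> real^'n \<Rightarrow> 'a" where
  "exp_map M p \<xi> = (THE q. exp_rel M p \<xi> q)"

text \<open>The columns of \<open>L\<close> are an orthonormal basis of the tangent space at \<open>p\<close>.\<close>

definition orthonormal_frame :: "('a, 'n::finite) riemannian \<Rightarrow> 'a \<Rightarrow> real^'n^'n \<Rightarrow> bool" where
  "orthonormal_frame M p L \<longleftrightarrow>
     (\<forall>i j. inner_at M p (column i L) (column j L) = (if i = j then 1 else 0))"

definition normal_chart ::
  "('a, 'n::finite) riemannian \<Rightarrow> 'a \<Rightarrow> real^'n^'n \<Rightarrow> real \<Rightarrow> ('a, 'n) chart" where
  "normal_chart M p L \<delta> =
     \<lparr>chart_dom = (\<lambda>x. exp_map M p (L *v x)) ` ball 0 \<delta>,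
      chart_map = inv_into (ball 0 \<delta>) (\<lambda>x. exp_map M p (L *v x))\<rparr>"

text \<open>\<open>exp\<^sub>p\<close> is defined on the ball of radius \<open>\<delta>\<close> and maps it diffeomorphically onto an open set.\<close>

definition normal_coordinates ::
  "('a, 'n::finite) riemannian \<Rightarrow> 'a \<Rightarrow> real^'n^'n \<Rightarrow> real \<Rightarrow> bool" where
  "normal_coordinates M p L \<delta> \<longleftrightarrow>
     orthonormal_frame M p L \<and>
     (\<forall>x\<in>ball 0 \<delta>. \<exists>q. exp_rel M p (L *v x) q) \<and>
     inj_on (\<lambda>x. exp_map M p (L *v x)) (ball 0 \<delta>) \<and>
     smooth_chart M (normal_chart M p L \<delta>)"

subsection \<open>Density function and harmonic spaces\<close>

text \<open>\<open>\<Theta>(p;\<xi>)\<close> is a partial function of \<open>\<xi>\<close>, hence a relation: \<open>has_density M p \<xi> d\<close> says that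
  \<open>\<xi>\<close> lies in a ball carrying geodesic normal coordinates and
  \<open>d = r\<^sup>n\<^sup>-\<^sup>1 (det g\<^sub>i\<^sub>j(\<xi>))\<^sup>1\<^sup>/\<^sup>2\<close> in these.\<close>

definition has_density ::
  "('a, 'n::finite) riemannian \<Rightarrow> 'a \<Rightarrow> real^'n \<Rightarrow> real \<Rightarrow> bool" where
  "has_density M p \<xi> d \<longleftrightarrow>
     (\<exists>L \<delta>. normal_coordinates M p L \<delta> \<and>
        (\<exists>x\<in>ball 0 \<delta>. \<xi> = L *v x \<and>
           d = norm_at M p \<xi> ^ (CARD('n) - 1) * sqrt (det (metric_in M (normal_chart M p L \<delta>) x))))"

definition harmonic_with_density ::
  "('a, 'n::finite) riemannian \<Rightarrow> (real \<Rightarrow> real) \<Rightarrow> bool" where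
  "harmonic_with_density M f \<longleftrightarrow>
     (\<forall>p\<in>topspace (space_top M). \<exists>\<delta>>0. \<forall>\<xi>.
        0 < norm_at M p \<xi> \<and> norm_at M p \<xi> < \<delta> \<longrightarrow> has_density M p \<xi> (f (norm_at M p \<xi>)))"

definition model_density :: "int \<Rightarrow> int \<Rightarrow> int \<Rightarrow> real \<Rightarrow> real" where
  "model_density \<epsilon> m k r =
     (if \<epsilon> = 1 then sin r powi (m - 1) * cos r powi k
      else sinh r powi (m - 1) * cosh r powi k)"

definition error_term :: "int \<Rightarrow> int \<Rightarrow> real" where
  "error_term m k = (3 * of_int m - 6) / (of_int m - 1) *
     sqrt (of_int k * (of_int m - 1 - of_int k) / (of_int m - 2))"

end

theory Submission
  imports Defs "HOL-Real_Asymp.Real_Asymp"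
begin

text \<open>
  Along a unit speed geodesic \<open>t \<mapsto> exp\<^sub>p(t u)\<close> the logarithmic covariant derivative \<open>U\<close> of the matrix of Jacobi
  fields vanishing at \<open>p\<close> satisfies the Riccati equation \<open>U' + U\<^sup>2 + R = 0\<close>, where \<open>R\<close> is the Jacobi operator
  of the velocity, and \<open>tr U - 1 / t\<close> is the logarithmic derivative of the density. Writing \<open>U = 1 / t + V\<close>,
  the trace of the equation is \<open>h' + 2 h / t + tr V\<^sup>2 + tr R = 0\<close> with \<open>h = tr V\<close> an explicit function of
  \<open>t\<close>. Letting \<open>t\<close> tend to \<open>0\<close> gives \<open>tr R = \<epsilon> (m - 1 + 3 k)\<close> at every point for every unit vector, hence
  along the whole geodesic. As \<open>V / t\<close> tends to \<open>- R / 3\<close>, the next order then gives \<open>tr R\<^sup>2 = m - 1 + 15 k\<close>.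
  Since \<open>R\<close> is self-adjoint and annihilates the velocity, the bound on an eigenvalue follows from these two
  traces by the Cauchy-Schwarz inequality.
\<close>

subsection \<open>Calculus of smooth maps\<close>

text \<open>All computations take place in coordinates. The exponential map is read in a chart of
  the atlas as a map \<open>E\<close> with Jacobian matrix \<open>J\<close>; then \<open>t J\<close>
  is the matrix of Jacobi fields, and the Jacobi equation is the derivative of the radial geodesic
  equation in a transverse direction. As \<open>exp_map\<close> is a definite description,
  identifying it along rays requires uniqueness of geodesics across charts. Splitting off
  \<open>1 / t\<close> leaves a \<open>V\<close> that is smooth at the origin, so the limits are
  values of smooth maps and of their derivatives. The obstacle lies in the second order: derivatives
  of \<open>tr R\<close> would enter the coefficient of \<open>t^2\<close>. For this reason the
  first order is carried out at every point, each with exponential coordinates of its own but read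
  in the same chart, and is combined with the constant speed of geodesics. The numbers 3 and 15 come
  from Taylor coefficients of the mean curvature of the model. In the last inequality the velocity
  and the eigenvector are both projected away, which leaves \<open>m - 2\<close> dimensions and
  produces the \<open>m - 2\<close> in the error term.\<close>

lemma Ck_on_cong:
  assumes "open S" "\<And>x. x \<in> S \<Longrightarrow> f x = g x" "Ck_on k S f"
  shows "Ck_on k S g"
  using assms(2,3)
proof (induction k arbitrary: f g)
  case 0
  then show ?case by (simp cong: continuous_on_cong)
next
  case (Suc k)
  have D: "frechet_derivative f (at x) = frechet_derivative g (at x)" if "x \<in> S" for x
    using frechet_derivative_transform_within_open[of f x S g] Suc.prems that assms(1) by auto
  have "g differentiable (at x)" if "x \<in> S" for x
    using Suc.prems that assms(1)
    by (metis Ck_on.simps(2) differentiable_def has_derivative_transform_within_open)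
  moreover have "Ck_on k S (\<lambda>x. frechet_derivative g (at x) v)" for v
    using Suc.IH[of "\<lambda>x. frechet_derivative f (at x) v"] Suc.prems D by auto
  ultimately show ?case by simp
qed

lemma Ck_on_subset: "Ck_on k S f \<Longrightarrow> T \<subseteq> S \<Longrightarrow> Ck_on k T f"
  by (induction k arbitrary: f) (auto intro: continuous_on_subset)

lemma Ck_on_SucD: "Ck_on (Suc k) S f \<Longrightarrow> Ck_on k S f"
proof (induction k arbitrary: f)
  case 0
  then show ?case
    by (auto intro!: differentiable_imp_continuous_on differentiable_at_imp_differentiable_on)
next
  case (Suc k)
  then show ?case by auto
qed

lemma frechet_derivative_eqI:
  "(f has_derivative f') (at x) \<Longrightarrow> frechet_derivative f (at x) v = f' v"
  by (metis frechet_derivative_at)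

text \<open>It suffices to know the derivative on the open set \<open>S\<close>, where it agrees
  with \<open>frechet_derivative\<close>. Most closure properties below are inductions on the order
  through this rule.\<close>

lemma Ck_on_SucI:
  assumes "open S" "\<And>x. x \<in> S \<Longrightarrow> (f has_derivative f' x) (at x)"
    "\<And>v. Ck_on k S (\<lambda>x. f' x v)"
  shows "Ck_on (Suc k) S f"
proof -
  have "Ck_on k S (\<lambda>x. frechet_derivative f (at x) v)" for v
    by (rule Ck_on_cong[OF assms(1) _ assms(3)[of v]])
      (use assms(2) frechet_derivative_eqI in metis)
  then show ?thesis using assms(2) by (auto simp: differentiable_def)
qed

lemma Ck_on_has_derivative:
  "Ck_on (Suc k) S f \<Longrightarrow> x \<in> S \<Longrightarrow> (f has_derivative frechet_derivative f (at x)) (at x)"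
  using frechet_derivative_works by auto

lemma Ck_on_derivative: "Ck_on (Suc k) S f \<Longrightarrow> Ck_on k S (\<lambda>x. frechet_derivative f (at x) v)"
  by simp

lemma Ck_on_const: "Ck_on k S (\<lambda>x. c)"
  by (induction k arbitrary: c) auto

lemma Ck_on_linear:
  assumes "open S" "bounded_linear f"
  shows "Ck_on k S f"
proof (cases k)
  case 0
  then show ?thesis using assms(2) by (auto simp: linear_continuous_on)
next
  case (Suc j)
  then show ?thesis
    using Ck_on_SucI[of S f "\<lambda>x. f" j] assms by (auto intro: bounded_linear_imp_has_derivative Ck_on_const)
qed

lemma Ck_on_linear_compose:
  assumes "open S" "bounded_linear h" "Ck_on k S f"
  shows "Ck_on k S (\<lambda>x. h (f x))"
  using assms(3)
proof (induction k arbitrary: f)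
  case 0
  then show ?case using assms(2) by (auto simp: bounded_linear.continuous_on)
next
  case (Suc k)
  show ?case
    by (rule Ck_on_SucI[OF assms(1), where f' = "\<lambda>x v. h (frechet_derivative f (at x) v)"])
      (use Suc in \<open>auto intro!: bounded_linear.has_derivative[OF assms(2)] Ck_on_has_derivative[OF Suc.prems]\<close>)
qed

lemma Ck_on_add:
  assumes "open S" "Ck_on k S f" "Ck_on k S g"
  shows "Ck_on k S (\<lambda>x. f x + g x)"
  using assms(2,3)
proof (induction k arbitrary: f g)
  case 0
  then show ?case by (auto intro: continuous_intros)
next
  case (Suc k)
  show ?case
    by (rule Ck_on_SucI[OF assms(1) has_derivative_add[OF Ck_on_has_derivative[OF Suc.prems(1)]
            Ck_on_has_derivative[OF Suc.prems(2)]]]) (use Suc in auto)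
qed

lemma Ck_on_bilinear:
  assumes "bounded_bilinear b" "open S" "Ck_on k S f" "Ck_on k S g"
  shows "Ck_on k S (\<lambda>x. b (f x) (g x))"
  using assms(3,4)
proof (induction k arbitrary: f g)
  case 0
  then show ?case using assms(1) by (auto intro: bounded_bilinear.continuous_on)
next
  case (Suc k)
  have *: "Ck_on k S f" "Ck_on k S g"
    using Suc.prems by (auto intro: Ck_on_SucD simp del: Ck_on.simps)
  show ?case
    by (rule Ck_on_SucI[OF assms(2) bounded_bilinear.FDERIV[OF assms(1)
            Ck_on_has_derivative[OF Suc.prems(1)] Ck_on_has_derivative[OF Suc.prems(2)]]])
      (use Suc.prems * in \<open>auto intro!: Ck_on_add assms(2) Suc.IH\<close>)
qed

lemma Ck_on_sum:
  assumes "open S" "\<And>i. i \<in> I \<Longrightarrow> Ck_on k S (f i)"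
  shows "Ck_on k S (\<lambda>x. \<Sum>i\<in>I. f i x)"
  using assms(2)
  by (induction I rule: infinite_finite_induct) (auto intro: Ck_on_const Ck_on_add assms(1))

lemma Ck_on_prod:
  fixes f :: "'i \<Rightarrow> 'a::euclidean_space \<Rightarrow> real"
  assumes "open S" "\<And>i. i \<in> I \<Longrightarrow> Ck_on k S (f i)"
  shows "Ck_on k S (\<lambda>x. \<Prod>i\<in>I. f i x)"
  using assms(2)
  by (induction I rule: infinite_finite_induct)
    (auto intro: Ck_on_const Ck_on_bilinear[OF bounded_bilinear_mult] assms(1))

lemma Ck_on_inverse:
  fixes f :: "'a::euclidean_space \<Rightarrow> real"
  assumes "open S" "Ck_on k S f" "\<And>x. x \<in> S \<Longrightarrow> f x \<noteq> 0"
  shows "Ck_on k S (\<lambda>x. inverse (f x))"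
  using assms(2)
proof (induction k)
  case 0
  then show ?case using assms(3) by (auto intro: continuous_intros)
next
  case (Suc k)
  have I: "Ck_on k S (\<lambda>x. inverse (f x))"
    using Suc Ck_on_SucD by blast
  show ?case
    by (rule Ck_on_SucI[OF assms(1) Deriv.has_derivative_inverse[OF assms(3) Ck_on_has_derivative[OF Suc.prems]]])
      (use Suc.prems in \<open>auto intro!: Ck_on_bilinear[OF bounded_bilinear_mult] assms(1) I
        Ck_on_linear_compose[OF assms(1) bounded_linear_minus[OF bounded_linear_ident]]\<close>)
qed

text \<open>\<open>Ck_on\<close> controls the derivative only in fixed directions, while the chain
  rule feeds it the moving vector \<open>f'(x) v\<close>. Expanding that vector in the basis leaves
  derivatives of \<open>g\<close> in fixed directions, to which the induction hypothesis
  applies.\<close>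

lemma Ck_on_compose:
  fixes f :: "'a::euclidean_space \<Rightarrow> 'b::euclidean_space" and g :: "'b \<Rightarrow> 'c::real_normed_vector"
  assumes "open S" "open T" "f ` S \<subseteq> T" "Ck_on k S f" "Ck_on k T g"
  shows "Ck_on k S (\<lambda>x. g (f x))"
  using assms(4,5)
proof (induction k arbitrary: g)
  case 0
  then show ?case using assms(3) by (auto intro: continuous_on_compose2)
next
  case (Suc k)
  have fT: "f x \<in> T" if "x \<in> S" for x using that assms(3) by auto
  have eq: "frechet_derivative g (at (f x)) (frechet_derivative f (at x) v) =
     (\<Sum>b\<in>Basis. (frechet_derivative f (at x) v \<bullet> b) *\<^sub>R frechet_derivative g (at (f x)) b)"
    if "x \<in> S" for x v
  proof -
    have "linear (frechet_derivative g (at (f x)))"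
      using Suc.prems(2) fT[OF that] by (auto intro: linear_frechet_derivative)
    then show ?thesis
      by (subst (1) euclidean_representation[symmetric])
        (simp add: linear_sum linear_cmul)
  qed
  show ?case
  proof (rule Ck_on_SucI[OF assms(1)])
    show "((\<lambda>x. g (f x)) has_derivative
        (\<lambda>v. frechet_derivative g (at (f x)) (frechet_derivative f (at x) v))) (at x)" if "x \<in> S" for x
      using diff_chain_at[OF Ck_on_has_derivative[OF Suc.prems(1) that]
          Ck_on_has_derivative[OF Suc.prems(2) fT[OF that]]] by (simp add: o_def)
    fix v
    have "Ck_on k S (\<lambda>x. \<Sum>b\<in>Basis. (frechet_derivative f (at x) v \<bullet> b) *\<^sub>R frechet_derivative g (at (f x)) b)"
    proof (intro Ck_on_sum Ck_on_bilinear[OF bounded_bilinear_scaleR] assms(1))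
      fix b
      show "Ck_on k S (\<lambda>x. frechet_derivative f (at x) v \<bullet> b)"
        using Suc.prems(1) by (intro Ck_on_linear_compose[OF assms(1) bounded_linear_inner_left]) auto
      show "Ck_on k S (\<lambda>x. frechet_derivative g (at (f x)) b)"
        by (rule Suc.IH) (use Suc.prems Ck_on_SucD in auto)
    qed
    then show "Ck_on k S (\<lambda>x. frechet_derivative g (at (f x)) (frechet_derivative f (at x) v))"
      by (rule Ck_on_cong[OF assms(1), rotated]) (simp add: eq)
  qed
qed

section \<open>Closure properties of smooth maps\<close>

lemma smooth_on_cong:
  "open S \<Longrightarrow> (\<And>x. x \<in> S \<Longrightarrow> f x = g x) \<Longrightarrow> smooth_on S f \<Longrightarrow> smooth_on S g"
  unfolding smooth_on_def using Ck_on_cong by blast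

lemma smooth_on_subset: "smooth_on S f \<Longrightarrow> T \<subseteq> S \<Longrightarrow> smooth_on T f"
  unfolding smooth_on_def using Ck_on_subset by blast

lemma smooth_on_has_derivative:
  "smooth_on S f \<Longrightarrow> x \<in> S \<Longrightarrow> (f has_derivative frechet_derivative f (at x)) (at x)"
  unfolding smooth_on_def using Ck_on_has_derivative by blast

lemma smooth_on_differentiable: "smooth_on S f \<Longrightarrow> x \<in> S \<Longrightarrow> f differentiable (at x)"
  using smooth_on_has_derivative differentiable_def by blast

lemma smooth_on_derivative: "smooth_on S f \<Longrightarrow> smooth_on S (\<lambda>x. frechet_derivative f (at x) v)"
  unfolding smooth_on_def using Ck_on_derivative by blast

lemma smooth_on_continuous: "smooth_on S f \<Longrightarrow> continuous_on S f"
  unfolding smooth_on_def by (metis Ck_on.simps(1))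

lemma smooth_on_const: "smooth_on S (\<lambda>x. c)"
  by (simp add: smooth_on_def Ck_on_const)

lemma smooth_on_linear: "open S \<Longrightarrow> bounded_linear f \<Longrightarrow> smooth_on S f"
  by (simp add: smooth_on_def Ck_on_linear)

lemma smooth_on_linear_compose:
  "open S \<Longrightarrow> bounded_linear h \<Longrightarrow> smooth_on S f \<Longrightarrow> smooth_on S (\<lambda>x. h (f x))"
  by (simp add: smooth_on_def Ck_on_linear_compose)

lemma smooth_on_add:
  "open S \<Longrightarrow> smooth_on S f \<Longrightarrow> smooth_on S g \<Longrightarrow> smooth_on S (\<lambda>x. f x + g x)"
  by (simp add: smooth_on_def Ck_on_add)

lemma smooth_on_minus: "open S \<Longrightarrow> smooth_on S f \<Longrightarrow> smooth_on S (\<lambda>x. - f x)"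
  by (rule smooth_on_linear_compose[OF _ bounded_linear_minus[OF bounded_linear_ident]])

lemma smooth_on_diff:
  "open S \<Longrightarrow> smooth_on S f \<Longrightarrow> smooth_on S g \<Longrightarrow> smooth_on S (\<lambda>x. f x - g x)"
  using smooth_on_add[of S f "\<lambda>x. - g x"] smooth_on_minus[of S g] by simp

lemma smooth_on_mult:
  fixes f g :: "'a::euclidean_space \<Rightarrow> real"
  shows "open S \<Longrightarrow> smooth_on S f \<Longrightarrow> smooth_on S g \<Longrightarrow> smooth_on S (\<lambda>x. f x * g x)"
  by (simp add: smooth_on_def Ck_on_bilinear[OF bounded_bilinear_mult])

lemma smooth_on_sum:
  "open S \<Longrightarrow> (\<And>i. i \<in> I \<Longrightarrow> smooth_on S (f i)) \<Longrightarrow> smooth_on S (\<lambda>x. \<Sum>i\<in>I. f i x)"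
  by (simp add: smooth_on_def Ck_on_sum)

lemma smooth_on_prod:
  fixes f :: "'i \<Rightarrow> 'a::euclidean_space \<Rightarrow> real"
  shows "open S \<Longrightarrow> (\<And>i. i \<in> I \<Longrightarrow> smooth_on S (f i)) \<Longrightarrow> smooth_on S (\<lambda>x. \<Prod>i\<in>I. f i x)"
  by (simp add: smooth_on_def Ck_on_prod)

lemma smooth_on_inverse:
  fixes f :: "'a::euclidean_space \<Rightarrow> real"
  shows "open S \<Longrightarrow> smooth_on S f \<Longrightarrow> (\<And>x. x \<in> S \<Longrightarrow> f x \<noteq> 0) \<Longrightarrow> smooth_on S (\<lambda>x. inverse (f x))"
  by (simp add: smooth_on_def Ck_on_inverse)

lemma smooth_on_compose:
  fixes f :: "'a::euclidean_space \<Rightarrow> 'b::euclidean_space" and g :: "'b \<Rightarrow> 'c::real_normed_vector"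
  shows "open S \<Longrightarrow> open T \<Longrightarrow> f ` S \<subseteq> T \<Longrightarrow> smooth_on S f \<Longrightarrow> smooth_on T g
    \<Longrightarrow> smooth_on S (\<lambda>x. g (f x))"
  unfolding smooth_on_def using Ck_on_compose by blast

lemma smooth_on_nth:
  "open S \<Longrightarrow> smooth_on S f \<Longrightarrow> smooth_on S (\<lambda>x. f x $ i)" for f :: "'a::euclidean_space \<Rightarrow> ('b::real_normed_vector)^'n"
  by (rule smooth_on_linear_compose[OF _ bounded_linear_vec_nth])

section \<open>Smooth vector-valued and matrix-valued maps\<close>

lemma bounded_linear_axis: "bounded_linear (axis i :: 'b::real_normed_vector \<Rightarrow> 'b^'n)"
proof (rule bounded_linear_intro[where K = 1])
  fix x y :: 'b and r
  show "(axis i (x + y) :: 'b^'n) = axis i x + axis i y" "(axis i (r *\<^sub>R x) :: 'b^'n) = r *\<^sub>R axis i x"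
    by (auto simp: vec_eq_iff axis_def)
  show "norm (axis i x :: 'b^'n) \<le> norm x * 1"
    by (simp add: norm_vec_def L2_set_def axis_def if_distrib[of norm] if_distrib[of "\<lambda>r. r\<^sup>2"] cong: if_cong)
qed

lemma vec_as_sum_axis: "(v::('b::real_normed_vector)^'n) = (\<Sum>i\<in>UNIV. axis i (v $ i))"
  by (simp add: vec_eq_iff axis_def if_distrib sum.delta cong: if_cong)

lemma smooth_on_vec:
  fixes f :: "'a::euclidean_space \<Rightarrow> ('b::real_normed_vector)^'n"
  assumes "open S" "\<And>i. smooth_on S (\<lambda>x. f x $ i)"
  shows "smooth_on S f"
proof -
  have "smooth_on S (\<lambda>x. \<Sum>i\<in>UNIV. axis i (f x $ i))"
    by (intro smooth_on_sum assms smooth_on_linear_compose[OF _ bounded_linear_axis])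
  then show ?thesis by (simp flip: vec_as_sum_axis)
qed

lemma smooth_on_matrix:
  fixes f :: "'a::euclidean_space \<Rightarrow> real^'n^'m"
  assumes "open S" "\<And>i j. smooth_on S (\<lambda>x. f x $ i $ j)"
  shows "smooth_on S f"
  by (intro smooth_on_vec assms)

lemma smooth_on_matrix_mult:
  fixes f :: "'a::euclidean_space \<Rightarrow> real^'n^'m" and g :: "'a \<Rightarrow> real^'l^'n"
  assumes "open S" "smooth_on S f" "smooth_on S g"
  shows "smooth_on S (\<lambda>x. f x ** g x)"
  by (intro smooth_on_matrix assms) 
    (auto simp: matrix_matrix_mult_def intro!: smooth_on_sum smooth_on_mult smooth_on_nth assms)

lemma smooth_on_det:
  fixes f :: "'a::euclidean_space \<Rightarrow> real^'n^'n"
  assumes "open S" "smooth_on S f"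
  shows "smooth_on S (\<lambda>x. det (f x))"
  unfolding det_def
  by (intro smooth_on_sum smooth_on_mult smooth_on_const smooth_on_prod smooth_on_nth assms)

lemma matrix_inv_mult:
  fixes A :: "real^'n^'n"
  assumes "det A \<noteq> 0"
  shows "A ** matrix_inv A = mat 1" "matrix_inv A ** A = mat 1"
proof -
  have "\<exists>A'. A ** A' = mat 1 \<and> A' ** A = mat 1"
    using assms by (simp add: invertible_det_nz[symmetric] invertible_def)
  from someI_ex[OF this] show "A ** matrix_inv A = mat 1" "matrix_inv A ** A = mat 1"
    by (simp_all add: matrix_inv_def)
qed

text \<open>Cramer's rule for the column that \<open>matrix_inv A\<close> assigns to
  \<open>axis l 1\<close>. It displays the inverse as a quotient of determinants, so its smoothness
  reduces to that of \<open>det\<close>.\<close>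

lemma matrix_inv_cramer:
  fixes A :: "real^'n^'n"
  assumes "det A \<noteq> 0"
  shows "matrix_inv A $ k $ l = det (\<chi> i j. if j = k then axis l 1 $ i else A $ i $ j) * inverse (det A)"
proof -
  have "A *v (matrix_inv A *v axis l 1) = axis l 1"
    by (simp add: matrix_vector_mul_assoc matrix_inv_mult[OF assms])
  then have "matrix_inv A *v axis l 1 =
      (\<chi> k. det (\<chi> i j. if j = k then axis l 1 $ i else A $ i $ j) / det A)"
    using cramer[OF assms] by blast
  then have "(matrix_inv A *v axis l 1) $ k =
      (\<chi> k. det (\<chi> i j. if j = k then axis l 1 $ i else A $ i $ j) / det A) $ k" by simp
  moreover have "(matrix_inv A *v axis l 1) $ k = matrix_inv A $ k $ l"
    by (simp add: matrix_vector_mult_basis column_def)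
  ultimately show ?thesis by (simp add: divide_inverse)
qed

lemma smooth_on_matrix_inv:
  fixes f :: "'a::euclidean_space \<Rightarrow> real^'n^'n"
  assumes "open S" "smooth_on S f" "\<And>x. x \<in> S \<Longrightarrow> det (f x) \<noteq> 0"
  shows "smooth_on S (\<lambda>x. matrix_inv (f x))"
proof (intro smooth_on_matrix assms)
  fix k l
  have "smooth_on S (\<lambda>x. det (\<chi> i j. if j = k then axis l 1 $ i else f x $ i $ j) * inverse (det (f x)))"
  proof (intro smooth_on_mult smooth_on_inverse smooth_on_det smooth_on_matrix assms)
    fix i j
    show "smooth_on S (\<lambda>x. (\<chi> i j. if j = k then axis l (1::real) $ i else f x $ i $ j) $ i $ j)"
      using smooth_on_nth[OF assms(1) smooth_on_nth[OF assms(1,2)]]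
      by (cases "j = k") (auto intro: smooth_on_const)
  qed (intro smooth_on_nth assms)
  then show "smooth_on S (\<lambda>x. matrix_inv (f x) $ k $ l)"
    by (rule smooth_on_cong[OF assms(1), rotated]) (simp add: matrix_inv_cramer assms(3))
qed

section \<open>Derivatives along curves\<close>

lemma has_vector_derivative_compose_differentiable:
  assumes f: "f differentiable (at (x t))" and x: "(x has_vector_derivative x') (at t)"
  shows "((\<lambda>s. f (x s)) has_vector_derivative frechet_derivative f (at (x t)) x') (at t)"
proof -
  have "((f \<circ> x) has_derivative (frechet_derivative f (at (x t)) \<circ> (\<lambda>h. h *\<^sub>R x'))) (at t)"
    using x f by (intro diff_chain_at) (auto simp: has_vector_derivative_def frechet_derivative_works)
  then show ?thesis
    by (simp add: has_vector_derivative_def o_def linear_cmul[OF linear_frechet_derivative[OF f]])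
qed

lemma has_vector_derivative_transform_nhds:
  assumes "(f has_vector_derivative f') (at t)" "eventually (\<lambda>s. f s = g s) (nhds t)"
  shows "(g has_vector_derivative f') (at t)"
  using has_vector_derivative_cong_ev[of UNIV f g t f'] assms eventually_nhds_x_imp_x by auto

lemma eventually_curve_in_open:
  assumes "(x has_vector_derivative x') (at t)" "open S" "x t \<in> S"
  shows "eventually (\<lambda>s. x s \<in> S) (nhds t)"
  using has_vector_derivative_continuous[OF assms(1)] assms(2,3)
  by (auto simp: continuous_within tendsto_at_iff_tendsto_nhds dest: topological_tendstoD)

lemma has_vector_derivative_affine: "((\<lambda>s. a + s *\<^sub>R u) has_vector_derivative u) (at t)"
  by (auto simp: has_vector_derivative_def intro!: derivative_eq_intros)

section \<open>Symmetry of second derivatives\<close>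

text \<open>The mean value theorem is used twice: in direction \<open>u\<close> for the increment of
  \<open>f\<close> across \<open>h v\<close>, then in direction \<open>v\<close> for the derivative
  so obtained.\<close>

lemma second_difference_mean_value:
  fixes f :: "'a::euclidean_space \<Rightarrow> real"
  assumes f: "smooth_on S f" and S: "ball x r \<subseteq> S" and h: "0 < h" "h * (norm u + norm v) < r"
  shows "\<exists>y. dist x y \<le> h * (norm u + norm v) \<and>
    f (x + h *\<^sub>R u + h *\<^sub>R v) - f (x + h *\<^sub>R u) - f (x + h *\<^sub>R v) + f x =
    h\<^sup>2 * frechet_derivative (\<lambda>y. frechet_derivative f (at y) u) (at y) v"
proof -
  let ?Df = "\<lambda>y. frechet_derivative f (at y) u"
  have near: "norm (s *\<^sub>R u + t *\<^sub>R v) \<le> h * (norm u + norm v)" if "0 \<le> s" "s \<le> h" "0 \<le> t" "t \<le> h" for s t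
  proof -
    have "norm (s *\<^sub>R u + t *\<^sub>R v) \<le> s * norm u + t * norm v"
      using norm_triangle_ineq[of "s *\<^sub>R u" "t *\<^sub>R v"] that by simp
    also have "\<dots> \<le> h * norm u + h * norm v"
      using that by (intro add_mono mult_right_mono) auto
    finally show ?thesis by (simp add: algebra_simps)
  qed
  have inS: "x + s *\<^sub>R u + t *\<^sub>R v \<in> S" if "0 \<le> s" "s \<le> h" "0 \<le> t" "t \<le> h" for s t
  proof -
    have "dist x (x + s *\<^sub>R u + t *\<^sub>R v) = norm (s *\<^sub>R u + t *\<^sub>R v)"
      by (simp add: dist_norm norm_minus_commute flip: norm_minus_cancel[of "s *\<^sub>R u + t *\<^sub>R v"])
    then have "x + s *\<^sub>R u + t *\<^sub>R v \<in> ball x r" using near[OF that] h by auto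
    then show ?thesis using S by auto
  qed
  have d1: "((\<lambda>s. f (x + s *\<^sub>R u + t *\<^sub>R v)) has_real_derivative ?Df (x + s *\<^sub>R u + t *\<^sub>R v)) (at s)"
    if "0 \<le> s" "s \<le> h" "0 \<le> t" "t \<le> h" for s t
    using has_vector_derivative_compose_differentiable[where x = "\<lambda>s. x + s *\<^sub>R u + t *\<^sub>R v" and x' = u,
        OF smooth_on_differentiable[OF f inS[OF that]]] has_vector_derivative_affine[of "x + t *\<^sub>R v" u s]
    by (simp add: has_real_derivative_iff_has_vector_derivative add_ac)
  have d2: "((\<lambda>t. ?Df (x + s *\<^sub>R u + t *\<^sub>R v)) has_real_derivative
     frechet_derivative ?Df (at (x + s *\<^sub>R u + t *\<^sub>R v)) v) (at t)"
    if "0 \<le> s" "s \<le> h" "0 \<le> t" "t \<le> h" for s t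
    using has_vector_derivative_compose_differentiable[where x = "\<lambda>t. x + s *\<^sub>R u + t *\<^sub>R v" and x' = v,
        OF smooth_on_differentiable[OF smooth_on_derivative[OF f, of u] inS[OF that]] has_vector_derivative_affine]
    by (simp add: has_real_derivative_iff_has_vector_derivative)
  have "\<exists>s. 0 < s \<and> s < h \<and> (f (x + h *\<^sub>R u + h *\<^sub>R v) - f (x + h *\<^sub>R u + 0 *\<^sub>R v)) -
      (f (x + 0 *\<^sub>R u + h *\<^sub>R v) - f (x + 0 *\<^sub>R u + 0 *\<^sub>R v)) =
      (h - 0) * (?Df (x + s *\<^sub>R u + h *\<^sub>R v) - ?Df (x + s *\<^sub>R u + 0 *\<^sub>R v))"
    by (rule MVT2[OF h(1)], rule DERIV_diff[OF d1 d1]) (use h in auto)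
  then obtain s where s: "0 < s" "s < h" and eq1: "f (x + h *\<^sub>R u + h *\<^sub>R v) - f (x + h *\<^sub>R u) -
      f (x + h *\<^sub>R v) + f x = h * (?Df (x + s *\<^sub>R u + h *\<^sub>R v) - ?Df (x + s *\<^sub>R u + 0 *\<^sub>R v))"
    by auto
  have "\<exists>t. 0 < t \<and> t < h \<and> ?Df (x + s *\<^sub>R u + h *\<^sub>R v) - ?Df (x + s *\<^sub>R u + 0 *\<^sub>R v) =
      (h - 0) * frechet_derivative ?Df (at (x + s *\<^sub>R u + t *\<^sub>R v)) v"
    by (rule MVT2[OF h(1)], rule d2) (use s in auto)
  then obtain t where t: "0 < t" "t < h" and eq2: "?Df (x + s *\<^sub>R u + h *\<^sub>R v) - ?Df (x + s *\<^sub>R u + 0 *\<^sub>R v) =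
      h * frechet_derivative ?Df (at (x + s *\<^sub>R u + t *\<^sub>R v)) v" by auto
  show ?thesis
  proof (intro exI conjI)
    show "dist x (x + s *\<^sub>R u + t *\<^sub>R v) \<le> h * (norm u + norm v)"
      using near[of s t] s t
      by (simp add: dist_norm norm_minus_commute flip: norm_minus_cancel[of "s *\<^sub>R u + t *\<^sub>R v"])
  qed (use eq1 eq2 in \<open>simp add: power2_eq_square\<close>)
qed

text \<open>Both orders of differentiation describe the same second difference over a shrinking
  parallelogram, at two points that tend to \<open>x\<close>; continuity of the second derivatives
  identifies the limits.\<close>

lemma second_derivative_symmetric_real:
  fixes f :: "'a::euclidean_space \<Rightarrow> real"
  assumes f: "smooth_on S f" and S: "open S" "x \<in> S"
  shows "frechet_derivative (\<lambda>y. frechet_derivative f (at y) u) (at x) v =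
    frechet_derivative (\<lambda>y. frechet_derivative f (at y) v) (at x) u" (is "?F u v x = ?F v u x")
proof -
  obtain r where r: "r > 0" "ball x r \<subseteq> S" using S openE by blast
  \<comment> \<open>The summand 1 keeps \<open>K\<close> positive when \<open>u = v = 0\<close>;
    dividing \<open>r\<close> by \<open>K\<close> keeps the parallelogram inside the ball.\<close>
  define K where "K = norm u + norm v + 1"
  have K: "K > 0" "norm u + norm v < K" by (simp_all add: K_def add_nonneg_pos)
  define h where "h = (\<lambda>n. r / (K * real (Suc n)))"
  have h0: "h n > 0" for n using r K by (simp add: h_def)
  have hr: "h n * (norm u + norm v) < r" for n
  proof -
    have "h n * (norm u + norm v) < h n * K" using h0 K by simp
    also have "\<dots> = r / real (Suc n)" using K by (simp add: h_def)
    also have "\<dots> \<le> r" using r by (simp add: field_simps)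
    finally show ?thesis .
  qed
  have "(\<lambda>n. (r / K) * (1 / real (Suc n))) \<longlonglongrightarrow> (r / K) * 0"
    by (intro tendsto_intros LIMSEQ_Suc lim_1_over_n)
  then have "h \<longlonglongrightarrow> 0" by (simp add: h_def[abs_def])
  then have hl: "(\<lambda>n. h n * (norm u + norm v)) \<longlonglongrightarrow> 0"
    using tendsto_mult_left_zero by blast
  obtain a where a: "\<And>n. dist x (a n) \<le> h n * (norm u + norm v)"
    "\<And>n. f (x + h n *\<^sub>R u + h n *\<^sub>R v) - f (x + h n *\<^sub>R u) - f (x + h n *\<^sub>R v) + f x = (h n)\<^sup>2 * ?F u v (a n)"
    using second_difference_mean_value[OF f r(2) h0 hr] by metis
  obtain b where b: "\<And>n. dist x (b n) \<le> h n * (norm v + norm u)"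
    "\<And>n. f (x + h n *\<^sub>R v + h n *\<^sub>R u) - f (x + h n *\<^sub>R v) - f (x + h n *\<^sub>R u) + f x = (h n)\<^sup>2 * ?F v u (b n)"
    using second_difference_mean_value[OF f r(2) h0, of _ v u] hr by (metis add.commute)
  have ab: "?F u v (a n) = ?F v u (b n)" for n
  proof -
    have "f (x + h n *\<^sub>R u + h n *\<^sub>R v) = f (x + h n *\<^sub>R v + h n *\<^sub>R u)"
      by (simp add: algebra_simps)
    then have "(h n)\<^sup>2 * ?F u v (a n) = (h n)\<^sup>2 * ?F v u (b n)"
      using a(2)[of n] b(2)[of n] by linarith
    then show ?thesis using h0[of n] by simp
  qed
  have cont: "isCont (\<lambda>y. ?F p q y) x" for p q
    using smooth_on_continuous[OF smooth_on_derivative[OF smooth_on_derivative[OF f]]] S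
    by (auto simp: continuous_on_eq_continuous_at)
  have lim: "c \<longlonglongrightarrow> x" if "\<And>n. dist x (c n) \<le> h n * (norm u + norm v)" for c
    using tendsto_sandwich[OF _ _ tendsto_const hl, of "\<lambda>n. dist (c n) x"] that
    by (subst tendsto_dist_iff) (auto simp: dist_commute)
  have "(\<lambda>n. ?F u v (a n)) \<longlonglongrightarrow> ?F u v x" "(\<lambda>n. ?F v u (b n)) \<longlonglongrightarrow> ?F v u x"
    using isCont_tendsto_compose[OF cont lim] a(1) b(1) by (auto simp: add.commute)
  then show ?thesis using ab LIMSEQ_unique by simp
qed

lemma frechet_derivative_linear_compose:
  assumes "bounded_linear h" "f differentiable (at x)"
  shows "frechet_derivative (\<lambda>y. h (f y)) (at x) v = h (frechet_derivative f (at x) v)"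
  by (rule frechet_derivative_eqI, rule bounded_linear.has_derivative[OF assms(1)])
    (use assms(2) frechet_derivative_works in blast)

lemma second_derivative_symmetric:
  fixes f :: "'a::euclidean_space \<Rightarrow> 'b::euclidean_space"
  assumes f: "smooth_on S f" and S: "open S" "x \<in> S"
  shows "frechet_derivative (\<lambda>y. frechet_derivative f (at y) u) (at x) v =
    frechet_derivative (\<lambda>y. frechet_derivative f (at y) v) (at x) u"
proof (rule euclidean_eqI)
  fix b :: 'b
  let ?i = "\<lambda>z. z \<bullet> b"
  have eq: "?i (frechet_derivative (\<lambda>y. frechet_derivative f (at y) u) (at x) v) =
     frechet_derivative (\<lambda>y. frechet_derivative (\<lambda>y. ?i (f y)) (at y) u) (at x) v" for u v
  proof -
    have "frechet_derivative (\<lambda>y. frechet_derivative (\<lambda>y. ?i (f y)) (at y) u) (at x) =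
      frechet_derivative (\<lambda>y. ?i (frechet_derivative f (at y) u)) (at x)"
    proof (rule frechet_derivative_transform_within_open[OF _ S])
      show "(\<lambda>y. frechet_derivative (\<lambda>y. ?i (f y)) (at y) u) differentiable (at x)"
        by (rule smooth_on_differentiable[OF smooth_on_derivative[OF
                smooth_on_linear_compose[OF S(1) bounded_linear_inner_left f]] S(2)])
    qed (intro frechet_derivative_linear_compose bounded_linear_inner_left smooth_on_differentiable[OF f])
    then show ?thesis
      using frechet_derivative_linear_compose[OF bounded_linear_inner_left
          smooth_on_differentiable[OF smooth_on_derivative[OF f] S(2)]] by metis
  qed
  show "?i (frechet_derivative (\<lambda>y. frechet_derivative f (at y) u) (at x) v) =
    ?i (frechet_derivative (\<lambda>y. frechet_derivative f (at y) v) (at x) u)"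
    unfolding eq
    by (rule second_derivative_symmetric_real[OF smooth_on_linear_compose[OF S(1) bounded_linear_inner_left f] S])
qed

section \<open>Product rule for families of bilinear maps\<close>

lemma bilinear_euclidean_expansion:
  fixes b :: "'b::euclidean_space \<Rightarrow> 'c::euclidean_space \<Rightarrow> 'd::real_normed_vector"
  assumes "bilinear b"
  shows "b u v = (\<Sum>i\<in>Basis. \<Sum>j\<in>Basis. ((u \<bullet> i) * (v \<bullet> j)) *\<^sub>R b i j)"
proof -
  have "b u v = b (\<Sum>i\<in>Basis. (u \<bullet> i) *\<^sub>R i) (\<Sum>j\<in>Basis. (v \<bullet> j) *\<^sub>R j)"
    by (simp add: euclidean_representation)
  also have "\<dots> = (\<Sum>i\<in>Basis. \<Sum>j\<in>Basis. ((u \<bullet> i) * (v \<bullet> j)) *\<^sub>R b i j)"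
    by (simp add: bilinear_sum[OF assms] bilinear_lmul[OF assms] bilinear_rmul[OF assms]
        sum.cartesian_product case_prod_unfold mult.commute)
  finally show ?thesis .
qed

text \<open>Expansion in bases reduces the moving arguments to scalar coefficients, so only
  derivatives of \<open>B\<close> at fixed arguments are required. The applications are the
  Christoffel symbols and the second derivative of the exponential map.\<close>

lemma has_vector_derivative_bilinear_family:
  fixes B :: "'a::euclidean_space \<Rightarrow> 'b::euclidean_space \<Rightarrow> 'c::euclidean_space \<Rightarrow> 'd::real_normed_vector"
  assumes S: "open S" "x t \<in> S" and bil: "\<And>y. y \<in> S \<Longrightarrow> bilinear (B y)"
    and dif: "\<And>a b. (\<lambda>y. B y a b) differentiable (at (x t))"
    and x: "(x has_vector_derivative x') (at t)"
    and u: "(u has_vector_derivative u') (at t)" and v: "(v has_vector_derivative v') (at t)"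
  shows "((\<lambda>s. B (x s) (u s) (v s)) has_vector_derivative
    (frechet_derivative (\<lambda>y. B y (u t) (v t)) (at (x t)) x' + B (x t) u' (v t) + B (x t) (u t) v')) (at t)"
proof -
  note e = bilinear_euclidean_expansion[OF bil]
  let ?d = "\<lambda>i j. frechet_derivative (\<lambda>y. B y i j) (at (x t))"
  have hd: "((\<lambda>y. B y i j) has_derivative ?d i j) (at (x t))" for i j
    using dif frechet_derivative_works by blast
  have "((\<lambda>y. \<Sum>i\<in>Basis. \<Sum>j\<in>Basis. ((u t \<bullet> i) * (v t \<bullet> j)) *\<^sub>R B y i j) has_derivative
     (\<lambda>h. \<Sum>i\<in>Basis. \<Sum>j\<in>Basis. ((u t \<bullet> i) * (v t \<bullet> j)) *\<^sub>R ?d i j h)) (at (x t))"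
    by (intro has_derivative_sum has_derivative_scaleR_right hd)
  then have "((\<lambda>y. B y (u t) (v t)) has_derivative
     (\<lambda>h. \<Sum>i\<in>Basis. \<Sum>j\<in>Basis. ((u t \<bullet> i) * (v t \<bullet> j)) *\<^sub>R ?d i j h)) (at (x t))"
    by (rule has_derivative_transform_within_open[OF _ S]) (rule e[symmetric])
  then have D: "frechet_derivative (\<lambda>y. B y (u t) (v t)) (at (x t)) x' =
     (\<Sum>i\<in>Basis. \<Sum>j\<in>Basis. ((u t \<bullet> i) * (v t \<bullet> j)) *\<^sub>R ?d i j x')"
    by (rule frechet_derivative_eqI)
  have r: "((\<lambda>s. u s \<bullet> i) has_real_derivative u' \<bullet> i) (at t)" "((\<lambda>s. v s \<bullet> j) has_real_derivative v' \<bullet> j) (at t)" for i j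
    using bounded_linear.has_vector_derivative[OF bounded_linear_inner_left u]
      bounded_linear.has_vector_derivative[OF bounded_linear_inner_left v]
    by (auto simp: has_real_derivative_iff_has_vector_derivative)
  have c: "((\<lambda>s. B (x s) i j) has_vector_derivative ?d i j x') (at t)" for i j
    using diff_chain_at[OF x[unfolded has_vector_derivative_def] hd[of i j]]
      linear_cmul[OF linear_frechet_derivative[OF dif]]
    by (simp add: has_vector_derivative_def o_def)
  have "((\<lambda>s. \<Sum>i\<in>Basis. \<Sum>j\<in>Basis. ((u s \<bullet> i) * (v s \<bullet> j)) *\<^sub>R B (x s) i j) has_vector_derivative
     (\<Sum>i\<in>Basis. \<Sum>j\<in>Basis. ((u t \<bullet> i) * (v t \<bullet> j)) *\<^sub>R ?d i j x' +
       ((u' \<bullet> i) * (v t \<bullet> j) + (v' \<bullet> j) * (u t \<bullet> i)) *\<^sub>R B (x t) i j)) (at t)"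
    by (intro has_vector_derivative_sum has_vector_derivative_scaleR c DERIV_mult r)
  also have "(\<Sum>i\<in>Basis. \<Sum>j\<in>Basis. ((u t \<bullet> i) * (v t \<bullet> j)) *\<^sub>R ?d i j x' +
       ((u' \<bullet> i) * (v t \<bullet> j) + (v' \<bullet> j) * (u t \<bullet> i)) *\<^sub>R B (x t) i j) =
     frechet_derivative (\<lambda>y. B y (u t) (v t)) (at (x t)) x' + B (x t) u' (v t) + B (x t) (u t) v'"
    unfolding D e[OF S(2), of u' "v t"] e[OF S(2), of "u t" v']
    by (simp add: sum.distrib scaleR_add_left mult.commute)
  finally have d: "((\<lambda>s. \<Sum>i\<in>Basis. \<Sum>j\<in>Basis. ((u s \<bullet> i) * (v s \<bullet> j)) *\<^sub>R B (x s) i j) has_vector_derivative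
    (frechet_derivative (\<lambda>y. B y (u t) (v t)) (at (x t)) x' + B (x t) u' (v t) + B (x t) (u t) v')) (at t)" .
  have "eventually (\<lambda>s. x s \<in> S) (nhds t)"
    by (rule eventually_curve_in_open[OF x S])
  then have "eventually (\<lambda>s. (\<Sum>i\<in>Basis. \<Sum>j\<in>Basis. ((u s \<bullet> i) * (v s \<bullet> j)) *\<^sub>R B (x s) i j) = B (x s) (u s) (v s)) (nhds t)"
    by eventually_elim (rule e[symmetric])
  with d show ?thesis by (rule has_vector_derivative_transform_nhds)
qed

section \<open>Curves of matrices: products, inverses, determinants\<close>

lemma has_vector_derivative_vec:
  fixes f :: "real \<Rightarrow> ('b::real_normed_vector)^'n"
  assumes "\<And>i. ((\<lambda>t. f t $ i) has_vector_derivative f' $ i) (at t)"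
  shows "(f has_vector_derivative f') (at t)"
proof -
  have "((\<lambda>t. \<Sum>i\<in>UNIV. axis i (f t $ i)) has_vector_derivative (\<Sum>i\<in>UNIV. axis i (f' $ i))) (at t)"
    by (intro has_vector_derivative_sum bounded_linear.has_vector_derivative[OF bounded_linear_axis] assms)
  then show ?thesis by (simp flip: vec_as_sum_axis)
qed

lemma has_vector_derivative_nth:
  fixes f :: "real \<Rightarrow> ('b::real_normed_vector)^'n"
  shows "(f has_vector_derivative f') (at t) \<Longrightarrow> ((\<lambda>t. f t $ i) has_vector_derivative f' $ i) (at t)"
  by (rule bounded_linear.has_vector_derivative[OF bounded_linear_vec_nth])

lemma matrix_mult_distribs:
  fixes A B :: "real^'n^'m" and C D :: "real^'l^'n"
  shows "(A + B) ** C = A ** C + B ** C" "A ** (C + D) = A ** C + A ** D"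
    "(A - B) ** C = A ** C - B ** C" "A ** (C - D) = A ** C - A ** D"
    "(- A) ** C = - (A ** C)" "A ** (- C) = - (A ** C)"
    "(r *\<^sub>R A) ** C = r *\<^sub>R (A ** C)" "A ** (r *\<^sub>R C) = r *\<^sub>R (A ** C)"
    "(0 :: real^'n^'m) ** C = 0" "A ** (0 :: real^'l^'n) = 0"
  by (simp_all add: vec_eq_iff matrix_matrix_mult_def sum.distrib sum_subtractf sum_negf sum_distrib_left algebra_simps)

lemma has_vector_derivative_matrix_mult:
  fixes f :: "real \<Rightarrow> real^'n^'m" and g :: "real \<Rightarrow> real^'l^'n"
  assumes "(f has_vector_derivative f') (at t)" "(g has_vector_derivative g') (at t)"
  shows "((\<lambda>t. f t ** g t) has_vector_derivative (f t ** g' + f' ** g t)) (at t)"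
proof (intro has_vector_derivative_vec)
  fix i j
  have "((\<lambda>t. \<Sum>k\<in>UNIV. f t $ i $ k * g t $ k $ j) has_vector_derivative
     (\<Sum>k\<in>UNIV. f t $ i $ k * g' $ k $ j + f' $ i $ k * g t $ k $ j)) (at t)"
    by (intro has_vector_derivative_sum has_vector_derivative_mult has_vector_derivative_nth assms)
  then show "((\<lambda>t. (f t ** g t) $ i $ j) has_vector_derivative (f t ** g' + f' ** g t) $ i $ j) (at t)"
    by (simp add: matrix_matrix_mult_def sum.distrib)
qed

text \<open>The product with \<open>f\<close> is constantly the identity near \<open>t\<close>, and
  differentiating it determines the derivative of the inverse. Its existence is an assumption, met
  later through Cramer's rule.\<close>

lemma has_vector_derivative_matrix_inv:
  fixes f :: "real \<Rightarrow> real^'n^'n"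
  assumes "(\<lambda>s. matrix_inv (f s)) differentiable (at t)"
    and "(f has_vector_derivative f') (at t)" "eventually (\<lambda>s. det (f s) \<noteq> 0) (nhds t)"
  shows "((\<lambda>s. matrix_inv (f s)) has_vector_derivative
    (- (matrix_inv (f t) ** f' ** matrix_inv (f t)))) (at t)"
proof -
  from assms(1) obtain i' where i: "((\<lambda>s. matrix_inv (f s)) has_vector_derivative i') (at t)"
    using vector_derivative_works by blast
  have d0: "det (f t) \<noteq> 0" using assms(3) eventually_nhds_x_imp_x by blast
  have "((\<lambda>s. matrix_inv (f s) ** f s) has_vector_derivative (matrix_inv (f t) ** f' + i' ** f t)) (at t)"
    by (rule has_vector_derivative_matrix_mult[OF i assms(2)])
  moreover have "((\<lambda>s. matrix_inv (f s) ** f s) has_vector_derivative 0) (at t)"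
    by (rule has_vector_derivative_transform_nhds[where f = "\<lambda>s. mat 1"])
      (simp, rule eventually_mono[OF assms(3)], simp add: matrix_inv_mult(2))
  ultimately have "matrix_inv (f t) ** f' + i' ** f t = 0"
    using vector_derivative_unique_at by blast
  then have "(matrix_inv (f t) ** f' + i' ** f t) ** matrix_inv (f t) = 0" by (simp add: matrix_mult_distribs)
  then have "matrix_inv (f t) ** f' ** matrix_inv (f t) + i' = 0"
    by (simp add: matrix_mult_distribs matrix_mul_assoc[symmetric] matrix_inv_mult[OF d0])
  then have "i' = - (matrix_inv (f t) ** f' ** matrix_inv (f t))"
    by (simp add: add_eq_0_iff)
  then show ?thesis using i by simp
qed

text \<open>In the permutation expansion a permutation other than the identity moves at least two
  indices, so after one factor is differentiated an off-diagonal entry of the identity matrix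
  remains. Only the diagonal product contributes.\<close>

lemma has_real_derivative_det_at_one:
  fixes X :: "real \<Rightarrow> real^'n^'n"
  assumes X: "(X has_vector_derivative X') (at t)" and one: "X t = mat 1"
  shows "((\<lambda>s. det (X s)) has_real_derivative trace X') (at t)"
proof -
  let ?P = "{p. p permutes (UNIV::'n set)}"
  have e: "((\<lambda>s. X s $ i $ j) has_derivative (\<lambda>h. h * X' $ i $ j)) (at t)" for i j
    using has_vector_derivative_nth[OF has_vector_derivative_nth[OF X]]
    by (simp add: has_vector_derivative_def)
  have "((\<lambda>s. det (X s)) has_derivative
    (\<lambda>h. \<Sum>p\<in>?P. of_int (sign p) * (\<Sum>i\<in>UNIV. h * X' $ i $ p i * (\<Prod>j\<in>UNIV - {i}. X t $ j $ p j)))) (at t)"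
    unfolding det_def
    by (intro has_derivative_sum has_derivative_mult_right has_derivative_prod e)
  also have "(\<lambda>h. \<Sum>p\<in>?P. of_int (sign p) * (\<Sum>i\<in>UNIV. h * X' $ i $ p i * (\<Prod>j\<in>UNIV - {i}. X t $ j $ p j))) =
    (\<lambda>h. h * trace X')"
  proof
    fix h
    have z: "(\<Prod>j\<in>UNIV - {i}. X t $ j $ p j) = 0" if p: "p permutes UNIV" "p \<noteq> id" for p i
    proof -
      have "\<exists>j. j \<noteq> i \<and> p j \<noteq> j"
      proof (rule ccontr)
        assume n: "\<not> ?thesis"
        have "p i = i"
          using n permutes_inj[OF p(1)] by (metis injD)
        then have "p = id" using n by (metis eq_id_iff)
        then show False using p by simp
      qed
      then show ?thesis by (auto simp: one mat_def intro!: bexI)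
    qed
    have "(\<Sum>p\<in>?P. of_int (sign p) * (\<Sum>i\<in>UNIV. h * X' $ i $ p i * (\<Prod>j\<in>UNIV - {i}. X t $ j $ p j))) =
      (\<Sum>p\<in>{id}. of_int (sign p) * (\<Sum>i\<in>UNIV. h * X' $ i $ p i * (\<Prod>j\<in>UNIV - {i}. X t $ j $ p j)))"
      by (rule sum.mono_neutral_right) (auto simp: z permutes_id)
    also have "\<dots> = h * trace X'"
      by (simp add: one mat_def trace_def sum_distrib_left)
    finally show "(\<Sum>p\<in>?P. of_int (sign p) * (\<Sum>i\<in>UNIV. h * X' $ i $ p i * (\<Prod>j\<in>UNIV - {i}. X t $ j $ p j))) = h * trace X'" .
  qed
  finally show ?thesis
    by (simp add: has_real_derivative_iff_has_vector_derivative has_vector_derivative_def)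

qed

text \<open>Jacobi's formula, reduced to the previous case by splitting off the constant factor
  \<open>X t\<close>.\<close>

lemma has_real_derivative_det:
  fixes X :: "real \<Rightarrow> real^'n^'n"
  assumes X: "(X has_vector_derivative X') (at t)" and d: "det (X t) \<noteq> 0"
  shows "((\<lambda>s. det (X s)) has_real_derivative det (X t) * trace (matrix_inv (X t) ** X')) (at t)"
proof -
  have "((\<lambda>s. matrix_inv (X t) ** X s) has_vector_derivative (matrix_inv (X t) ** X' + 0 ** X t)) (at t)"
    by (rule has_vector_derivative_matrix_mult[OF has_vector_derivative_const X])
  then have "((\<lambda>s. matrix_inv (X t) ** X s) has_vector_derivative matrix_inv (X t) ** X') (at t)"
    by (simp add: matrix_mult_distribs)
  from has_real_derivative_det_at_one[OF this]
  have "((\<lambda>s. det (matrix_inv (X t) ** X s)) has_real_derivative trace (matrix_inv (X t) ** X')) (at t)"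
    by (simp add: matrix_inv_mult[OF d])
  from DERIV_cmult[OF this, of "det (X t)"]
  have "((\<lambda>s. det (X t) * det (matrix_inv (X t) ** X s)) has_real_derivative
    det (X t) * trace (matrix_inv (X t) ** X')) (at t)" .
  moreover have "det (X t) * det (matrix_inv (X t) ** X s) = det (X s)" for s
    by (simp add: det_mul[symmetric] matrix_mul_assoc matrix_inv_mult[OF d])
  ultimately show ?thesis by simp
qed

lemma has_vector_derivative_matrix_vector_mult:
  fixes f :: "real \<Rightarrow> real^'n^'m" and g :: "real \<Rightarrow> real^'n"
  assumes "(f has_vector_derivative f') (at t)" "(g has_vector_derivative g') (at t)"
  shows "((\<lambda>t. f t *v g t) has_vector_derivative (f t *v g' + f' *v g t)) (at t)"
proof (intro has_vector_derivative_vec)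
  fix i
  have "((\<lambda>t. \<Sum>k\<in>UNIV. f t $ i $ k * g t $ k) has_vector_derivative
     (\<Sum>k\<in>UNIV. f t $ i $ k * g' $ k + f' $ i $ k * g t $ k)) (at t)"
    by (intro has_vector_derivative_sum has_vector_derivative_mult has_vector_derivative_nth assms)
  then show "((\<lambda>t. (f t *v g t) $ i) has_vector_derivative (f t *v g' + f' *v g t) $ i) (at t)"
    by (simp add: matrix_vector_mult_def sum.distrib)
qed

lemma symmetric_matrix_inner:
  fixes A :: "real^'n^'n"
  assumes "transpose A = A"
  shows "(A *v x) \<bullet> y = x \<bullet> (A *v y)"
  by (metis assms dot_lmul_matrix transpose_matrix_vector)

lemma bounded_linear_transpose: "bounded_linear (transpose :: real^'n^'m \<Rightarrow> real^'m^'n)"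
proof -
  have "linear (transpose :: real^'n^'m \<Rightarrow> real^'m^'n)"
    by (auto intro!: linearI simp: transpose_def vec_eq_iff)
  then show ?thesis by (simp add: linear_conv_bounded_linear)
qed

lemma transpose_frechet_derivative:
  fixes f :: "'a::euclidean_space \<Rightarrow> real^'n^'n"
  assumes f: "smooth_on S f" "open S" "x \<in> S" and sym: "\<And>y. y \<in> S \<Longrightarrow> transpose (f y) = f y"
  shows "transpose (frechet_derivative f (at x) v) = frechet_derivative f (at x) v"
proof -
  have "frechet_derivative f (at x) = frechet_derivative (\<lambda>y. transpose (f y)) (at x)"
    by (rule frechet_derivative_transform_within_open[OF smooth_on_differentiable[OF f(1,3)] f(2,3)])
      (simp add: sym)
  then show ?thesis
    using frechet_derivative_linear_compose[OF bounded_linear_transpose smooth_on_differentiable[OF f(1,3)]]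
    by metis
qed

lemma linear_sum_axis:
  fixes f :: "real^'n \<Rightarrow> 'b::real_normed_vector"
  assumes "linear f"
  shows "f v = (\<Sum>i\<in>UNIV. v $ i *\<^sub>R f (axis i 1))"
proof -
  have "f v = f (\<Sum>i\<in>UNIV. v $ i *\<^sub>R axis i 1)"
    by (metis basis_expansion scalar_mult_eq_scaleR)
  then show ?thesis by (simp add: linear_sum[OF assms] linear_cmul[OF assms])
qed

subsection \<open>Levi-Civita connection in coordinates\<close>

text \<open>A chart reduced to its coordinate data, so that curvature identities are proved on an
  open subset of Euclidean space. Every chart of the atlas is an instance by
  \<open>coordinate_metric_chart\<close>.\<close>

locale coordinate_metric =
  fixes \<Omega> :: "(real^'n) set" and G :: "real^'n \<Rightarrow> real^'n^'n"
  assumes open_domain: "open \<Omega>" and smooth_metric: "smooth_on \<Omega> G"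
    and symmetric_metric: "\<And>x. x \<in> \<Omega> \<Longrightarrow> transpose (G x) = G x"
    and positive_metric: "\<And>x v. x \<in> \<Omega> \<Longrightarrow> v \<noteq> 0 \<Longrightarrow> v \<bullet> (G x *v v) > 0"
begin

abbreviation "\<Gamma> \<equiv> christoffel_vec G"

abbreviation "DG x w \<equiv> frechet_derivative G (at x) w"

abbreviation "DDG x w u \<equiv> frechet_derivative (\<lambda>y. DG y u) (at x) w"

abbreviation "D\<Gamma> x w u v \<equiv> frechet_derivative (\<lambda>y. \<Gamma> y u v) (at x) w"

lemma det_metric: "x \<in> \<Omega> \<Longrightarrow> det (G x) \<noteq> 0"
proof -
  assume x: "x \<in> \<Omega>"
  have "\<forall>v. G x *v v = 0 \<longrightarrow> v = 0"
    using positive_metric[OF x] by force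
  then show ?thesis
    by (metis invertible_det_nz invertible_left_inverse matrix_left_invertible_ker)
qed

lemma metric_cancel: "x \<in> \<Omega> \<Longrightarrow> (\<And>w. (G x *v u) \<bullet> w = (G x *v v) \<bullet> w) \<Longrightarrow> u = v"
proof -
  assume x: "x \<in> \<Omega>" and "\<And>w. (G x *v u) \<bullet> w = (G x *v v) \<bullet> w"
  then have "G x *v u = G x *v v" by (metis vector_eq_rdot)
  then have "matrix_inv (G x) *v (G x *v u) = matrix_inv (G x) *v (G x *v v)" by simp
  then show "u = v" by (simp add: matrix_vector_mul_assoc matrix_inv_mult[OF det_metric[OF x]])
qed

lemma metric_derivative_trilinear:
  assumes "x \<in> \<Omega>"
  shows "b \<bullet> (DG x a *v c) =
    (\<Sum>i\<in>UNIV. \<Sum>j\<in>UNIV. \<Sum>l\<in>UNIV. a $ i * b $ j * c $ l * metric_partial G x i j l)"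
proof -
  have "linear (DG x)"
    by (rule linear_frechet_derivative[OF smooth_on_differentiable[OF smooth_metric assms]])
  then have "DG x a = (\<Sum>i\<in>UNIV. a $ i *\<^sub>R DG x (axis i 1))" by (rule linear_sum_axis)
  then have "DG x a $ j $ l = (\<Sum>i\<in>UNIV. a $ i * metric_partial G x i j l)" for j l
    by (simp add: metric_partial_def)
  then have "b \<bullet> (DG x a *v c) =
     (\<Sum>j\<in>UNIV. \<Sum>l\<in>UNIV. \<Sum>i\<in>UNIV. a $ i * b $ j * c $ l * metric_partial G x i j l)"
    by (simp add: inner_vec_def matrix_vector_mult_def sum_distrib_left sum_distrib_right mult_ac)
  also have "\<dots> = (\<Sum>j\<in>UNIV. \<Sum>i\<in>UNIV. \<Sum>l\<in>UNIV. a $ i * b $ j * c $ l * metric_partial G x i j l)"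
    by (intro sum.cong refl sum.swap)
  also have "\<dots> = (\<Sum>i\<in>UNIV. \<Sum>j\<in>UNIV. \<Sum>l\<in>UNIV. a $ i * b $ j * c $ l * metric_partial G x i j l)"
    by (rule sum.swap)
  finally show ?thesis .
qed

text \<open>Lowering the index cancels \<open>matrix_inv\<close> and leaves the Koszul formula for
  fields with constant components. Symmetry, metricity and the self-adjointness of the Jacobi
  operator are derived from this form.\<close>

lemma lowered_christoffel:
  assumes x: "x \<in> \<Omega>"
  shows "(G x *v \<Gamma> x u v) \<bullet> w =
    (v \<bullet> (DG x u *v w) + u \<bullet> (DG x v *v w) - u \<bullet> (DG x w *v v)) / 2"
proof -
  let ?m = "metric_partial G x"
  define c where "c = (\<lambda>i j. (\<chi> l. ?m i j l + ?m j i l - ?m l i j))"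
  have "\<Gamma> x u v = (\<Sum>i\<in>UNIV. \<Sum>j\<in>UNIV. ((u $ i * v $ j) / 2) *\<^sub>R (matrix_inv (G x) *v c i j))"
    by (simp add: christoffel_vec_def christoffel_def vec_eq_iff matrix_vector_mult_def c_def mult_ac)
  then have "G x *v \<Gamma> x u v = (\<Sum>i\<in>UNIV. \<Sum>j\<in>UNIV. ((u $ i * v $ j) / 2) *\<^sub>R c i j)"
    by (simp add: linear_sum[OF matrix_vector_mul_linear] matrix_vector_mult_scaleR
        matrix_vector_mul_assoc matrix_inv_mult[OF det_metric[OF x]])
  then have "(G x *v \<Gamma> x u v) \<bullet> w =
     (\<Sum>i\<in>UNIV. \<Sum>j\<in>UNIV. \<Sum>l\<in>UNIV. u $ i * v $ j * w $ l * (?m i j l + ?m j i l - ?m l i j)) / 2"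
    by (simp add: inner_sum_left sum_divide_distrib) (simp add: inner_vec_def c_def sum_distrib_left sum_divide_distrib mult_ac)
  also have "(\<Sum>i\<in>UNIV. \<Sum>j\<in>UNIV. \<Sum>l\<in>UNIV. u $ i * v $ j * w $ l * (?m i j l + ?m j i l - ?m l i j)) =
     (\<Sum>i\<in>UNIV. \<Sum>j\<in>UNIV. \<Sum>l\<in>UNIV. u $ i * v $ j * w $ l * ?m i j l) +
     (\<Sum>i\<in>UNIV. \<Sum>j\<in>UNIV. \<Sum>l\<in>UNIV. u $ i * v $ j * w $ l * ?m j i l) -
     (\<Sum>i\<in>UNIV. \<Sum>j\<in>UNIV. \<Sum>l\<in>UNIV. u $ i * v $ j * w $ l * ?m l i j)"
    by (simp add: sum.distrib sum_subtractf algebra_simps)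
  also have "(\<Sum>i\<in>UNIV. \<Sum>j\<in>UNIV. \<Sum>l\<in>UNIV. u $ i * v $ j * w $ l * ?m j i l) = u \<bullet> (DG x v *v w)"
    unfolding metric_derivative_trilinear[OF x] by (subst sum.swap) (simp add: mult_ac)
  also have "(\<Sum>i\<in>UNIV. \<Sum>j\<in>UNIV. \<Sum>l\<in>UNIV. u $ i * v $ j * w $ l * ?m l i j) =
      (\<Sum>i\<in>UNIV. \<Sum>l\<in>UNIV. \<Sum>j\<in>UNIV. u $ i * v $ j * w $ l * ?m l i j)"
    by (intro sum.cong refl sum.swap)
  also have "\<dots> = u \<bullet> (DG x w *v v)"
    unfolding metric_derivative_trilinear[OF x] by (subst sum.swap) (simp add: mult_ac)
  finally show ?thesis unfolding metric_derivative_trilinear[OF x, of v u w] by simp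
qed

lemma bilinear_christoffel: "bilinear (\<Gamma> x)"
  unfolding bilinear_def
  by (auto intro!: linearI simp: christoffel_vec_def vec_eq_iff sum.distrib sum_distrib_left algebra_simps)

lemmas christoffel_linear =
  bilinear_ladd[OF bilinear_christoffel] bilinear_radd[OF bilinear_christoffel]
  bilinear_lmul[OF bilinear_christoffel] bilinear_rmul[OF bilinear_christoffel]
  bilinear_lzero[OF bilinear_christoffel] bilinear_rzero[OF bilinear_christoffel]

lemma transpose_DG: "x \<in> \<Omega> \<Longrightarrow> transpose (DG x w) = DG x w"
  by (rule transpose_frechet_derivative[OF smooth_metric open_domain _ symmetric_metric])

lemma transpose_DDG: "x \<in> \<Omega> \<Longrightarrow> transpose (DDG x w u) = DDG x w u"
  by (rule transpose_frechet_derivative[OF smooth_on_derivative[OF smooth_metric] open_domain _ transpose_DG])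

lemma DDG_commute: "x \<in> \<Omega> \<Longrightarrow> DDG x w u = DDG x u w"
  by (rule second_derivative_symmetric[OF smooth_metric open_domain])

lemma christoffel_commute: "x \<in> \<Omega> \<Longrightarrow> \<Gamma> x u v = \<Gamma> x v u"
  by (rule metric_cancel, assumption)
    (simp add: lowered_christoffel, metis inner_commute symmetric_matrix_inner transpose_DG)

lemma metric_compatible:
  assumes x: "x \<in> \<Omega>"
  shows "a \<bullet> (DG x w *v b) = (G x *v \<Gamma> x w a) \<bullet> b + (G x *v \<Gamma> x w b) \<bullet> a"
proof -
  have "b \<bullet> (DG x w *v a) = a \<bullet> (DG x w *v b)"
    by (metis x inner_commute symmetric_matrix_inner transpose_DG)
  then show ?thesis by (simp add: lowered_christoffel[OF x] field_simps)
qed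

lemma smooth_christoffel: "smooth_on \<Omega> (\<lambda>x. \<Gamma> x u v)"
proof (intro smooth_on_vec open_domain)
  fix k
  show "smooth_on \<Omega> (\<lambda>x. \<Gamma> x u v $ k)"
    unfolding christoffel_vec_def christoffel_def metric_partial_def
    by (simp only: vec_lambda_beta, intro smooth_on_sum smooth_on_mult smooth_on_const smooth_on_add smooth_on_diff smooth_on_nth
        open_domain smooth_on_derivative smooth_metric smooth_on_matrix_inv det_metric)
qed

lemma christoffel_differentiable: "x \<in> \<Omega> \<Longrightarrow> (\<lambda>y. \<Gamma> y u v) differentiable (at x)"
  by (rule smooth_on_differentiable[OF smooth_christoffel])

lemma linear_D\<Gamma>: "x \<in> \<Omega> \<Longrightarrow> linear (\<lambda>w. D\<Gamma> x w u v)"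
  by (rule linear_frechet_derivative[OF christoffel_differentiable])

lemma D\<Gamma>_commute:
  assumes "x \<in> \<Omega>"
  shows "D\<Gamma> x w u v = D\<Gamma> x w v u"
  using frechet_derivative_transform_within_open[OF christoffel_differentiable open_domain _ christoffel_commute] assms
  by metis

lemma bilinear_D\<Gamma>:
  assumes x: "x \<in> \<Omega>"
  shows "bilinear (D\<Gamma> x w)"
proof -
  have 1: "D\<Gamma> x w (a + b) v = D\<Gamma> x w a v + D\<Gamma> x w b v" "D\<Gamma> x w (r *\<^sub>R a) v = r *\<^sub>R D\<Gamma> x w a v"
    for a b v r
    using christoffel_differentiable[OF x]
    by (auto simp: christoffel_linear frechet_derivative_works intro!: frechet_derivative_eqI derivative_eq_intros)
  have 2: "D\<Gamma> x w v (a + b) = D\<Gamma> x w v a + D\<Gamma> x w v b" "D\<Gamma> x w v (r *\<^sub>R a) = r *\<^sub>R D\<Gamma> x w v a"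
    for a b v r
    using christoffel_differentiable[OF x]
    by (auto simp: christoffel_linear frechet_derivative_works intro!: frechet_derivative_eqI derivative_eq_intros)
  show ?thesis unfolding bilinear_def by (auto intro!: linearI simp: 1 2)
qed

lemma smooth_D\<Gamma>: "smooth_on \<Omega> (\<lambda>x. D\<Gamma> x w u v)"
  by (rule smooth_on_derivative[OF smooth_christoffel])

subsection \<open>The Jacobi operator\<close>

text \<open>Expansion of \<open>R(\<eta>, \<xi>) \<xi>\<close> on fields with constant components,
  whose bracket vanishes, with the lower arguments arranged by the symmetry of
  \<open>\<Gamma>\<close>.\<close>

definition jacobi :: "real^'n \<Rightarrow> real^'n \<Rightarrow> real^'n \<Rightarrow> real^'n" where
  "jacobi x \<xi> \<eta> = D\<Gamma> x \<eta> \<xi> \<xi> - D\<Gamma> x \<xi> \<xi> \<eta> + \<Gamma> x \<eta> (\<Gamma> x \<xi> \<xi>) - \<Gamma> x \<xi> (\<Gamma> x \<xi> \<eta>)"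

lemma curvature_field_eq_jacobi:
  assumes x: "x \<in> \<Omega>"
  shows "curvature_field G (\<lambda>_. \<eta>) (\<lambda>_. \<xi>) (\<lambda>_. \<xi>) x = jacobi x \<xi> \<eta>"
  using D\<Gamma>_commute[OF x, of \<xi> \<eta> \<xi>] christoffel_commute[OF x, of \<eta> \<xi>]
  by (simp add: curvature_field_def nabla_def[abs_def] lie_bracket_def jacobi_def christoffel_linear)

lemma linear_jacobi:
  assumes x: "x \<in> \<Omega>"
  shows "linear (jacobi x \<xi>)"
proof -
  have 1: "linear (\<Gamma> x u)" "linear (\<lambda>w. \<Gamma> x w u)" "linear (D\<Gamma> x w u)" for u w
    using bilinear_christoffel[of x] bilinear_D\<Gamma>[OF x] by (auto simp: bilinear_def)
  show ?thesis
    unfolding jacobi_def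
    using linear_compose[OF 1(1) 1(1)]
    by (intro linear_compose_sub linear_compose_add linear_D\<Gamma>[OF x] 1) (simp add: o_def)
qed

lemma jacobi_self: "jacobi x \<xi> \<xi> = 0" if "x \<in> \<Omega>"
  using christoffel_commute[OF that] by (simp add: jacobi_def)

text \<open>The Koszul form is differentiated along the line \<open>x + s w\<close>. Through it the
  derivatives of the Christoffel symbols become second derivatives of the metric, whose symmetries
  are known.\<close>

lemma lowered_christoffel_derivative:
  assumes x: "x \<in> \<Omega>"
  shows "(G x *v D\<Gamma> x w u v) \<bullet> z + (DG x w *v \<Gamma> x u v) \<bullet> z =
    (v \<bullet> (DDG x w u *v z) + u \<bullet> (DDG x w v *v z) - u \<bullet> (DDG x w z *v v)) / 2"
proof -
  let ?c = "\<lambda>s. x + s *\<^sub>R w"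
  note dG = has_vector_derivative_compose_differentiable[where x = ?c and t = 0 and x' = w,
      OF _ has_vector_derivative_affine]
  have G0: "G differentiable (at (?c 0))" "(\<lambda>y. DG y a) differentiable (at (?c 0))"
    "(\<lambda>y. \<Gamma> y u v) differentiable (at (?c 0))" for a
    using x smooth_on_differentiable[OF smooth_metric] christoffel_differentiable
      smooth_on_differentiable[OF smooth_on_derivative[OF smooth_metric]] by auto
  have l: "((\<lambda>s. (G (?c s) *v \<Gamma> (?c s) u v) \<bullet> z) has_vector_derivative
     (G (?c 0) *v D\<Gamma> (?c 0) w u v + DG (?c 0) w *v \<Gamma> (?c 0) u v) \<bullet> z) (at 0)"
    by (intro bounded_linear.has_vector_derivative[OF bounded_linear_inner_left]
        has_vector_derivative_matrix_vector_mult dG G0)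
  have t: "((\<lambda>s. b \<bullet> (DG (?c s) a *v d)) has_vector_derivative
     b \<bullet> (DG (?c 0) a *v 0 + DDG (?c 0) w a *v d)) (at 0)" for a b d
    by (intro bounded_linear.has_vector_derivative[OF bounded_linear_inner_right]
        has_vector_derivative_matrix_vector_mult dG[of "\<lambda>y. DG y a"] G0 has_vector_derivative_const)
  have "((\<lambda>s. (v \<bullet> (DG (?c s) u *v z) + u \<bullet> (DG (?c s) v *v z) - u \<bullet> (DG (?c s) z *v v)) / 2)
    has_vector_derivative (v \<bullet> (DG (?c 0) u *v 0 + DDG (?c 0) w u *v z) +
      u \<bullet> (DG (?c 0) v *v 0 + DDG (?c 0) w v *v z) - u \<bullet> (DG (?c 0) z *v 0 + DDG (?c 0) w z *v v)) / 2) (at 0)"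
    by (intro has_vector_derivative_divide has_vector_derivative_add has_vector_derivative_diff t)
  moreover have "eventually (\<lambda>s. (v \<bullet> (DG (?c s) u *v z) + u \<bullet> (DG (?c s) v *v z) - u \<bullet> (DG (?c s) z *v v)) / 2 =
      (G (?c s) *v \<Gamma> (?c s) u v) \<bullet> z) (nhds 0)"
  proof -
    have "eventually (\<lambda>s. ?c s \<in> \<Omega>) (nhds 0)"
      by (rule eventually_curve_in_open[OF has_vector_derivative_affine open_domain]) (simp add: x)
    then show ?thesis by eventually_elim (simp add: lowered_christoffel)
  qed
  ultimately have "((\<lambda>s. (G (?c s) *v \<Gamma> (?c s) u v) \<bullet> z) has_vector_derivative
     (v \<bullet> (DDG x w u *v z) + u \<bullet> (DDG x w v *v z) - u \<bullet> (DDG x w z *v v)) / 2) (at 0)"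
    using has_vector_derivative_transform_nhds by fastforce
  from vector_derivative_unique_at[OF l this] show ?thesis by (simp add: inner_add_left)
qed

text \<open>After lowering, the terms assemble into the classical expression of the curvature
  tensor: second derivatives of the metric plus two products of Christoffel symbols. It is symmetric
  in \<open>w\<close> and \<open>z\<close> because second derivatives commute and the metric is
  symmetric.\<close>

lemma jacobi_self_adjoint:
  assumes x: "x \<in> \<Omega>"
  shows "(G x *v jacobi x \<xi> w) \<bullet> z = (G x *v jacobi x \<xi> z) \<bullet> w"
proof -
  define B where "B = (\<lambda>a b c d. c \<bullet> (DDG x a b *v d))"
  have B1: "B a b c d = B b a c d" and B2: "B a b c d = B a b d c" for a b c d
    unfolding B_def
    by (simp add: DDG_commute[OF x]) (metis inner_commute symmetric_matrix_inner transpose_DDG[OF x])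
  have Gs: "(G x *v a) \<bullet> b = (G x *v b) \<bullet> a" for a b
    by (metis inner_commute symmetric_matrix_inner symmetric_metric x)
  have e: "(G x *v jacobi x \<xi> w) \<bullet> z =
      (B w \<xi> \<xi> z + B \<xi> z \<xi> w - B w z \<xi> \<xi> - B \<xi> \<xi> w z) / 2
      - (G x *v \<Gamma> x w z) \<bullet> \<Gamma> x \<xi> \<xi> + (G x *v \<Gamma> x \<xi> z) \<bullet> \<Gamma> x \<xi> w" for w z
  proof -
    have 1: "(G x *v D\<Gamma> x w \<xi> \<xi>) \<bullet> z = B w \<xi> \<xi> z - B w z \<xi> \<xi> / 2 - (DG x w *v \<Gamma> x \<xi> \<xi>) \<bullet> z"
      using lowered_christoffel_derivative[OF x, where w = w and u = \<xi> and v = \<xi> and z = z] by (simp add: B_def field_simps)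
    have 2: "(G x *v D\<Gamma> x \<xi> \<xi> w) \<bullet> z =
        (B \<xi> \<xi> w z + B \<xi> w \<xi> z - B \<xi> z \<xi> w) / 2 - (DG x \<xi> *v \<Gamma> x \<xi> w) \<bullet> z"
      using lowered_christoffel_derivative[OF x, where w = \<xi> and u = \<xi> and v = w and z = z] by (simp add: B_def field_simps)
    have 3: "(DG x a *v b) \<bullet> z = (G x *v \<Gamma> x a b) \<bullet> z + (G x *v \<Gamma> x a z) \<bullet> b" for a b
      using metric_compatible[OF x, of z a b] by (simp add: inner_commute[of z])
    show ?thesis
      unfolding jacobi_def
      using B1[of \<xi> w \<xi> z]
      by (simp add: matrix_vector_right_distrib matrix_vector_mult_diff_distrib inner_add_left inner_diff_left
          1 2 3 field_simps)
  qed
  show ?thesis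
    unfolding e[of w z] e[of z w]
    using B1[of w \<xi> \<xi> z] B1[of z \<xi> \<xi> w] B1[of w z \<xi> \<xi>] B2[of \<xi> \<xi> w z] christoffel_commute[OF x, of w z]
      Gs[of "\<Gamma> x \<xi> z" "\<Gamma> x \<xi> w"] by simp
qed

text \<open>Metricity makes the derivative of the metric equal to
  \<open>transpose P ** G + G ** P\<close>, with \<open>P\<close> the matrix of
  \<open>\<Gamma> x v\<close>; multiplied by the inverse metric, each term has the trace of
  \<open>P\<close>. This is the part of the logarithmic derivative of the density that comes from
  \<open>det G\<close>.\<close>

lemma trace_christoffel:
  assumes x: "x \<in> \<Omega>"
  shows "trace (matrix_inv (G x) ** DG x v) = 2 * trace (matrix (\<Gamma> x v))"
proof -
  let ?P = "matrix (\<Gamma> x v)"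
  have P: "?P *v a = \<Gamma> x v a" for a
    using bilinear_christoffel[of x] by (simp add: bilinear_def)
  have "DG x v *v b = (transpose ?P ** G x + G x ** ?P) *v b" for b
  proof (rule vector_eq_ldot[THEN iffD1], rule allI)
    fix a
    have "a \<bullet> (DG x v *v b) = (G x *v (?P *v a)) \<bullet> b + (G x *v (?P *v b)) \<bullet> a"
      by (simp add: metric_compatible[OF x] P)
    also have "(G x *v (?P *v a)) \<bullet> b = (?P *v a) \<bullet> (G x *v b)"
      by (rule symmetric_matrix_inner[OF symmetric_metric[OF x]])
    also have "\<dots> = a \<bullet> (transpose ?P *v (G x *v b))"
      by (metis dot_lmul_matrix inner_commute transpose_matrix_vector)
    finally show "a \<bullet> (DG x v *v b) = a \<bullet> ((transpose ?P ** G x + G x ** ?P) *v b)"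
      by (simp add: matrix_vector_mult_add_rdistrib inner_add_right inner_commute
          flip: matrix_vector_mul_assoc)
  qed
  then have "DG x v = transpose ?P ** G x + G x ** ?P" by (simp add: matrix_eq)
  then have "matrix_inv (G x) ** DG x v = matrix_inv (G x) ** (transpose ?P ** G x) + ?P"
    by (simp add: matrix_mult_distribs) (simp add: matrix_mul_assoc matrix_inv_mult[OF det_metric[OF x]])
  moreover have "trace (matrix_inv (G x) ** (transpose ?P ** G x)) = trace (transpose ?P)"
    by (subst trace_mul_sym) (simp add: matrix_mul_assoc[symmetric] matrix_inv_mult[OF det_metric[OF x]])
  moreover have "trace (transpose ?P) = trace ?P" by (simp add: trace_def transpose_def)
  ultimately show ?thesis by (simp add: trace_add)
qed

text \<open>Metricity cancels the derivative of the metric against the two acceleration terms. Unit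
  speed along rays lets the curvature trace, known for unit vectors, be used there.\<close>

lemma geodesic_speed_constant:
  assumes c: "(c has_vector_derivative v t) (at t)" and ct: "c t \<in> \<Omega>"
    and v: "(v has_vector_derivative - \<Gamma> (c t) (v t) (v t)) (at t)"
  shows "((\<lambda>s. v s \<bullet> (G (c s) *v v s)) has_real_derivative 0) (at t)"
proof -
  have "((\<lambda>s. G (c s)) has_vector_derivative DG (c t) (v t)) (at t)"
    by (rule has_vector_derivative_compose_differentiable[OF smooth_on_differentiable[OF smooth_metric ct] c])
  from bounded_bilinear.has_vector_derivative[OF bounded_bilinear_inner v
      has_vector_derivative_matrix_vector_mult[OF this v]]
  have "((\<lambda>s. v s \<bullet> (G (c s) *v v s)) has_vector_derivative
     v t \<bullet> (G (c t) *v - \<Gamma> (c t) (v t) (v t) + DG (c t) (v t) *v v t) +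
      - \<Gamma> (c t) (v t) (v t) \<bullet> (G (c t) *v v t)) (at t)" .
  moreover have "\<Gamma> (c t) (v t) (v t) \<bullet> (G (c t) *v v t) = (G (c t) *v \<Gamma> (c t) (v t) (v t)) \<bullet> v t"
    by (simp add: symmetric_matrix_inner[OF symmetric_metric[OF ct]])
  moreover have "v t \<bullet> (G (c t) *v - \<Gamma> (c t) (v t) (v t)) = - ((G (c t) *v \<Gamma> (c t) (v t) (v t)) \<bullet> v t)"
    by (simp add: linear_neg[OF matrix_vector_mul_linear] inner_commute)
  ultimately show ?thesis
    by (simp add: has_real_derivative_iff_has_vector_derivative inner_add_right metric_compatible[OF ct])
qed

end

section \<open>Smoothness of bilinear families, matrix products and Jacobians\<close>

lemma smooth_on_scaleR:
  "open S \<Longrightarrow> smooth_on S f \<Longrightarrow> smooth_on S g \<Longrightarrow> smooth_on S (\<lambda>x. f x *\<^sub>R g x)"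
  by (simp add: smooth_on_def Ck_on_bilinear[OF bounded_bilinear_scaleR])

lemma smooth_on_bilinear_family:
  fixes B :: "'a::euclidean_space \<Rightarrow> 'b::euclidean_space \<Rightarrow> 'c::euclidean_space \<Rightarrow> 'd::real_normed_vector"
    and f :: "'e::euclidean_space \<Rightarrow> 'a"
  assumes S: "open S" "open T" "f ` S \<subseteq> T" "smooth_on S f"
    and bil: "\<And>y. y \<in> T \<Longrightarrow> bilinear (B y)" and B: "\<And>a b. smooth_on T (\<lambda>y. B y a b)"
    and uv: "smooth_on S u" "smooth_on S v"
  shows "smooth_on S (\<lambda>x. B (f x) (u x) (v x))"
proof -
  have "smooth_on S (\<lambda>x. \<Sum>i\<in>Basis. \<Sum>j\<in>Basis. ((u x \<bullet> i) * (v x \<bullet> j)) *\<^sub>R B (f x) i j)"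
    by (intro smooth_on_sum smooth_on_scaleR smooth_on_mult S uv
        smooth_on_linear_compose[OF _ bounded_linear_inner_left] smooth_on_compose[OF S B])
  then show ?thesis
    by (rule smooth_on_cong[OF S(1), rotated])
      (rule bilinear_euclidean_expansion[OF bil, symmetric], use S(3) in auto)
qed

lemma smooth_on_matrix_vector_mult:
  fixes f :: "'a::euclidean_space \<Rightarrow> real^'n^'m" and g :: "'a \<Rightarrow> real^'n"
  assumes "open S" "smooth_on S f" "smooth_on S g"
  shows "smooth_on S (\<lambda>x. f x *v g x)"
  by (intro smooth_on_vec assms)
    (auto simp: matrix_vector_mult_def intro!: smooth_on_sum smooth_on_mult smooth_on_nth assms)

lemma smooth_on_matrixI:
  fixes f :: "'a::euclidean_space \<Rightarrow> real^'n^'m"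
  assumes "open S" "\<And>w. smooth_on S (\<lambda>x. f x *v w)"
  shows "smooth_on S f"
proof (intro smooth_on_matrix assms)
  fix i j
  show "smooth_on S (\<lambda>x. f x $ i $ j)"
    using smooth_on_nth[OF assms(1) assms(2)[of "axis j 1"], of i]
    by (simp add: matrix_vector_mult_basis column_def)
qed

lemma matrix_scaleR_vector_mult: "(r *\<^sub>R A) *v x = r *\<^sub>R (A *v x)" for A :: "real^'n^'m"
  by (simp add: vec_eq_iff matrix_vector_mult_def sum_distrib_left mult_ac)

lemma bounded_linear_matrix_vector_mult_left: "bounded_linear (\<lambda>A :: real^'n^'m. A *v x)"
proof -
  have "linear (\<lambda>A :: real^'n^'m. A *v x)"
    by (auto intro!: linearI simp: matrix_vector_mult_add_rdistrib matrix_scaleR_vector_mult)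
  then show ?thesis by (simp add: linear_conv_bounded_linear)
qed

lemma derivative_matrix_vector:
  fixes F :: "'a::real_normed_vector \<Rightarrow> real^'n^'m"
  assumes "F differentiable (at x)"
  shows "frechet_derivative (\<lambda>y. F y *v w) (at x) a = frechet_derivative F (at x) a *v w"
  by (rule frechet_derivative_linear_compose[OF bounded_linear_matrix_vector_mult_left assms])

lemma trace_scaleR: "trace (r *\<^sub>R A) = r * trace A" for A :: "real^'n^'n"
  by (simp add: trace_def sum_distrib_left)

lemma bounded_linear_trace: "bounded_linear (trace :: real^'n^'n \<Rightarrow> real)"
proof -
  have "linear (trace :: real^'n^'n \<Rightarrow> real)"
    by (auto intro!: linearI simp: trace_def sum.distrib sum_distrib_left)
  then show ?thesis by (simp add: linear_conv_bounded_linear)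
qed

lemma tendsto_matrix_mult:
  fixes f :: "'a \<Rightarrow> real^'n^'m" and g :: "'a \<Rightarrow> real^'l^'n"
  assumes "(f \<longlongrightarrow> a) F" "(g \<longlongrightarrow> b) F"
  shows "((\<lambda>x. f x ** g x) \<longlongrightarrow> a ** b) F"
  unfolding matrix_matrix_mult_def
  by (intro tendsto_vec_lambda tendsto_sum tendsto_mult tendsto_vec_nth assms)

lemma jacobian_vector_mult: "f differentiable (at x) \<Longrightarrow> jacobian f x *v w = frechet_derivative f (at x) w"
  using linear_frechet_derivative[of f "at x"] by (simp add: jacobian_def)

lemma smooth_on_jacobian:
  assumes "open S" "smooth_on S f"
  shows "smooth_on S (jacobian f)"
proof (rule smooth_on_matrixI[OF assms(1)])
  show "smooth_on S (\<lambda>x. jacobian f x *v w)" for w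
    by (rule smooth_on_cong[OF assms(1) _ smooth_on_derivative[OF assms(2), of w]])
      (simp add: jacobian_vector_mult smooth_on_differentiable[OF assms(2)])
qed

subsection \<open>The Riccati equation along radial geodesics\<close>

text \<open>\<open>E\<close> stands for the exponential map after an orthonormal frame, read in the
  chart. \<open>radial_geodesic\<close> is the geodesic equation of
  \<open>t \<mapsto> E (t x)\<close> at \<open>t = 1\<close>; imposing it for all \<open>x\<close>
  at once allows it to be differentiated in directions transverse to a ray.\<close>

locale exponential_coordinates = coordinate_metric \<Omega> G
  for \<Omega> :: "(real^'n) set" and G :: "real^'n \<Rightarrow> real^'n^'n" +
  fixes E :: "real^'n \<Rightarrow> real^'n" and \<delta> :: real
  assumes radius: "\<delta> > 0" and smooth_exp: "smooth_on (ball 0 \<delta>) E" and exp_in: "E ` ball 0 \<delta> \<subseteq> \<Omega>"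
    and radial_geodesic: "\<And>x. x \<in> ball 0 \<delta> \<Longrightarrow>
      frechet_derivative (jacobian E) (at x) x *v x + \<Gamma> (E x) (jacobian E x *v x) (jacobian E x *v x) = 0"
    and regular: "\<And>x. x \<in> ball 0 \<delta> \<Longrightarrow> det (jacobian E x) \<noteq> 0"
    and orthonormal_origin: "transpose (jacobian E 0) ** G (E 0) ** jacobian E 0 = mat 1"
begin

abbreviation "J \<equiv> jacobian E"

abbreviation "DJ x w \<equiv> frechet_derivative J (at x) w"

lemma exp_in_domain: "x \<in> ball 0 \<delta> \<Longrightarrow> E x \<in> \<Omega>"
  using exp_in by blast

lemma J_mult: "x \<in> ball 0 \<delta> \<Longrightarrow> J x *v w = frechet_derivative E (at x) w"
  by (rule jacobian_vector_mult[OF smooth_on_differentiable[OF smooth_exp]])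

lemma smooth_J: "smooth_on (ball 0 \<delta>) J"
  by (rule smooth_on_jacobian[OF open_ball smooth_exp])

lemma smooth_J_mult: "smooth_on (ball 0 \<delta>) (\<lambda>x. J x *v w)"
  by (intro smooth_on_matrix_vector_mult smooth_J smooth_on_const) auto

lemma J_differentiable: "x \<in> ball 0 \<delta> \<Longrightarrow> J differentiable (at x)"
  by (rule smooth_on_differentiable[OF smooth_J])

lemma DJ_mult: "x \<in> ball 0 \<delta> \<Longrightarrow> DJ x a *v w = frechet_derivative (\<lambda>y. J y *v w) (at x) a"
  by (simp add: derivative_matrix_vector J_differentiable)

lemma DJ_commute:
  assumes x: "x \<in> ball 0 \<delta>"
  shows "DJ x a *v w = DJ x w *v a"
proof -
  have "DJ x a *v w = frechet_derivative (\<lambda>y. frechet_derivative E (at y) w) (at x) a" for a w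
    unfolding DJ_mult[OF x]
    by (rule fun_cong[OF frechet_derivative_transform_within_open[OF
            smooth_on_differentiable[OF smooth_J_mult x] open_ball x J_mult]])
  then show ?thesis using second_derivative_symmetric[OF smooth_exp open_ball x] by metis
qed

lemma DJ_linear: "x \<in> ball 0 \<delta> \<Longrightarrow> linear (DJ x)"
  by (rule linear_frechet_derivative[OF J_differentiable])

lemma bilinear_DJ: "x \<in> ball 0 \<delta> \<Longrightarrow> bilinear (\<lambda>a b. DJ x a *v b)"
  unfolding bilinear_def
  by (auto intro!: linearI simp: linear_add[OF DJ_linear] linear_cmul[OF DJ_linear]
      matrix_vector_mult_add_rdistrib matrix_scaleR_vector_mult matrix_vector_right_distrib matrix_vector_mult_scaleR)

context
  fixes u :: "real^'n"
begin

definition J1 :: "real^'n \<Rightarrow> real^'n^'n" where "J1 x = DJ x u"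

definition J2 :: "real^'n \<Rightarrow> real^'n^'n" where "J2 x = frechet_derivative J1 (at x) u"

text \<open>Covariant differentiation of components along the ray is the ordinary derivative plus
  this matrix.\<close>

definition connection :: "real^'n \<Rightarrow> real^'n^'n" where
  "connection x = matrix (\<Gamma> (E x) (J x *v u))"

text \<open>Coefficient of the undifferentiated Jacobi field in the linearised geodesic equation. It
  depends on the coordinates; \<open>curvature_matrix_eq\<close> corrects it to the Jacobi
  operator.\<close>

definition tidal :: "real^'n \<Rightarrow> real^'n^'n" where
  "tidal x = matrix (\<lambda>w. D\<Gamma> (E x) w (J x *v u) (J x *v u))"

definition curvature_matrix :: "real^'n \<Rightarrow> real^'n^'n" where
  "curvature_matrix x = matrix (jacobi (E x) (J x *v u))"

text \<open>With \<open>W = t J\<close> the matrix of Jacobi fields along the ray, \<open>(\<nabla>W) W\<^sup>-\<^sup>1 = t\<^sup>-\<^sup>1 + shape\<close>.\<close>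

definition shape :: "real^'n \<Rightarrow> real^'n^'n" where
  "shape x = J1 x ** matrix_inv (J x) + connection x"

lemma smooth_J1: "smooth_on (ball 0 \<delta>) J1"
  unfolding J1_def[abs_def] by (rule smooth_on_derivative[OF smooth_J])

lemma connection_mult: "connection x *v w = \<Gamma> (E x) (J x *v u) w"
  using bilinear_christoffel by (simp add: connection_def bilinear_def)

lemma tidal_mult: "x \<in> ball 0 \<delta> \<Longrightarrow> tidal x *v w = D\<Gamma> (E x) w (J x *v u) (J x *v u)"
  using linear_D\<Gamma>[OF exp_in_domain] by (simp add: tidal_def)

lemma curvature_mult: "x \<in> ball 0 \<delta> \<Longrightarrow> curvature_matrix x *v w = jacobi (E x) (J x *v u) w"
  using linear_jacobi[OF exp_in_domain] by (simp add: curvature_matrix_def)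

lemma smooth_connection: "smooth_on (ball 0 \<delta>) connection"
  by (rule smooth_on_matrixI, simp, unfold connection_mult,
      rule smooth_on_bilinear_family[OF _ open_domain exp_in smooth_exp bilinear_christoffel smooth_christoffel])
    (auto intro: smooth_J_mult smooth_on_const)

lemma smooth_curvature: "smooth_on (ball 0 \<delta>) curvature_matrix"
proof (rule smooth_on_matrixI)
  fix w
  note \<Gamma> = smooth_on_bilinear_family[OF open_ball open_domain exp_in smooth_exp bilinear_christoffel smooth_christoffel]
  note D = smooth_on_bilinear_family[OF open_ball open_domain exp_in smooth_exp bilinear_D\<Gamma> smooth_D\<Gamma>]
  let ?c = "\<lambda>x. J x *v u"
  \<comment> \<open>\<open>D\<Gamma>\<close> is a bilinear family only in its last two arguments;
    the moving direction of differentiation is expanded by linearity.\<close>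
  have "smooth_on (ball 0 \<delta>) (\<lambda>x. \<Sum>i\<in>UNIV. ?c x $ i *\<^sub>R D\<Gamma> (E x) (axis i 1) (?c x) w)"
    by (intro smooth_on_sum smooth_on_scaleR smooth_on_nth smooth_J_mult D smooth_on_const open_ball)
  then have "smooth_on (ball 0 \<delta>) (\<lambda>x. D\<Gamma> (E x) (?c x) (?c x) w)"
    by (rule smooth_on_cong[OF open_ball, rotated])
      (rule linear_sum_axis[OF linear_D\<Gamma>[OF exp_in_domain], symmetric])
  then have "smooth_on (ball 0 \<delta>) (\<lambda>x. jacobi (E x) (?c x) w)"
    unfolding jacobi_def
    by (intro smooth_on_add smooth_on_diff \<Gamma> D smooth_J_mult smooth_on_const open_ball)
  then show "smooth_on (ball 0 \<delta>) (\<lambda>x. curvature_matrix x *v w)"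
    by (rule smooth_on_cong[OF open_ball, rotated]) (simp add: curvature_mult)
qed auto

lemma smooth_J_inv: "smooth_on (ball 0 \<delta>) (\<lambda>x. matrix_inv (J x))"
  by (intro smooth_on_matrix_inv smooth_J open_ball regular)

lemma smooth_shape: "smooth_on (ball 0 \<delta>) shape"
  unfolding shape_def[abs_def]
  by (intro smooth_on_add smooth_on_matrix_mult smooth_J1 smooth_J_inv smooth_connection open_ball)

text \<open>Both sides are the third derivative of \<open>E\<close> in the directions
  \<open>u\<close>, \<open>u\<close> and \<open>w\<close>. This turns the transverse derivative of
  the radial acceleration into the second radial derivative of \<open>J\<close>.\<close>

lemma J2_commute:
  assumes x: "x \<in> ball 0 \<delta>"
  shows "frechet_derivative J1 (at x) w *v u = J2 x *v w"
proof -
  have J1d: "J1 differentiable (at x)" by (rule smooth_on_differentiable[OF smooth_J1 x])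
  have s: "smooth_on (ball 0 \<delta>) (\<lambda>y. frechet_derivative (\<lambda>z. J z *v u) (at y) b)" for b
    by (rule smooth_on_derivative[OF smooth_J_mult])
  have "frechet_derivative J1 (at x) w *v u = frechet_derivative (\<lambda>y. J1 y *v u) (at x) w"
    by (simp add: derivative_matrix_vector J1d)
  also have "\<dots> = frechet_derivative (\<lambda>y. frechet_derivative (\<lambda>z. J z *v u) (at y) u) (at x) w"
    by (rule fun_cong[OF frechet_derivative_transform_within_open[OF smooth_on_differentiable[OF s x] open_ball x, symmetric]])
      (simp add: J1_def DJ_mult)
  also have "\<dots> = frechet_derivative (\<lambda>y. frechet_derivative (\<lambda>z. J z *v u) (at y) w) (at x) u"
    by (rule second_derivative_symmetric[OF smooth_J_mult open_ball x])
  also have "\<dots> = frechet_derivative (\<lambda>y. J1 y *v w) (at x) u"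
    by (rule fun_cong[OF frechet_derivative_transform_within_open[OF smooth_on_differentiable[OF s x] open_ball x]])
      (simp add: J1_def DJ_commute[of _ u w] flip: DJ_mult)
  also have "\<dots> = J2 x *v w"
    by (simp add: derivative_matrix_vector J1d J2_def)
  finally show ?thesis .
qed

text \<open>For the Jacobi field \<open>Y = t J w\<close> along the ray \<open>c\<close> this is
  \<open>Y'' + 2 \<Gamma>(c', Y') + D\<Gamma>(Y)(c', c') = 0\<close> multiplied by \<open>t\<close>.
  It arises from \<open>radial_geodesic\<close> at \<open>x = t u\<close> by differentiation in
  direction \<open>w\<close>.\<close>

lemma jacobi_equation_vector:
  assumes t: "t *\<^sub>R u \<in> ball 0 \<delta>"
  defines "x \<equiv> t *\<^sub>R u"
  shows "t\<^sup>2 *\<^sub>R (J2 x *v w) + (2 * t) *\<^sub>R (J1 x *v w) + t\<^sup>2 *\<^sub>R (tidal x *v (J x *v w)) +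
    (2 * t) *\<^sub>R (connection x *v (J x *v w + t *\<^sub>R (J1 x *v w))) = 0"
proof -
  have x: "x \<in> ball 0 \<delta>" using t by (simp add: x_def)
  define y where "y = (\<lambda>s. x + s *\<^sub>R w)"
  have y: "(y has_vector_derivative w) (at 0)" and y0: "y 0 = x"
    unfolding y_def by (rule has_vector_derivative_affine) simp
  define v where "v = (\<lambda>s. J (y s) *v y s)"
  have v: "(v has_vector_derivative (J x *v w + DJ x w *v x)) (at 0)"
    unfolding v_def
    using has_vector_derivative_matrix_vector_mult[OF has_vector_derivative_compose_differentiable[OF _ y] y, of J]
      J_differentiable[OF x] by (simp add: y0)
  have ex: "((\<lambda>s. E (y s)) has_vector_derivative J x *v w) (at 0)"
    using has_vector_derivative_compose_differentiable[OF _ y, of E]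
      smooth_on_differentiable[OF smooth_exp x] J_mult[OF x] by (simp add: y0)
  have "((\<lambda>s. \<Gamma> (E (y s)) (v s) (v s)) has_vector_derivative
     (D\<Gamma> (E (y 0)) (J x *v w) (v 0) (v 0) + \<Gamma> (E (y 0)) (J x *v w + DJ x w *v x) (v 0) +
     \<Gamma> (E (y 0)) (v 0) (J x *v w + DJ x w *v x))) (at 0)"
    by (rule has_vector_derivative_bilinear_family[OF open_domain _ bilinear_christoffel _ ex v v])
      (use x y0 exp_in_domain christoffel_differentiable in auto)
  moreover have "((\<lambda>s. DJ (y s) (y s) *v y s) has_vector_derivative
     (frechet_derivative (\<lambda>z. DJ z (y 0) *v y 0) (at (y 0)) w + DJ (y 0) w *v y 0 + DJ (y 0) (y 0) *v w)) (at 0)"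
  proof (rule has_vector_derivative_bilinear_family[OF open_ball[of 0 \<delta>] _ bilinear_DJ _ y y y])
    fix a b
    have "smooth_on (ball 0 \<delta>) (\<lambda>y. DJ y a *v b)"
      by (intro smooth_on_matrix_vector_mult smooth_on_derivative[OF smooth_J] smooth_on_const open_ball)
    then show "(\<lambda>y. DJ y a *v b) differentiable (at (y 0))"
      unfolding y0 by (rule smooth_on_differentiable[OF _ x])
  qed (use x y0 in auto)
  ultimately have "((\<lambda>s. DJ (y s) (y s) *v y s + \<Gamma> (E (y s)) (v s) (v s)) has_vector_derivative
     ((frechet_derivative (\<lambda>z. DJ z (y 0) *v y 0) (at (y 0)) w + DJ (y 0) w *v y 0 + DJ (y 0) (y 0) *v w) +
      (D\<Gamma> (E (y 0)) (J x *v w) (v 0) (v 0) + \<Gamma> (E (y 0)) (J x *v w + DJ x w *v x) (v 0) +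
     \<Gamma> (E (y 0)) (v 0) (J x *v w + DJ x w *v x)))) (at 0)" (is "(?f has_vector_derivative ?d) _")
    by (rule has_vector_derivative_add[rotated])
  moreover have "(?f has_vector_derivative 0) (at 0)"
  proof (rule has_vector_derivative_transform_nhds[OF has_vector_derivative_const])
    have "eventually (\<lambda>s. y s \<in> ball 0 \<delta>) (nhds 0)"
      by (rule eventually_curve_in_open[OF y open_ball]) (simp only: y0 x)
    then show "eventually (\<lambda>s. 0 = ?f s) (nhds 0)"
      by eventually_elim (simp add: radial_geodesic v_def)
  qed
  ultimately have eq: "?d = 0" using vector_derivative_unique_at by blast
  \<comment> \<open>The radial arguments, frozen at \<open>x = t u\<close>, contribute the powers of
    \<open>t\<close>; only the dependence of \<open>J1\<close> on the position is left to
    differentiate.\<close>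
  have Dx: "DJ z (t *\<^sub>R u) *v (t *\<^sub>R u) = t\<^sup>2 *\<^sub>R (J1 z *v u)" if "z \<in> ball 0 \<delta>" for z
    using bilinear_lmul[OF bilinear_DJ[OF that]] bilinear_rmul[OF bilinear_DJ[OF that]]
    by (simp add: J1_def power2_eq_square)
  have "frechet_derivative (\<lambda>z. DJ z (y 0) *v y 0) (at (y 0)) w = frechet_derivative (\<lambda>z. t\<^sup>2 *\<^sub>R (J1 z *v u)) (at x) w"
    unfolding y0
  proof (rule fun_cong[OF frechet_derivative_transform_within_open[OF _ open_ball x, symmetric]])
    show "(\<lambda>z. t\<^sup>2 *\<^sub>R (J1 z *v u)) differentiable (at x)"
      by (rule smooth_on_differentiable[OF _ x])
        (intro smooth_on_scaleR smooth_on_const smooth_on_matrix_vector_mult smooth_J1 open_ball)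
  qed (simp add: Dx x_def)
  also have "\<dots> = t\<^sup>2 *\<^sub>R frechet_derivative (\<lambda>z. J1 z *v u) (at x) w"
    by (rule frechet_derivative_linear_compose[OF bounded_linear_scaleR_right])
      (rule smooth_on_differentiable[OF _ x], intro smooth_on_const smooth_on_matrix_vector_mult smooth_J1 open_ball)
  also have "\<dots> = t\<^sup>2 *\<^sub>R (J2 x *v w)"
    by (simp add: derivative_matrix_vector smooth_on_differentiable[OF smooth_J1 x] J2_commute[OF x])
  finally have 1: "frechet_derivative (\<lambda>z. DJ z (y 0) *v y 0) (at (y 0)) w = t\<^sup>2 *\<^sub>R (J2 x *v w)" .
  have 2: "DJ x w *v x = t *\<^sub>R (J1 x *v w)" "DJ x x *v w = t *\<^sub>R (J1 x *v w)"
    using DJ_commute[OF x, of w x] bilinear_lmul[OF bilinear_DJ[OF x], of t u w]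
    by (simp_all add: J1_def) (simp_all add: x_def)
  have 3: "v 0 = t *\<^sub>R (J x *v u)" by (simp add: v_def y0) (simp add: x_def matrix_vector_mult_scaleR)
  have 4: "D\<Gamma> (E x) z (t *\<^sub>R a) (t *\<^sub>R a) = t\<^sup>2 *\<^sub>R D\<Gamma> (E x) z a a" for z a
    using bilinear_lmul[OF bilinear_D\<Gamma>[OF exp_in_domain[OF x]]] bilinear_rmul[OF bilinear_D\<Gamma>[OF exp_in_domain[OF x]]]
    by (simp add: power2_eq_square)
  have 5: "\<Gamma> (E x) a b = \<Gamma> (E x) b a" for a b by (rule christoffel_commute[OF exp_in_domain[OF x]])
  have "?d = t\<^sup>2 *\<^sub>R (J2 x *v w) + (2 * t) *\<^sub>R (J1 x *v w) + t\<^sup>2 *\<^sub>R (tidal x *v (J x *v w)) +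
    (2 * t) *\<^sub>R (connection x *v (J x *v w + t *\<^sub>R (J1 x *v w)))"
    unfolding 1 unfolding y0 2 3 4 tidal_mult[OF x] connection_mult 5[of _ "t *\<^sub>R (J x *v u)"]
    unfolding christoffel_linear
    by (simp add: vec_eq_iff algebra_simps power2_eq_square)
  then show ?thesis using eq by simp
qed

lemma ray_derivative:
  assumes "smooth_on (ball 0 \<delta>) F" "t *\<^sub>R u \<in> ball 0 \<delta>"
  shows "((\<lambda>s. F (s *\<^sub>R u)) has_vector_derivative frechet_derivative F (at (t *\<^sub>R u)) u) (at t)"
  using has_vector_derivative_compose_differentiable[where x = "\<lambda>s. s *\<^sub>R u" and t = t,
      OF smooth_on_differentiable[OF assms]] has_vector_derivative_affine[of 0 u t] by simp

lemma radial_acceleration: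
  assumes t: "t *\<^sub>R u \<in> ball 0 \<delta>" "t \<noteq> 0"
  shows "J1 (t *\<^sub>R u) *v u = - \<Gamma> (E (t *\<^sub>R u)) (J (t *\<^sub>R u) *v u) (J (t *\<^sub>R u) *v u)"
proof -
  have "DJ (t *\<^sub>R u) (t *\<^sub>R u) *v (t *\<^sub>R u) = t\<^sup>2 *\<^sub>R (J1 (t *\<^sub>R u) *v u)"
    using bilinear_lmul[OF bilinear_DJ[OF t(1)]] bilinear_rmul[OF bilinear_DJ[OF t(1)]]
    by (simp add: J1_def power2_eq_square)
  then have "t\<^sup>2 *\<^sub>R (J1 (t *\<^sub>R u) *v u + \<Gamma> (E (t *\<^sub>R u)) (J (t *\<^sub>R u) *v u) (J (t *\<^sub>R u) *v u)) = 0"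
    using radial_geodesic[OF t(1)]
    by (simp add: matrix_vector_mult_scaleR christoffel_linear power2_eq_square scaleR_add_right)
  then show ?thesis using t(2) by (simp add: eq_neg_iff_add_eq_0)
qed

text \<open>With \<open>P\<close> the connection matrix, the square of the covariant derivative
  \<open>d/dt + P\<close> is \<open>d\<^sup>2/dt\<^sup>2 + 2 P d/dt + P' + P\<^sup>2\<close>.
  Comparison with the linearised geodesic equation leaves \<open>tidal - P' - P\<^sup>2\<close> as
  the curvature term. The proof expands \<open>P'\<close>, with the radial acceleration replaced by
  its Christoffel term.\<close>

lemma curvature_matrix_eq:
  assumes t: "t *\<^sub>R u \<in> ball 0 \<delta>" "t \<noteq> 0"
  defines "x \<equiv> t *\<^sub>R u"
  shows "curvature_matrix x = tidal x - frechet_derivative connection (at x) u - connection x ** connection x"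
proof (rule matrix_eq[THEN iffD2], rule allI)
  fix w
  have x: "x \<in> ball 0 \<delta>" using t by (simp add: x_def)
  let ?c = "J x *v u"
  have Jx: "frechet_derivative (\<lambda>y. J y *v u) (at x) u = J1 x *v u"
    by (simp add: derivative_matrix_vector[OF J_differentiable[OF x]] J1_def)
  have "((\<lambda>s. \<Gamma> (E (s *\<^sub>R u)) (J (s *\<^sub>R u) *v u) w) has_vector_derivative
     (D\<Gamma> (E (t *\<^sub>R u)) ?c (J (t *\<^sub>R u) *v u) w + \<Gamma> (E (t *\<^sub>R u)) (J1 x *v u) w
      + \<Gamma> (E (t *\<^sub>R u)) (J (t *\<^sub>R u) *v u) 0)) (at t)"
    by (rule has_vector_derivative_bilinear_family[OF open_domain _ bilinear_christoffel])
      (use ray_derivative[OF smooth_exp t(1)] ray_derivative[OF smooth_J_mult[of u] t(1)] x Jx J_mult[OF x, of u]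
        exp_in_domain christoffel_differentiable in \<open>auto simp flip: x_def\<close>)
  moreover have "((\<lambda>s. connection (s *\<^sub>R u) *v w) has_vector_derivative
      frechet_derivative connection (at x) u *v w) (at t)"
    using bounded_linear.has_vector_derivative[OF bounded_linear_matrix_vector_mult_left
        ray_derivative[OF smooth_connection t(1)]] by (simp add: x_def)
  ultimately have "frechet_derivative connection (at x) u *v w =
     D\<Gamma> (E x) ?c ?c w + \<Gamma> (E x) (J1 x *v u) w + \<Gamma> (E x) ?c 0"
    unfolding connection_mult x_def using vector_derivative_unique_at by blast
  then have "frechet_derivative connection (at x) u *v w = D\<Gamma> (E x) ?c ?c w - \<Gamma> (E x) (\<Gamma> (E x) ?c ?c) w"
    using radial_acceleration[OF t]
    by (simp add: christoffel_linear bilinear_lneg[OF bilinear_christoffel] flip: x_def)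
  then show "curvature_matrix x *v w =
    (tidal x - frechet_derivative connection (at x) u - connection x ** connection x) *v w"
    by (simp add: curvature_mult[OF x] jacobi_def matrix_vector_mult_diff_rdistrib tidal_mult[OF x]
        connection_mult christoffel_commute[OF exp_in_domain[OF x], of w] flip: matrix_vector_mul_assoc)
qed

lemma shape_derivative:
  assumes t: "t *\<^sub>R u \<in> ball 0 \<delta>"
  defines "x \<equiv> t *\<^sub>R u"
  shows "frechet_derivative shape (at x) u = J2 x ** matrix_inv (J x)
    - J1 x ** matrix_inv (J x) ** J1 x ** matrix_inv (J x) + frechet_derivative connection (at x) u"
proof -
  have x: "x \<in> ball 0 \<delta>" using t by (simp add: x_def)
  have ray: "((\<lambda>s. s *\<^sub>R u) has_vector_derivative u) (at t)" using has_vector_derivative_affine[of 0 u t] by simp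
  have dJ: "((\<lambda>s. J (s *\<^sub>R u)) has_vector_derivative J1 x) (at t)"
    using ray_derivative[OF smooth_J t] by (simp add: J1_def x_def)
  have "eventually (\<lambda>s. s *\<^sub>R u \<in> ball 0 \<delta>) (nhds t)"
    by (rule eventually_curve_in_open[OF ray open_ball t])
  then have ev: "eventually (\<lambda>s. det (J (s *\<^sub>R u)) \<noteq> 0) (nhds t)"
    by eventually_elim (rule regular)
  have dQ: "((\<lambda>s. matrix_inv (J (s *\<^sub>R u))) has_vector_derivative
     - (matrix_inv (J (t *\<^sub>R u)) ** J1 x ** matrix_inv (J (t *\<^sub>R u)))) (at t)"
    by (rule has_vector_derivative_matrix_inv[OF differentiableI_vector[OF ray_derivative[OF smooth_J_inv t]] dJ ev])
  have "((\<lambda>s. J1 (s *\<^sub>R u) ** matrix_inv (J (s *\<^sub>R u)) + connection (s *\<^sub>R u)) has_vector_derivative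
    (J1 (t *\<^sub>R u) ** - (matrix_inv (J (t *\<^sub>R u)) ** J1 x ** matrix_inv (J (t *\<^sub>R u))) +
      J2 x ** matrix_inv (J (t *\<^sub>R u))) + frechet_derivative connection (at x) u) (at t)"
    using has_vector_derivative_add[OF has_vector_derivative_matrix_mult[OF ray_derivative[OF smooth_J1 t] dQ]
        ray_derivative[OF smooth_connection t]] by (simp add: J2_def x_def)
  from vector_derivative_unique_at[OF ray_derivative[OF smooth_shape t, unfolded shape_def] this]
  show ?thesis
    by (simp add: matrix_mult_distribs matrix_mul_assoc shape_def[abs_def] flip: x_def)
qed

text \<open>For \<open>U = 1 / t + V\<close> the terms \<open>1 / t\<^sup>2\<close> of
  \<open>U'\<close> and \<open>U\<^sup>2\<close> cancel, and multiplication by \<open>t\<close>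
  makes the remaining \<open>2 V / t\<close> regular. The commutator converts the ordinary
  derivative of the components of \<open>V\<close> into the covariant one; it vanishes under the
  trace.\<close>

lemma riccati:
  assumes t: "t *\<^sub>R u \<in> ball 0 \<delta>" "t \<noteq> 0"
  defines "x \<equiv> t *\<^sub>R u"
  shows "t *\<^sub>R frechet_derivative shape (at x) u + 2 *\<^sub>R shape x + t *\<^sub>R (shape x ** shape x) +
    t *\<^sub>R (connection x ** shape x - shape x ** connection x) + t *\<^sub>R curvature_matrix x = 0" (is "?L = 0")
proof -
  have x: "x \<in> ball 0 \<delta>" using t by (simp add: x_def)
  define y where "y = J1 x ** matrix_inv (J x)"
  define z where "z = J2 x ** matrix_inv (J x)"
  have JQ: "J x *v (matrix_inv (J x) *v w) = w" for w
    by (simp add: matrix_vector_mul_assoc matrix_inv_mult[OF regular[OF x]])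
  have jac: "t\<^sup>2 *\<^sub>R (z *v w) + (2 * t) *\<^sub>R (y *v w) + t\<^sup>2 *\<^sub>R (tidal x *v w) +
      (2 * t) *\<^sub>R (connection x *v (w + t *\<^sub>R (y *v w))) = 0" for w
    using jacobi_equation_vector[OF t(1), of "matrix_inv (J x) *v w"]
    by (simp add: JQ y_def z_def flip: matrix_vector_mul_assoc x_def)
  \<comment> \<open>The second factor \<open>t\<close> brings the equation to the scale of
    \<open>jac\<close>, the Jacobi equation applied to \<open>J\<^sup>-\<^sup>1 w\<close>.\<close>
  have "t *\<^sub>R (?L *v w) = 0" for w
  proof -
    have "t *\<^sub>R (?L *v w) = t\<^sup>2 *\<^sub>R (z *v w) + (2 * t) *\<^sub>R (y *v w) + t\<^sup>2 *\<^sub>R (tidal x *v w) +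
      (2 * t) *\<^sub>R (connection x *v (w + t *\<^sub>R (y *v w)))"
      unfolding curvature_matrix_eq[OF t, folded x_def] shape_derivative[OF t(1), folded x_def] shape_def
      by (simp flip: y_def z_def matrix_mul_assoc)
        (simp add: matrix_vector_mult_add_rdistrib matrix_vector_mult_diff_rdistrib matrix_scaleR_vector_mult
          matrix_vector_right_distrib matrix_vector_mult_diff_distrib matrix_vector_mult_scaleR
          flip: matrix_vector_mul_assoc, simp add: vec_eq_iff power2_eq_square algebra_simps)
    then show ?thesis using jac by simp
  qed
  then have "?L *v w = 0 *v w" for w using t(2) by simp
  then show ?thesis by (intro matrix_eq[THEN iffD2] allI)
qed

text \<open>The differentiated function is the determinant of the metric pulled back by
  \<open>E\<close>. Jacobi's formula for its two determinants produces the two summands of the trace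
  of \<open>shape\<close>; the square of \<open>det J\<close> and \<open>trace_christoffel\<close>
  account for the factor 2.\<close>

lemma volume_derivative:
  assumes t: "t *\<^sub>R u \<in> ball 0 \<delta>"
  shows "((\<lambda>s. (det (J (s *\<^sub>R u)))\<^sup>2 * det (G (E (s *\<^sub>R u)))) has_real_derivative
    2 * ((det (J (t *\<^sub>R u)))\<^sup>2 * det (G (E (t *\<^sub>R u)))) * trace (shape (t *\<^sub>R u))) (at t)"
proof -
  let ?x = "t *\<^sub>R u"
  have dJ: "((\<lambda>s. J (s *\<^sub>R u)) has_vector_derivative J1 ?x) (at t)"
    using ray_derivative[OF smooth_J t] by (simp add: J1_def)
  have "((\<lambda>s. E (s *\<^sub>R u)) has_vector_derivative J ?x *v u) (at t)"
    using ray_derivative[OF smooth_exp t] by (simp add: J_mult[OF t])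
  from has_vector_derivative_compose_differentiable[OF smooth_on_differentiable[OF smooth_metric exp_in_domain[OF t]] this]
  have dG: "((\<lambda>s. G (E (s *\<^sub>R u))) has_vector_derivative DG (E ?x) (J ?x *v u)) (at t)" .
  have tr: "trace (shape ?x) = trace (matrix_inv (J ?x) ** J1 ?x) + trace (connection ?x)"
    by (simp add: shape_def trace_add trace_mul_sym[of "J1 ?x"])
  note d1 = has_real_derivative_det[OF dJ regular[OF t]]
  note d2 = has_real_derivative_det[OF dG det_metric[OF exp_in_domain[OF t]]]
  show ?thesis
    by (rule DERIV_cong[OF DERIV_mult[OF DERIV_power[OF d1] d2]])
      (simp add: tr trace_christoffel[OF exp_in_domain[OF t]] connection_def power2_eq_square algebra_simps)
qed

lemma continuous_ray:
  assumes "smooth_on (ball 0 \<delta>) F"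
  shows "((\<lambda>t. F (t *\<^sub>R u)) \<longlongrightarrow> F 0) (at 0)"
  using has_vector_derivative_continuous[OF ray_derivative[OF assms, of 0]] radius
  by (simp add: continuous_within)

lemma eventually_ray: "eventually (\<lambda>t. t *\<^sub>R u \<in> ball 0 \<delta> \<and> t \<noteq> 0) (at 0)"
proof -
  have "eventually (\<lambda>t. t *\<^sub>R u \<in> ball 0 \<delta>) (nhds 0)"
    using eventually_curve_in_open[OF has_vector_derivative_affine[of 0 u 0] open_ball[of 0 \<delta>]] radius by simp
  then show ?thesis by (simp add: eventually_at_filter eventually_mono)
qed

text \<open>As \<open>t\<close> tends to 0 in \<open>riccati\<close>, every term with a factor
  \<open>t\<close> vanishes and \<open>2 V\<close> remains.\<close>

lemma shape_origin: "shape 0 = 0"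
proof -
  let ?F = "\<lambda>t. t *\<^sub>R frechet_derivative shape (at (t *\<^sub>R u)) u + 2 *\<^sub>R shape (t *\<^sub>R u) +
    t *\<^sub>R (shape (t *\<^sub>R u) ** shape (t *\<^sub>R u)) +
    t *\<^sub>R (connection (t *\<^sub>R u) ** shape (t *\<^sub>R u) - shape (t *\<^sub>R u) ** connection (t *\<^sub>R u)) +
    t *\<^sub>R curvature_matrix (t *\<^sub>R u)"
  have "(?F \<longlongrightarrow> 0 *\<^sub>R frechet_derivative shape (at 0) u + 2 *\<^sub>R shape 0 + 0 *\<^sub>R (shape 0 ** shape 0) +
    0 *\<^sub>R (connection 0 ** shape 0 - shape 0 ** connection 0) + 0 *\<^sub>R curvature_matrix 0) (at 0)"
    by (intro tendsto_intros tendsto_matrix_mult continuous_ray[of "\<lambda>x. frechet_derivative shape (at x) u"]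
        continuous_ray[of shape] continuous_ray[of connection] continuous_ray[of curvature_matrix]
        smooth_on_derivative smooth_shape smooth_connection smooth_curvature)
  moreover have "(?F \<longlongrightarrow> 0) (at 0)"
    by (rule tendsto_eventually) (rule eventually_mono[OF eventually_ray], use riccati in blast)
  ultimately have "2 *\<^sub>R shape 0 = 0" using tendsto_unique[OF trivial_limit_at] by fastforce
  then show ?thesis by simp
qed

lemma shape_quotient: "((\<lambda>t. (1 / t) *\<^sub>R shape (t *\<^sub>R u)) \<longlongrightarrow> frechet_derivative shape (at 0) u) (at 0)"
proof (rule tendstoI)
  let ?D = "frechet_derivative shape (at 0) u"
  fix e :: real assume "e > 0"
  moreover have "((\<lambda>t. norm (shape (t *\<^sub>R u) - t *\<^sub>R ?D) / \<bar>t\<bar>) \<longlongrightarrow> 0) (at 0)"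
    using ray_derivative[OF smooth_shape, of 0] radius shape_origin
    by (simp add: has_vector_derivative_def has_derivative_iff_norm)
  ultimately have "eventually (\<lambda>t. norm (shape (t *\<^sub>R u) - t *\<^sub>R ?D) / \<bar>t\<bar> < e) (at 0)"
    by (auto dest!: tendstoD)
  then show "eventually (\<lambda>t. dist ((1 / t) *\<^sub>R shape (t *\<^sub>R u)) ?D < e) (at 0)"
    using eventually_ray
  proof eventually_elim
    case (elim t)
    then have "(1 / t) *\<^sub>R shape (t *\<^sub>R u) - ?D = (1 / t) *\<^sub>R (shape (t *\<^sub>R u) - t *\<^sub>R ?D)"
      by (simp add: scaleR_diff_right)
    then have "dist ((1 / t) *\<^sub>R shape (t *\<^sub>R u)) ?D = norm (shape (t *\<^sub>R u) - t *\<^sub>R ?D) / \<bar>t\<bar>"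
      by (simp add: dist_norm)
    then show ?case using elim by simp
  qed
qed

text \<open>This is the limit of \<open>riccati\<close> divided by \<open>t\<close>: since
  \<open>V\<close> vanishes at the origin, \<open>V / t\<close> tends to \<open>V'\<close>, and the
  limit reads \<open>V' + 2 V' + R = 0\<close>.\<close>

lemma shape_derivative_origin: "3 *\<^sub>R frechet_derivative shape (at 0) u = - curvature_matrix 0"
proof -
  let ?F = "\<lambda>t. frechet_derivative shape (at (t *\<^sub>R u)) u + 2 *\<^sub>R ((1 / t) *\<^sub>R shape (t *\<^sub>R u)) +
    shape (t *\<^sub>R u) ** shape (t *\<^sub>R u) +
    (connection (t *\<^sub>R u) ** shape (t *\<^sub>R u) - shape (t *\<^sub>R u) ** connection (t *\<^sub>R u)) +
    curvature_matrix (t *\<^sub>R u)"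
  have "(?F \<longlongrightarrow> frechet_derivative shape (at 0) u + 2 *\<^sub>R frechet_derivative shape (at 0) u + shape 0 ** shape 0 +
    (connection 0 ** shape 0 - shape 0 ** connection 0) + curvature_matrix 0) (at 0)"
    by (intro tendsto_intros tendsto_matrix_mult continuous_ray[of "\<lambda>x. frechet_derivative shape (at x) u"]
        continuous_ray[of shape] continuous_ray[of connection] continuous_ray[of curvature_matrix]
        smooth_on_derivative smooth_shape smooth_connection smooth_curvature shape_quotient)
  moreover have "(?F \<longlongrightarrow> 0) (at 0)"
  proof (rule tendsto_eventually, rule eventually_mono[OF eventually_ray])
    fix t assume t: "t *\<^sub>R u \<in> ball 0 \<delta> \<and> t \<noteq> 0"
    then have "t *\<^sub>R ?F t = 0"
      using riccati[of t] by (simp add: scaleR_add_right scaleR_diff_right)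
    then show "?F t = 0" using t by simp
  qed
  ultimately have "frechet_derivative shape (at 0) u + 2 *\<^sub>R frechet_derivative shape (at 0) u + shape 0 ** shape 0 +
    (connection 0 ** shape 0 - shape 0 ** connection 0) + curvature_matrix 0 = 0"
    using tendsto_unique[OF trivial_limit_at] by blast
  then have "3 *\<^sub>R frechet_derivative shape (at 0) u + curvature_matrix 0 = 0"
    by (simp add: shape_origin matrix_mult_distribs vec_eq_iff)
  then show ?thesis by (simp add: eq_neg_iff_add_eq_0)
qed

lemma trace_riccati:
  assumes t: "t *\<^sub>R u \<in> ball 0 \<delta>" "t \<noteq> 0"
  shows "((\<lambda>s. trace (shape (s *\<^sub>R u))) has_real_derivative
    - 2 * trace (shape (t *\<^sub>R u)) / t - trace (shape (t *\<^sub>R u) ** shape (t *\<^sub>R u))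
    - trace (curvature_matrix (t *\<^sub>R u))) (at t)"
proof -
  let ?V = "shape (t *\<^sub>R u)" and ?P = "connection (t *\<^sub>R u)"
  have d: "((\<lambda>s. trace (shape (s *\<^sub>R u))) has_real_derivative trace (frechet_derivative shape (at (t *\<^sub>R u)) u)) (at t)"
    using bounded_linear.has_vector_derivative[OF bounded_linear_trace ray_derivative[OF smooth_shape t(1)]]
    by (simp add: has_real_derivative_iff_has_vector_derivative)
  have "trace (t *\<^sub>R frechet_derivative shape (at (t *\<^sub>R u)) u + 2 *\<^sub>R ?V + t *\<^sub>R (?V ** ?V) +
    t *\<^sub>R (?P ** ?V - ?V ** ?P) + t *\<^sub>R curvature_matrix (t *\<^sub>R u)) = 0"
    using riccati[OF t] by (simp add: trace_def)
  then have "t * trace (frechet_derivative shape (at (t *\<^sub>R u)) u) + 2 * trace ?V + t * trace (?V ** ?V) +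
     t * trace (curvature_matrix (t *\<^sub>R u)) = 0"
    by (simp add: trace_add trace_sub trace_scaleR trace_mul_sym[of ?P])
  then have "trace (frechet_derivative shape (at (t *\<^sub>R u)) u) =
    - 2 * trace ?V / t - trace (?V ** ?V) - trace (curvature_matrix (t *\<^sub>R u))"
    using t(2) by (simp add: field_simps)
  with d show ?thesis by simp
qed

end

end

subsection \<open>Model densities\<close>

text \<open>A common notation for both signs, so that one calculation serves the trigonometric and
  the hyperbolic density.\<close>

definition msin :: "int \<Rightarrow> real \<Rightarrow> real" where
  "msin \<epsilon> t = (if \<epsilon> = 1 then sin t else sinh t)"

definition mcos :: "int \<Rightarrow> real \<Rightarrow> real" where
  "mcos \<epsilon> t = (if \<epsilon> = 1 then cos t else cosh t)"

lemma model_density_eq: "model_density \<epsilon> (int N + 1) k r = msin \<epsilon> r ^ N * mcos \<epsilon> r powi k"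
  by (simp add: model_density_def msin_def mcos_def)

lemma msin_pos: "0 < t \<Longrightarrow> t < 1 \<Longrightarrow> msin \<epsilon> t > 0"
  using pi_gt3 by (auto simp: msin_def intro!: sin_gt_zero)

lemma mcos_pos: "0 < t \<Longrightarrow> t < 1 \<Longrightarrow> mcos \<epsilon> t > 0"
  using pi_gt3 by (auto simp: mcos_def intro!: cos_gt_zero)

lemma DERIV_msin: "(msin \<epsilon> has_real_derivative mcos \<epsilon> t) (at t)"
  unfolding msin_def[abs_def] mcos_def by (cases "\<epsilon> = 1") (auto intro!: derivative_eq_intros)

lemma DERIV_mcos: "\<epsilon> \<in> {1, -1} \<Longrightarrow> (mcos \<epsilon> has_real_derivative - of_int \<epsilon> * msin \<epsilon> t) (at t)"
  unfolding mcos_def[abs_def] msin_def by (auto intro!: derivative_eq_intros)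

lemma mcos_msin_squared: "\<epsilon> \<in> {1, -1} \<Longrightarrow> (mcos \<epsilon> t)\<^sup>2 = 1 - of_int \<epsilon> * (msin \<epsilon> t)\<^sup>2"
  by (auto simp: mcos_def msin_def cos_squared_eq cosh_square_eq)

lemma msin_over_self: "((\<lambda>t. msin \<epsilon> t / t) \<longlongrightarrow> 1) (at_right 0)"
  unfolding msin_def by (cases "\<epsilon> = 1") (simp_all, real_asymp+)

lemma mcos_origin: "(mcos \<epsilon> \<longlongrightarrow> 1) (at_right 0)"
  unfolding mcos_def[abs_def] by (cases "\<epsilon> = 1") (simp_all, real_asymp+)

text \<open>The mean curvature of geodesic spheres minus its Euclidean value \<open>N / t\<close>.\<close>

definition model_mean_curvature :: "int \<Rightarrow> real \<Rightarrow> real \<Rightarrow> real \<Rightarrow> real" where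
  "model_mean_curvature \<epsilon> N k t =
     N * (mcos \<epsilon> t / msin \<epsilon> t - 1 / t) - of_int \<epsilon> * k * msin \<epsilon> t / mcos \<epsilon> t"

definition model_mean_curvature' :: "int \<Rightarrow> real \<Rightarrow> real \<Rightarrow> real \<Rightarrow> real" where
  "model_mean_curvature' \<epsilon> N k t =
     N * (1 / t\<^sup>2 - 1 / (msin \<epsilon> t)\<^sup>2) - of_int \<epsilon> * k / (mcos \<epsilon> t)\<^sup>2"

lemma DERIV_model_mean_curvature:
  assumes "\<epsilon> \<in> {1, -1}" "0 < t" "t < 1"
  shows "(model_mean_curvature \<epsilon> N k has_real_derivative model_mean_curvature' \<epsilon> N k t) (at t)"
proof -
  note p = msin_pos[OF assms(2,3), of \<epsilon>] mcos_pos[OF assms(2,3), of \<epsilon>]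
  let ?s = "msin \<epsilon> t" and ?c = "mcos \<epsilon> t" and ?e = "of_int \<epsilon> :: real"
  have "(model_mean_curvature \<epsilon> N k has_real_derivative
     N * ((- ?e * ?s * ?s - ?c * ?c) / (?s * ?s) + 1 / t\<^sup>2) -
     (?e * k * ?c * ?c - ?e * k * ?s * (- ?e * ?s)) / (?c * ?c)) (at t)"
    unfolding model_mean_curvature_def[abs_def]
    using p assms
    by (auto intro!: derivative_eq_intros DERIV_msin DERIV_mcos simp: power2_eq_square)
  moreover have "(- ?e * ?s * ?s - ?c * ?c) / (?s * ?s) = - (1 / ?s\<^sup>2)"
  proof -
    have "- ?e * ?s * ?s - ?c * ?c = - 1"
      using mcos_msin_squared[OF assms(1), of t] by (simp add: power2_eq_square algebra_simps)
    then show ?thesis by (simp add: power2_eq_square)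
  qed
  moreover have "(?e * k * ?c * ?c - ?e * k * ?s * (- ?e * ?s)) / (?c * ?c) = ?e * k / ?c\<^sup>2"
  proof -
    have "?e * k * ?c * ?c - ?e * k * ?s * (- ?e * ?s) = ?e * k * (?c\<^sup>2 + ?e * ?s\<^sup>2)"
      by (simp add: power2_eq_square algebra_simps)
    also have "\<dots> = ?e * k" using mcos_msin_squared[OF assms(1), of t] by simp
    finally show ?thesis by (simp add: power2_eq_square)
  qed
  ultimately show ?thesis by (simp add: model_mean_curvature'_def)
qed

text \<open>The model mean curvature \<open>h\<close> expands as
  \<open>- \<epsilon> (N/3 + k) t - (N/45 + k/3) t^3 + ...\<close>; in \<open>h' + 2 h / t\<close>
  the coefficient of \<open>t\<close> is multiplied by 3.\<close>

lemma model_ricci_limit: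
  assumes "\<epsilon> \<in> {1, -1}"
  shows "((\<lambda>t. - (model_mean_curvature' \<epsilon> N k t + 2 * model_mean_curvature \<epsilon> N k t / t))
    \<longlongrightarrow> of_int \<epsilon> * (N + 3 * k)) (at_right 0)"
proof (cases "\<epsilon> = 1")
  case True
  then show ?thesis
    unfolding model_mean_curvature'_def model_mean_curvature_def msin_def mcos_def
    by (simp, real_asymp)
next
  case False
  then have "\<epsilon> = -1" using assms by auto
  then show ?thesis
    unfolding model_mean_curvature'_def model_mean_curvature_def msin_def mcos_def
    by (simp, real_asymp)
qed

text \<open>In \<open>h' + 2 h / t\<close> the coefficient of \<open>t^3\<close> is multiplied by 5,
  which gives \<open>5 (N/45 + k/3) = (N + 15 k) / 9\<close>. The substitution of \<open>i t\<close>
  for \<open>t\<close> that exchanges the two models leaves its sign unchanged.\<close>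

lemma model_second_limit:
  assumes "\<epsilon> \<in> {1, -1}"
  shows "((\<lambda>t. (- (model_mean_curvature' \<epsilon> N k t + 2 * model_mean_curvature \<epsilon> N k t / t) -
     of_int \<epsilon> * (N + 3 * k)) / t\<^sup>2) \<longlongrightarrow> (N + 15 * k) / 9) (at_right 0)"
proof (cases "\<epsilon> = 1")
  case True
  then show ?thesis
    unfolding model_mean_curvature'_def model_mean_curvature_def msin_def mcos_def
    by (simp, real_asymp)
next
  case False
  then have "\<epsilon> = -1" using assms by auto
  then show ?thesis
    unfolding model_mean_curvature'_def model_mean_curvature_def msin_def mcos_def
    by (simp, real_asymp)
qed

text \<open>Both factors are differentiated logarithmically; dividing by \<open>t ^ N\<close>
  beforehand takes away the singular \<open>N / t\<close>, just as in
  \<open>model_mean_curvature\<close>.\<close>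

lemma DERIV_normalized_density:
  assumes "\<epsilon> \<in> {1, -1}" "0 < t" "t < 1"
  shows "((\<lambda>t. (msin \<epsilon> t / t) ^ N * mcos \<epsilon> t powi k) has_real_derivative
    (msin \<epsilon> t / t) ^ N * mcos \<epsilon> t powi k * model_mean_curvature \<epsilon> (real N) (of_int k) t) (at t)"
proof -
  note p = msin_pos[OF assms(2,3), of \<epsilon>] mcos_pos[OF assms(2,3), of \<epsilon>]
  let ?s = "msin \<epsilon> t" and ?c = "mcos \<epsilon> t"
  have 1: "((\<lambda>t. msin \<epsilon> t / t) has_real_derivative (?s / t) * (?c / ?s - 1 / t)) (at t)"
    using p assms(2) by (auto intro!: derivative_eq_intros DERIV_msin simp: field_simps)
  have 2: "((\<lambda>t. (msin \<epsilon> t / t) ^ N) has_real_derivative (?s / t) ^ N * (real N * (?c / ?s - 1 / t))) (at t)"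
  proof (cases N)
    case (Suc M)
    then show ?thesis
      by (intro DERIV_cong[OF DERIV_power[OF 1]]) simp
  qed simp
  have "((\<lambda>t. mcos \<epsilon> t powi k) has_real_derivative of_int k * ?c powi (k - 1) * (- of_int \<epsilon> * ?s)) (at t)"
    using p by (intro DERIV_power_int DERIV_mcos assms) auto
  moreover have "?c powi (k - 1) = ?c powi k / ?c"
    using p by (simp add: power_int_diff)
  ultimately have 3: "((\<lambda>t. mcos \<epsilon> t powi k) has_real_derivative
      ?c powi k * (- of_int \<epsilon> * of_int k * ?s / ?c)) (at t)"
    by (simp add: mult_ac)
  show ?thesis
    by (rule DERIV_cong[OF DERIV_mult[OF 2 3]]) (simp add: model_mean_curvature_def algebra_simps)
qed

section \<open>From the density to the traces of the curvature and of its square\<close>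

context exponential_coordinates
begin

definition volume :: "real^'n \<Rightarrow> real" where
  "volume x = (det (J x))\<^sup>2 * det (G (E x))"

lemma det_pullback: "det (transpose (J x) ** G (E x) ** J x) = volume x"
  by (simp add: det_mul volume_def power2_eq_square)

lemma volume_origin: "volume 0 = 1"
  using arg_cong[OF orthonormal_origin, of det] by (simp add: det_pullback)

context
  fixes \<epsilon> k :: int and N :: nat and u :: "real^'n"
  assumes sign: "\<epsilon> \<in> {1, -1}" and unit: "norm u = 1"
    and density: "\<And>x. 0 < norm x \<Longrightarrow> norm x < \<delta> \<Longrightarrow>
      norm x ^ (CARD('n) - 1) * sqrt (det (transpose (J x) ** G (E x) ** J x)) =
      model_density \<epsilon> (int N + 1) k (norm x)"
begin

lemma ray_in_ball: "0 < t \<Longrightarrow> t < \<delta> \<Longrightarrow> t *\<^sub>R u \<in> ball 0 \<delta>"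
  using unit by simp

lemma eventually_ray_right: "eventually (\<lambda>t. 0 < t \<and> t < \<delta> \<and> t < 1) (at_right (0::real))"
  using radius by (auto simp: eventually_at_right[of 0 1] intro!: exI[of _ "min \<delta> 1"])

lemma density_ray:
  assumes "0 < t" "t < \<delta>"
  shows "t ^ (CARD('n) - 1) * sqrt (volume (t *\<^sub>R u)) = t ^ N * ((msin \<epsilon> t / t) ^ N * mcos \<epsilon> t powi k)"
  using density[of "t *\<^sub>R u"] assms unit
  by (simp add: det_pullback model_density_eq power_divide)

lemma sqrt_volume_limit: "((\<lambda>t. sqrt (volume (t *\<^sub>R u))) \<longlongrightarrow> 1) (at_right 0)"
proof -
  have "((\<lambda>s. volume (s *\<^sub>R u)) has_real_derivative 2 * volume (0 *\<^sub>R u) * trace (shape u (0 *\<^sub>R u))) (at 0)"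
    unfolding volume_def by (rule volume_derivative) (use radius in auto)
  then have "((\<lambda>s. volume (s *\<^sub>R u)) \<longlongrightarrow> 1) (at 0)"
    using DERIV_isCont isContD volume_origin by fastforce
  then show ?thesis
    using tendsto_real_sqrt[of _ 1] by (auto intro: filterlim_at_split[THEN iffD1, THEN conjunct2])
qed

lemma normalized_density_limit: "((\<lambda>t. (msin \<epsilon> t / t) ^ N * mcos \<epsilon> t powi k) \<longlongrightarrow> 1) (at_right 0)"
proof -
  have "((\<lambda>t. (msin \<epsilon> t / t) ^ N * mcos \<epsilon> t powi k) \<longlongrightarrow> 1 ^ N * 1 powi k) (at_right 0)"
    by (intro tendsto_intros msin_over_self mcos_origin) auto
  then show ?thesis by simp
qed

text \<open>After the powers of \<open>t\<close> are split off, both expressions for the density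
  tend to 1 at the origin, so a difference of exponents would force one of these limits to be
  0.\<close>

lemma dimension_eq: "CARD('n) - 1 = N"
proof (rule ccontr)
  let ?n = "CARD('n) - 1" and ?q = "\<lambda>t. sqrt (volume (t *\<^sub>R u))"
    and ?F = "\<lambda>t. (msin \<epsilon> t / t) ^ N * mcos \<epsilon> t powi k"
  have contr: False if fg: "(f \<longlongrightarrow> (1::real)) (at_right 0)" "(g \<longlongrightarrow> 1) (at_right 0)" and "a < b"
    and eq: "\<And>t::real. 0 < t \<Longrightarrow> t < \<delta> \<Longrightarrow> t ^ a * f t = t ^ b * g t" for a b f g
  proof -
    have "((\<lambda>t. t ^ (b - a) * g t) \<longlongrightarrow> 0 ^ (b - a) * 1) (at_right 0)"
      by (intro tendsto_intros fg)
    moreover have "eventually (\<lambda>t. t ^ (b - a) * g t = f t) (at_right 0)"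
      using eventually_ray_right
    proof eventually_elim
      case (elim t)
      have "t ^ a * (t ^ (b - a) * g t) = t ^ a * f t"
        using eq[of t] elim \<open>a < b\<close> by (simp flip: power_add mult.assoc)
      then show ?case using elim by simp
    qed
    ultimately have "(f \<longlongrightarrow> 0 ^ (b - a) * 1) (at_right 0)"
      by (rule Lim_transform_eventually)
    then have "(f \<longlongrightarrow> 0) (at_right 0)" using \<open>a < b\<close> by (simp add: zero_power)
    then show False using fg(1) tendsto_unique[OF trivial_limit_at_right_real] by force
  qed
  assume "?n \<noteq> N"
  then consider "?n < N" | "N < ?n" by linarith
  then show False
    by cases (use contr[OF sqrt_volume_limit normalized_density_limit] density_ray
        contr[OF normalized_density_limit sqrt_volume_limit] in \<open>force+\<close>)
qed

text \<open>Two expressions of the same function are differentiated logarithmically. The bound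
  \<open>t < 1\<close> keeps \<open>msin\<close> and \<open>mcos\<close> positive.\<close>

lemma trace_shape_eq:
  assumes t: "0 < t" "t < \<delta>" "t < 1"
  shows "trace (shape u (t *\<^sub>R u)) = model_mean_curvature \<epsilon> (real N) (of_int k) t"
proof -
  let ?F = "\<lambda>t. (msin \<epsilon> t / t) ^ N * mcos \<epsilon> t powi k"
  have eq: "sqrt (volume (s *\<^sub>R u)) = ?F s" if "0 < s" "s < \<delta>" for s
    using density_ray[OF that] that unfolding dimension_eq by simp
  have F: "?F t > 0"
    using msin_pos[OF t(1,3)] mcos_pos[OF t(1,3)] t by simp
  then have pos: "volume (t *\<^sub>R u) > 0" using eq[OF t(1,2)] by (metis real_sqrt_gt_0_iff)
  have "((\<lambda>s. volume (s *\<^sub>R u)) has_real_derivative 2 * volume (t *\<^sub>R u) * trace (shape u (t *\<^sub>R u))) (at t)"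
    unfolding volume_def by (rule volume_derivative[OF ray_in_ball[OF t(1,2)]])
  from DERIV_chain2[OF DERIV_real_sqrt[OF pos] this]
  have "((\<lambda>s. sqrt (volume (s *\<^sub>R u))) has_real_derivative
     inverse (sqrt (volume (t *\<^sub>R u))) / 2 * (2 * volume (t *\<^sub>R u) * trace (shape u (t *\<^sub>R u)))) (at t)" .
  moreover have "inverse (sqrt (volume (t *\<^sub>R u))) / 2 * (2 * volume (t *\<^sub>R u) * trace (shape u (t *\<^sub>R u))) =
     sqrt (volume (t *\<^sub>R u)) * trace (shape u (t *\<^sub>R u))"
    using pos by (simp add: field_simps flip: power2_eq_square)
  ultimately have "((\<lambda>s. sqrt (volume (s *\<^sub>R u))) has_real_derivative ?F t * trace (shape u (t *\<^sub>R u))) (at t)"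
    unfolding eq[OF t(1,2), symmetric] by (rule DERIV_cong)
  then have "(?F has_real_derivative ?F t * trace (shape u (t *\<^sub>R u))) (at t)"
  proof (rule has_field_derivative_transform_within_open[where S = "{0<..<\<delta>}"])
  qed (use t eq in auto)
  from DERIV_unique[OF this DERIV_normalized_density[OF sign t(1,3)]]
  show ?thesis using F by (metis mult_left_cancel less_irrefl)
qed

text \<open>The traced Riccati equation, with \<open>tr V\<close> and its derivative now known in
  closed form, so that the geometry is confined to the left-hand side.\<close>

lemma trace_curvature_shape:
  assumes t: "0 < t" "t < \<delta>" "t < 1"
  shows "trace (shape u (t *\<^sub>R u) ** shape u (t *\<^sub>R u)) + trace (curvature_matrix u (t *\<^sub>R u)) =
    - (model_mean_curvature' \<epsilon> (real N) (of_int k) t + 2 * model_mean_curvature \<epsilon> (real N) (of_int k) t / t)"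
proof -
  have "((\<lambda>s. trace (shape u (s *\<^sub>R u))) has_real_derivative model_mean_curvature' \<epsilon> (real N) (of_int k) t) (at t)"
    by (rule has_field_derivative_transform_within_open[OF DERIV_model_mean_curvature[OF sign t(1,3)],
          where S = "{0<..<min \<delta> 1}"]) (use t trace_shape_eq in auto)
  from DERIV_unique[OF trace_riccati[OF ray_in_ball[OF t(1,2)]] this] t
  show ?thesis by (simp add: trace_shape_eq)
qed

lemma tendsto_trace: "(f \<longlongrightarrow> A) F \<Longrightarrow> ((\<lambda>x. trace (f x)) \<longlongrightarrow> trace A) F" for f :: "'b \<Rightarrow> real^'m^'m"
  by (rule bounded_linear.tendsto[OF bounded_linear_trace])

text \<open>\<open>V\<close> vanishes at the origin, so \<open>tr V\<^sup>2\<close> drops out of the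
  limit. For varying base point and unit vector this says that the Ricci curvature is a constant
  multiple of the metric.\<close>

lemma trace_curvature: "trace (curvature_matrix u 0) = of_int \<epsilon> * (real N + 3 * of_int k)"
proof -
  have sub: "at_right (0::real) \<le> at 0" by (simp add: at_le)
  have "((\<lambda>t. trace (shape u (t *\<^sub>R u) ** shape u (t *\<^sub>R u)) + trace (curvature_matrix u (t *\<^sub>R u)))
    \<longlongrightarrow> trace (shape u 0 ** shape u 0) + trace (curvature_matrix u 0)) (at_right 0)"
    by (intro tendsto_add tendsto_trace tendsto_matrix_mult tendsto_mono[OF sub] continuous_ray smooth_shape
        smooth_curvature)
  moreover have "((\<lambda>t. trace (shape u (t *\<^sub>R u) ** shape u (t *\<^sub>R u)) + trace (curvature_matrix u (t *\<^sub>R u)))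
    \<longlongrightarrow> of_int \<epsilon> * (real N + 3 * of_int k)) (at_right 0)"
    by (rule Lim_transform_eventually[OF model_ricci_limit[OF sign]])
      (rule eventually_mono[OF eventually_ray_right], simp add: trace_curvature_shape)
  ultimately show ?thesis
    using tendsto_unique[OF trivial_limit_at_right_real] by (force simp: shape_origin matrix_mult_distribs trace_def)
qed

text \<open>With \<open>tr R\<close> constant along the ray, \<open>tr V\<^sup>2\<close> is the
  remainder of the model beyond its leading term, and division by \<open>t\<^sup>2\<close> gives
  \<open>(N + 15 k) / 9\<close> in the limit. The 9 cancels because \<open>R = - 3 V'\<close> at the
  origin.\<close>

lemma trace_curvature_squared:
  assumes ricci: "\<And>t. 0 < t \<Longrightarrow> t < \<delta> \<Longrightarrow> trace (curvature_matrix u (t *\<^sub>R u)) = of_int \<epsilon> * (real N + 3 * of_int k)"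
  shows "trace (curvature_matrix u 0 ** curvature_matrix u 0) = real N + 15 * of_int k"
proof -
  let ?D = "frechet_derivative (shape u) (at 0) u"
  have sub: "at_right (0::real) \<le> at 0" by (simp add: at_le)
  have "((\<lambda>t. trace (((1 / t) *\<^sub>R shape u (t *\<^sub>R u)) ** ((1 / t) *\<^sub>R shape u (t *\<^sub>R u)))) \<longlongrightarrow> trace (?D ** ?D)) (at_right 0)"
    by (intro tendsto_trace tendsto_matrix_mult tendsto_mono[OF sub] shape_quotient)
  moreover have "((\<lambda>t. trace (((1 / t) *\<^sub>R shape u (t *\<^sub>R u)) ** ((1 / t) *\<^sub>R shape u (t *\<^sub>R u))))
    \<longlongrightarrow> (real N + 15 * of_int k) / 9) (at_right 0)"
  proof (rule Lim_transform_eventually[OF model_second_limit[OF sign]], rule eventually_mono[OF eventually_ray_right])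
    fix t assume t: "0 < t \<and> t < \<delta> \<and> t < (1::real)"
    have "trace (((1 / t) *\<^sub>R shape u (t *\<^sub>R u)) ** ((1 / t) *\<^sub>R shape u (t *\<^sub>R u))) =
       trace (shape u (t *\<^sub>R u) ** shape u (t *\<^sub>R u)) / t\<^sup>2"
      by (simp add: matrix_mult_distribs power2_eq_square trace_scaleR)
    then show "(- (model_mean_curvature' \<epsilon> (real N) (of_int k) t +
         2 * model_mean_curvature \<epsilon> (real N) (of_int k) t / t) - of_int \<epsilon> * (real N + 3 * of_int k)) / t\<^sup>2 =
      trace (((1 / t) *\<^sub>R shape u (t *\<^sub>R u)) ** ((1 / t) *\<^sub>R shape u (t *\<^sub>R u)))"
      using trace_curvature_shape[of t] ricci[of t] t by simp
  qed
  ultimately have "trace (?D ** ?D) = (real N + 15 * of_int k) / 9"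
    using tendsto_unique[OF trivial_limit_at_right_real] by blast
  moreover have "curvature_matrix u 0 = - (3 *\<^sub>R ?D)"
    using shape_derivative_origin[of u] by (simp add: minus_equation_iff[of "curvature_matrix u 0"])
  then have "curvature_matrix u 0 ** curvature_matrix u 0 = 9 *\<^sub>R (?D ** ?D)"
    by (simp add: matrix_mult_distribs)
  ultimately show ?thesis by (simp add: trace_scaleR)
qed

end

end

subsection \<open>Trace inequality\<close>

lemma frobenius_inner: "A \<bullet> B = trace (transpose A ** B)" for A B :: "real^'n^'n"
  unfolding trace_def matrix_matrix_mult_def transpose_def inner_vec_def
  by simp (rule sum.swap)

lemma frobenius_outer: "A \<bullet> (\<chi> i j. x $ i * y $ j) = x \<bullet> (A *v y)" for A :: "real^'n^'n"
  by (simp add: inner_vec_def matrix_vector_mult_def sum_distrib_left mult_ac)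

lemma frobenius_mat_1: "A \<bullet> mat 1 = trace A" for A :: "real^'n^'n"
  by (simp add: inner_vec_def trace_def mat_def if_distrib cong: if_cong)

text \<open>Cauchy--Schwarz for the Frobenius product of \<open>S - \<mu> y y\<^sup>T\<close> with the projection
  \<open>1 - x x\<^sup>T - y y\<^sup>T\<close>.\<close>

lemma eigenvalue_trace_inequality:
  fixes S :: "real^'n^'n"
  assumes sym: "transpose S = S" and x: "x \<bullet> x = 1" "S *v x = 0"
    and y: "y \<bullet> y = 1" "S *v y = \<mu> *\<^sub>R y" and xy: "x \<bullet> y = 0"
  shows "(trace S - \<mu>)\<^sup>2 \<le> (trace (S ** S) - \<mu>\<^sup>2) * (real CARD('n) - 2)"
proof -
  define X Y where "X = (\<chi> i j. x $ i * x $ j)" and "Y = (\<chi> i j. y $ i * y $ j)"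
  have oX: "A \<bullet> X = x \<bullet> (A *v x)" and oY: "A \<bullet> Y = y \<bullet> (A *v y)" for A
    by (simp_all add: X_def Y_def frobenius_outer)
  have m: "X *v v = (x \<bullet> v) *\<^sub>R x" "Y *v v = (y \<bullet> v) *\<^sub>R y" for v
    by (simp_all add: X_def Y_def vec_eq_iff matrix_vector_mult_def inner_vec_def sum_distrib_left sum_distrib_right mult_ac)
  have t: "trace X = 1" "trace Y = 1"
    using x(1) y(1) by (simp_all add: X_def Y_def trace_def inner_vec_def)
  have yx: "y \<bullet> x = 0" using xy by (simp add: inner_commute)
  have SX: "S \<bullet> X = 0" "S \<bullet> Y = \<mu>" "X \<bullet> X = 1" "Y \<bullet> Y = 1" "X \<bullet> Y = 0"
    using x y xy yx by (simp_all add: oX oY m)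
  have c: "Y \<bullet> S = \<mu>" "X \<bullet> S = 0" "Y \<bullet> X = 0" using SX by (simp_all add: inner_commute)
  have one: "mat 1 \<bullet> X = 1" "mat 1 \<bullet> Y = 1" "(mat 1 :: real^'n^'n) \<bullet> mat 1 = real CARD('n)" "X \<bullet> mat 1 = 1" "Y \<bullet> mat 1 = 1"
    "S \<bullet> mat 1 = trace S"
    using t x y by (simp_all add: frobenius_mat_1 trace_I oX oY)
  have SS: "S \<bullet> S = trace (S ** S)" by (simp add: frobenius_inner sym)
  \<comment> \<open>\<open>S - \<mu> Y\<close> annihilates both \<open>x\<close> and
    \<open>y\<close>, hence is orthogonal to \<open>X\<close> and \<open>Y\<close>, and its product
    with the projection is its trace. The projection has rank \<open>n - 2\<close>, which is also
    its squared norm.\<close>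
  have "(S - \<mu> *\<^sub>R Y) \<bullet> (mat 1 - X - Y) = trace S - \<mu>"
    by (simp add: inner_diff_left inner_diff_right SX c one)
  moreover have "(S - \<mu> *\<^sub>R Y) \<bullet> (S - \<mu> *\<^sub>R Y) = trace (S ** S) - \<mu>\<^sup>2"
    by (simp add: inner_diff_left inner_diff_right SX c one SS power2_eq_square)
  moreover have "(mat 1 - X - Y) \<bullet> (mat 1 - X - Y) = real CARD('n) - 2"
    by (simp add: inner_diff_left inner_diff_right SX c one)
  ultimately show ?thesis
    using Cauchy_Schwarz_ineq[of "S - \<mu> *\<^sub>R Y" "mat 1 - X - Y"] by simp
qed

subsection \<open>Uniqueness of geodesics\<close>

text \<open>The partial derivatives are bounded on a compact ball, and the sum of the bounds
  dominates the operator norm; the mean value inequality on the convex open ball gives the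
  constant.\<close>

lemma smooth_on_locally_lipschitz:
  fixes f :: "'a::euclidean_space \<Rightarrow> 'b::euclidean_space"
  assumes S: "open S" "x \<in> S" and f: "smooth_on S f"
  shows "\<exists>r>0. \<exists>K\<ge>0. ball x r \<subseteq> S \<and> (\<forall>a\<in>ball x r. \<forall>b\<in>ball x r. norm (f a - f b) \<le> K * norm (a - b))"
proof -
  obtain r where r: "r > 0" "cball x r \<subseteq> S" using S open_contains_cball by blast
  have "\<exists>B. \<forall>y\<in>cball x r. norm (frechet_derivative f (at y) i) \<le> B" for i
  proof -
    have "continuous_on (cball x r) (\<lambda>y. frechet_derivative f (at y) i)"
      by (rule continuous_on_subset[OF smooth_on_continuous[OF smooth_on_derivative[OF f]] r(2)])
    then have "bounded ((\<lambda>y. frechet_derivative f (at y) i) ` cball x r)"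
      by (intro compact_imp_bounded compact_continuous_image) auto
    then show ?thesis by (auto simp: bounded_iff)
  qed
  then have "\<exists>B. \<forall>i. \<forall>y\<in>cball x r. norm (frechet_derivative f (at y) i) \<le> B i" by (intro choice allI)
  then obtain B where B: "\<And>i y. y \<in> cball x r \<Longrightarrow> norm (frechet_derivative f (at y) i) \<le> B i" by blast
  define K where "K = (\<Sum>i\<in>Basis. B i)"
  have B0: "B i \<ge> 0" for i
    by (rule order_trans[OF norm_ge_zero B[of x]]) (use r(1) in auto)
  have K0: "K \<ge> 0" unfolding K_def by (intro sum_nonneg B0)
  have on: "onorm (frechet_derivative f (at y)) \<le> K" if y: "y \<in> cball x r" for y
  proof (rule onorm_le)
    fix v
    have lin: "linear (frechet_derivative f (at y))"
      using y r(2) by (intro linear_frechet_derivative smooth_on_differentiable[OF f]) auto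
    have "frechet_derivative f (at y) v = (\<Sum>i\<in>Basis. (v \<bullet> i) *\<^sub>R frechet_derivative f (at y) i)"
      using linear_sum[OF lin, of "\<lambda>i. (v \<bullet> i) *\<^sub>R i" Basis]
      by (simp add: euclidean_representation linear_cmul[OF lin])
    also have "norm \<dots> \<le> (\<Sum>i\<in>Basis. norm v * B i)"
    proof (rule sum_norm_le)
      fix i :: 'a assume i: "i \<in> Basis"
      show "norm ((v \<bullet> i) *\<^sub>R frechet_derivative f (at y) i) \<le> norm v * B i"
        unfolding norm_scaleR by (intro mult_mono Basis_le_norm[OF i] B[OF y] norm_ge_zero)
    qed
    also have "(\<Sum>i\<in>Basis. norm v * B i) = K * norm v"
      unfolding K_def sum_distrib_right by (rule sum.cong[OF refl mult.commute])
    finally show "norm (frechet_derivative f (at y) v) \<le> K * norm v" .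
  qed
  have "norm (f a - f b) \<le> K * norm (a - b)" if "a \<in> ball x r" "b \<in> ball x r" for a b
  proof -
    have d: "(f has_derivative frechet_derivative f (at y)) (at y within ball x r)" if "y \<in> ball x r" for y
    proof -
      have "y \<in> S" using that r(2) ball_subset_cball by blast
      then show ?thesis by (rule has_derivative_at_withinI[OF smooth_on_has_derivative[OF f]])
    qed
    have o: "onorm (frechet_derivative f (at y)) \<le> K" if "y \<in> ball x r" for y
      by (rule on) (use that in simp)
    show ?thesis by (rule differentiable_bound[OF convex_ball d o that])
  qed
  moreover have "ball x r \<subseteq> S" using r(2) ball_subset_cball by blast
  ultimately show ?thesis by (intro exI[of _ r] exI[of _ K] conjI r(1) K0 ballI)
qed

text \<open>Gronwall's argument: the squared distance \<open>D\<close> satisfies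
  \<open>\<bar>D'\<bar> \<le> 2 K D\<close>, so \<open>D\<close> times \<open>exp (- 2 K t)\<close>
  does not increase after \<open>t0\<close> and \<open>D\<close> times \<open>exp (2 K t)\<close>
  does not decrease before it, and both products vanish at \<open>t0\<close>.\<close>

lemma lipschitz_ode_unique:
  fixes f :: "'a::real_inner \<Rightarrow> 'a" and x y :: "real \<Rightarrow> 'a"
  assumes lip: "\<And>a b. a \<in> U \<Longrightarrow> b \<in> U \<Longrightarrow> norm (f a - f b) \<le> K * norm (a - b)"
    and x: "\<And>t. t \<in> {a<..<b} \<Longrightarrow> x t \<in> U \<and> (x has_vector_derivative f (x t)) (at t)"
    and y: "\<And>t. t \<in> {a<..<b} \<Longrightarrow> y t \<in> U \<and> (y has_vector_derivative f (y t)) (at t)"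
    and t0: "t0 \<in> {a<..<b}" "x t0 = y t0" and t: "t \<in> {a<..<b}"
  shows "x t = y t"
proof -
  define D where "D = (\<lambda>t. (x t - y t) \<bullet> (x t - y t))"
  define D' where "D' = (\<lambda>t. 2 * ((x t - y t) \<bullet> (f (x t) - f (y t))))"
  have D: "(D has_real_derivative D' t) (at t)" if "t \<in> {a<..<b}" for t
  proof -
    have "((\<lambda>t. x t - y t) has_vector_derivative f (x t) - f (y t)) (at t)"
      using x[OF that] y[OF that] by (intro has_vector_derivative_diff) auto
    from bounded_bilinear.has_vector_derivative[OF bounded_bilinear_inner this this]
    show ?thesis
      by (simp add: D_def D'_def has_real_derivative_iff_has_vector_derivative inner_commute)
  qed
  have bound: "\<bar>D' t\<bar> \<le> 2 * K * D t" if "t \<in> {a<..<b}" for t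
  proof -
    have "\<bar>(x t - y t) \<bullet> (f (x t) - f (y t))\<bar> \<le> norm (x t - y t) * norm (f (x t) - f (y t))"
      by (rule Cauchy_Schwarz_ineq2)
    also have "\<dots> \<le> norm (x t - y t) * (K * norm (x t - y t))"
      using x[OF that] y[OF that] by (intro mult_left_mono lip) auto
    also have "\<dots> = K * D t" by (simp add: D_def power2_norm_eq_inner[symmetric] power2_eq_square)
    finally show ?thesis by (simp add: D'_def abs_mult)
  qed
  have e: "((\<lambda>t. D t * exp (c * t)) has_real_derivative (D' t + c * D t) * exp (c * t)) (at t)"
    if "t \<in> {a<..<b}" for t c
    by (rule DERIV_cong[OF DERIV_mult[OF D[OF that]]])
      (auto intro!: derivative_eq_intros simp: algebra_simps)
  have D0: "D t0 = 0" using t0 by (simp add: D_def)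
  have "D t \<le> 0"
  proof (cases "t0 \<le> t")
    case True
    have "D t * exp (- (2 * K) * t) \<le> D t0 * exp (- (2 * K) * t0)"
    proof (rule DERIV_nonpos_imp_nonincreasing[OF True])
      fix s assume "t0 \<le> s" "s \<le> t"
      then have s: "s \<in> {a<..<b}" using t0 t by auto
      have "(D' s + - (2 * K) * D s) * exp (- (2 * K) * s) \<le> 0"
        using bound[OF s] by (intro mult_nonpos_nonneg) auto
      then show "\<exists>y. ((\<lambda>t. D t * exp (- (2 * K) * t)) has_real_derivative y) (at s) \<and> y \<le> 0"
        using e[OF s, of "- (2 * K)"] by blast
    qed
    then show ?thesis by (simp add: D0 mult_le_0_iff)
  next
    case False
    have "D t * exp (2 * K * t) \<le> D t0 * exp (2 * K * t0)"
    proof (rule DERIV_nonneg_imp_nondecreasing[where f = "\<lambda>t. D t * exp (2 * K * t)" and a = t and b = t0])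
      show "t \<le> t0" using False by simp
    next
      fix s assume "t \<le> s" "s \<le> t0"
      then have s: "s \<in> {a<..<b}" using t0 t by auto
      have "0 \<le> (D' s + 2 * K * D s) * exp (2 * K * s)"
        using bound[OF s] by (intro mult_nonneg_nonneg) auto
      then show "\<exists>y. ((\<lambda>t. D t * exp (2 * K * t)) has_real_derivative y) (at s) \<and> 0 \<le> y"
        using e[OF s, of "2 * K"] by blast
    qed
    then show ?thesis by (simp add: D0 mult_le_0_iff)
  qed
  moreover have "D t \<ge> 0" by (simp add: D_def)
  ultimately have "D t = 0" by simp
  then show ?thesis by (simp add: D_def)
qed

section \<open>Geodesics in charts\<close>

lemma is_chart_inj: "is_chart X c \<Longrightarrow> inj_on (chart_map c) (chart_dom c)"
  by (metis homeomorphic_imp_injective_map is_chart_def openin_subset topspace_subtopology_subset)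

lemma chart_inv_chart_map: "is_chart X c \<Longrightarrow> p \<in> chart_dom c \<Longrightarrow> chart_inv c (chart_map c p) = p"
  by (simp add: chart_inv_def is_chart_inj inv_into_f_f)

lemma open_chart_image:
  assumes c: "is_chart X c" and V: "openin X V"
  shows "open (chart_map c ` (chart_dom c \<inter> V))"
proof -
  have "open_map (subtopology X (chart_dom c)) (top_of_set (chart_im c)) (chart_map c)"
    using c homeomorphic_imp_open_map by (auto simp: is_chart_def)
  moreover have "openin (subtopology X (chart_dom c)) (chart_dom c \<inter> V)"
    using V by (auto simp: openin_subtopology)
  ultimately have "openin (top_of_set (chart_im c)) (chart_map c ` (chart_dom c \<inter> V))"
    by (auto simp: open_map_def)
  then show ?thesis using c by (auto simp: is_chart_def openin_open_eq)
qed

lemma has_vector_derivative_Pair: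
  assumes "(f has_vector_derivative f') (at t)" "(g has_vector_derivative g') (at t)"
  shows "((\<lambda>t. (f t, g t)) has_vector_derivative (f', g')) (at t)"
  using has_derivative_Pair[OF assms[unfolded has_vector_derivative_def]]
  by (simp add: has_vector_derivative_def)

text \<open>The geodesic equation as a first-order system for position and velocity, the form to
  which the Lipschitz uniqueness applies.\<close>

lemma (in coordinate_metric) smooth_geodesic_field:
  "smooth_on (\<Omega> \<times> UNIV) (\<lambda>z. (snd z, - \<Gamma> (fst z) (snd z) (snd z)))"
proof -
  have o: "open (\<Omega> \<times> (UNIV :: (real^'n) set))" by (intro open_Times open_domain open_UNIV)
  have "smooth_on (\<Omega> \<times> UNIV) (\<lambda>z. \<Gamma> (fst z) (snd z) (snd z))"
    by (rule smooth_on_bilinear_family[OF o open_domain _ _ bilinear_christoffel smooth_christoffel])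
      (auto intro: smooth_on_linear[OF o] bounded_linear_fst bounded_linear_snd)
  then have "smooth_on (\<Omega> \<times> UNIV) (\<lambda>z. - \<Gamma> (fst z) (snd z) (snd z))" by (rule smooth_on_minus[OF o])
  then have 1: "smooth_on (\<Omega> \<times> UNIV) (\<lambda>z. (0 :: real^'n, - \<Gamma> (fst z) (snd z) (snd z)))"
    by (rule smooth_on_linear_compose[OF o, rotated]) (intro bounded_linear_Pair bounded_linear_ident bounded_linear_zero)
  have 2: "smooth_on (\<Omega> \<times> UNIV) (\<lambda>z :: (real^'n) \<times> (real^'n). (snd z, 0 :: real^'n))"
    by (intro smooth_on_linear[OF o] bounded_linear_Pair bounded_linear_snd bounded_linear_zero)
  from smooth_on_add[OF o 2 1] show ?thesis by simp
qed

context
  fixes M :: "('a, 'n::finite) riemannian"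
  assumes M: "riemannian_manifold M"
begin

lemma atlas_chart: "c \<in> atlas M \<Longrightarrow> is_chart (space_top M) c"
  using M by (auto simp: riemannian_manifold_def smooth_manifold_def)

lemma coordinate_metric_chart: "c \<in> atlas M \<Longrightarrow> coordinate_metric (chart_im c) (metric M c)"
  using M atlas_chart[of c] by (unfold_locales) (auto simp: riemannian_manifold_def is_chart_def)

lemma chart_at_atlas:
  assumes "p \<in> topspace (space_top M)"
  shows "chart_at M p \<in> atlas M" "p \<in> chart_dom (chart_at M p)"
proof -
  have "\<exists>c. c \<in> atlas M \<and> p \<in> chart_dom c"
    using M assms by (auto simp: riemannian_manifold_def smooth_manifold_def)
  from someI_ex[OF this] show "chart_at M p \<in> atlas M" "p \<in> chart_dom (chart_at M p)"
    by (auto simp: chart_at_def)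
qed

lemma geodesic_eventually_in:
  assumes "geodesic_on M \<gamma> {a<..<b}" "t \<in> {a<..<b}" "openin (space_top M) V" "\<gamma> t \<in> V"
  shows "eventually (\<lambda>s. s \<in> {a<..<b} \<and> \<gamma> s \<in> V) (nhds t)"
proof -
  have "openin (top_of_set {a<..<b}) {s \<in> topspace (top_of_set {a<..<b}). \<gamma> s \<in> V}"
    using assms by (intro openin_continuous_map_preimage) (auto simp: geodesic_on_def)
  then have "open {s \<in> {a<..<b}. \<gamma> s \<in> V}" by (simp add: openin_open_eq)
  from eventually_nhds_in_open[OF this, of t] assms show ?thesis by simp
qed

lemma geodesic_velocity:
  "geodesic_on M \<gamma> I \<Longrightarrow> c \<in> atlas M \<Longrightarrow> \<exists>v. \<forall>t\<in>I. \<gamma> t \<in> chart_dom c \<longrightarrow>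
      ((chart_map c \<circ> \<gamma>) has_vector_derivative v t) (at t) \<and>
      (v has_vector_derivative - christoffel_vec (metric M c) (chart_map c (\<gamma> t)) (v t) (v t)) (at t)"
  by (simp add: geodesic_on_def)

text \<open>In the chart both geodesics become integral curves of one smooth vector field on
  positions and velocities; near \<open>t0\<close> they stay in a ball where it is
  Lipschitz.\<close>

lemma geodesic_locally_unique:
  assumes c: "c \<in> atlas M" and g: "geodesic_on M \<gamma>1 {a<..<b}" "geodesic_on M \<gamma>2 {a<..<b}"
    and t0: "t0 \<in> {a<..<b}" "\<gamma>1 t0 = \<gamma>2 t0" "\<gamma>1 t0 \<in> chart_dom c"
    and w: "((chart_map c \<circ> \<gamma>1) has_vector_derivative w) (at t0)"
      "((chart_map c \<circ> \<gamma>2) has_vector_derivative w) (at t0)"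
  shows "eventually (\<lambda>t. \<gamma>1 t = \<gamma>2 t) (nhds t0)"
proof -
  interpret coordinate_metric "chart_im c" "metric M c" by (rule coordinate_metric_chart[OF c])
  let ?f = "\<lambda>z. (snd z, - \<Gamma> (fst z) (snd z) (snd z))"
  obtain v1 where v1: "\<And>t. t \<in> {a<..<b} \<Longrightarrow> \<gamma>1 t \<in> chart_dom c \<Longrightarrow>
      ((chart_map c \<circ> \<gamma>1) has_vector_derivative v1 t) (at t) \<and>
      (v1 has_vector_derivative - \<Gamma> (chart_map c (\<gamma>1 t)) (v1 t) (v1 t)) (at t)"
    using geodesic_velocity[OF g(1) c] by blast
  obtain v2 where v2: "\<And>t. t \<in> {a<..<b} \<Longrightarrow> \<gamma>2 t \<in> chart_dom c \<Longrightarrow>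
      ((chart_map c \<circ> \<gamma>2) has_vector_derivative v2 t) (at t) \<and>
      (v2 has_vector_derivative - \<Gamma> (chart_map c (\<gamma>2 t)) (v2 t) (v2 t)) (at t)"
    using geodesic_velocity[OF g(2) c] by blast
  note v = v1 v2
  define z1 where "z1 = (\<lambda>t. (chart_map c (\<gamma>1 t), v1 t))"
  define z2 where "z2 = (\<lambda>t. (chart_map c (\<gamma>2 t), v2 t))"
  have z1: "(z1 has_vector_derivative ?f (z1 t)) (at t)" if "t \<in> {a<..<b}" "\<gamma>1 t \<in> chart_dom c" for t
    unfolding z1_def using v(1)[OF that] by (auto intro!: has_vector_derivative_Pair simp: o_def)
  have z2: "(z2 has_vector_derivative ?f (z2 t)) (at t)" if "t \<in> {a<..<b}" "\<gamma>2 t \<in> chart_dom c" for t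
    unfolding z2_def using v(2)[OF that] by (auto intro!: has_vector_derivative_Pair simp: o_def)
  \<comment> \<open>\<open>geodesic_on\<close> provides velocities only existentially; at
    \<open>t0\<close> they are identified by uniqueness of the derivative.\<close>
  have "v1 t0 = w" "v2 t0 = w"
    using vector_derivative_unique_at[OF conjunct1[OF v(1)[OF t0(1)]] w(1)]
      vector_derivative_unique_at[OF conjunct1[OF v(2)[OF t0(1)]] w(2)] t0 by auto
  then have z0: "z1 t0 = z2 t0" by (simp add: z1_def z2_def t0)
  have "z1 t0 \<in> chart_im c \<times> UNIV" using t0 by (simp add: z1_def chart_im_def)
  from smooth_on_locally_lipschitz[OF open_Times[OF open_domain open_UNIV] this smooth_geodesic_field]
  obtain r K where r: "r > 0" and lip: "\<And>p q. p \<in> ball (z1 t0) r \<Longrightarrow> q \<in> ball (z1 t0) r \<Longrightarrow>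
      norm (?f p - ?f q) \<le> K * norm (p - q)" by blast
  have dom: "openin (space_top M) (chart_dom c)" using atlas_chart[OF c] by (simp add: is_chart_def)
  have "eventually (\<lambda>t. t \<in> {a<..<b} \<and> \<gamma>1 t \<in> chart_dom c) (nhds t0)"
    by (rule geodesic_eventually_in[OF g(1) t0(1) dom t0(3)])
  moreover have "eventually (\<lambda>t. t \<in> {a<..<b} \<and> \<gamma>2 t \<in> chart_dom c) (nhds t0)"
    by (rule geodesic_eventually_in[OF g(2) t0(1) dom]) (use t0 in simp)
  moreover have "eventually (\<lambda>t. z1 t \<in> ball (z1 t0) r) (nhds t0)"
    by (rule eventually_curve_in_open[OF z1]) (use t0 r in auto)
  moreover have "eventually (\<lambda>t. z2 t \<in> ball (z1 t0) r) (nhds t0)"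
    by (rule eventually_curve_in_open[OF z2]) (use t0 r z0 in auto)
  ultimately have "eventually (\<lambda>t. (t \<in> {a<..<b} \<and> \<gamma>1 t \<in> chart_dom c) \<and> (t \<in> {a<..<b} \<and> \<gamma>2 t \<in> chart_dom c) \<and>
      z1 t \<in> ball (z1 t0) r \<and> z2 t \<in> ball (z1 t0) r) (nhds t0)" by eventually_elim blast
  then obtain d where d: "d > 0" and P: "\<And>t. dist t t0 < d \<Longrightarrow> (t \<in> {a<..<b} \<and> \<gamma>1 t \<in> chart_dom c) \<and>
     (t \<in> {a<..<b} \<and> \<gamma>2 t \<in> chart_dom c) \<and> z1 t \<in> ball (z1 t0) r \<and> z2 t \<in> ball (z1 t0) r"
    unfolding eventually_nhds_metric by blast
  have iv: "dist t t0 < d \<longleftrightarrow> t \<in> {t0 - d<..<t0 + d}" for t by (auto simp: dist_real_def)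
  have "\<gamma>1 t = \<gamma>2 t" if t: "dist t t0 < d" for t
  proof -
    have "z1 t = z2 t"
    proof (rule lipschitz_ode_unique[where U = "ball (z1 t0) r" and f = ?f and a = "t0 - d" and b = "t0 + d"])
      show "z1 s \<in> ball (z1 t0) r \<and> (z1 has_vector_derivative ?f (z1 s)) (at s)" if "s \<in> {t0 - d<..<t0 + d}" for s
        using P[of s] iv[of s] that z1[of s] by blast
      show "z2 s \<in> ball (z1 t0) r \<and> (z2 has_vector_derivative ?f (z2 s)) (at s)" if "s \<in> {t0 - d<..<t0 + d}" for s
        using P[of s] iv[of s] that z2[of s] by blast
    qed (use lip d z0 t iv in auto)
    then show ?thesis
      using P[OF t] is_chart_inj[OF atlas_chart[OF c]] by (auto simp: z1_def z2_def inj_on_def)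
  qed
  then show ?thesis unfolding eventually_nhds_metric using d by blast
qed

text \<open>The times around which the geodesics agree form a relatively open and closed subset of
  the interval. At a limit time the positions agree by the Hausdorff property and the velocities by
  continuity in a chart there, so local uniqueness applies.\<close>

lemma geodesic_unique:
  assumes p: "p \<in> topspace (space_top M)"
    and g: "geodesic_on M \<gamma>1 {a<..<b}" "geodesic_on M \<gamma>2 {a<..<b}" and ab: "a < 0" "0 < b"
    and init: "\<gamma>1 0 = p" "\<gamma>2 0 = p" "((chart_map (chart_at M p) \<circ> \<gamma>1) has_vector_derivative \<xi>) (at 0)"
      "((chart_map (chart_at M p) \<circ> \<gamma>2) has_vector_derivative \<xi>) (at 0)"
    and t: "t \<in> {a<..<b}"
  shows "\<gamma>1 t = \<gamma>2 t"
proof -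
  let ?I = "{a<..<b}"
  define S where "S = {t \<in> ?I. eventually (\<lambda>s. \<gamma>1 s = \<gamma>2 s) (nhds t)}"
  have "0 \<in> S"
    unfolding S_def using geodesic_locally_unique[OF chart_at_atlas(1)[OF p] g, of 0 \<xi>] chart_at_atlas(2)[OF p] init ab
    by auto
  moreover have "open S"
  proof (subst open_subopen, intro ballI)
    fix s assume s: "s \<in> S"
    then have "eventually (\<lambda>r. r \<in> ?I) (nhds s)" "eventually (\<lambda>r. eventually (\<lambda>s. \<gamma>1 s = \<gamma>2 s) (nhds r)) (nhds s)"
      by (auto simp: S_def eventually_eventually intro!: eventually_nhds_in_open[of ?I s, simplified])
    then have "eventually (\<lambda>r. r \<in> S) (nhds s)"
      by eventually_elim (simp add: S_def)
    then show "\<exists>T. open T \<and> s \<in> T \<and> T \<subseteq> S" by (auto simp: eventually_nhds)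
  qed
  then have "openin (top_of_set ?I) S" by (auto simp: openin_open_eq S_def)
  moreover have "closedin (top_of_set ?I) S"
    unfolding closedin_limpt
  proof (intro conjI allI impI)
    show "S \<subseteq> ?I" by (auto simp: S_def)
    fix t0 assume "t0 islimpt S \<and> t0 \<in> ?I"
    then obtain f where f: "\<And>n. f n \<in> S" "f \<longlonglongrightarrow> t0" and t0: "t0 \<in> ?I"
      unfolding islimpt_sequential by blast
    have feq: "eventually (\<lambda>s. \<gamma>1 s = \<gamma>2 s) (nhds (f n))" for n using f(1) by (auto simp: S_def)
    have seq: "eventually (\<lambda>n. P (f n)) sequentially" if "eventually P (nhds t0)" for P
      using f(2) that unfolding filterlim_iff by simp
    have top: "\<gamma> t0 \<in> topspace (space_top M)" if "geodesic_on M \<gamma> ?I" for \<gamma>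
      using that t0 by (auto simp: geodesic_on_def continuous_map_def)
    have eq: "\<gamma>1 t0 = \<gamma>2 t0"
    proof (rule ccontr)
      assume ne: "\<gamma>1 t0 \<noteq> \<gamma>2 t0"
      have "Hausdorff_space (space_top M)"
        using M by (simp add: riemannian_manifold_def smooth_manifold_def)
      then obtain U V where UV: "openin (space_top M) U" "openin (space_top M) V" "\<gamma>1 t0 \<in> U" "\<gamma>2 t0 \<in> V" "disjnt U V"
        using ne top[OF g(1)] top[OF g(2)] by (meson Hausdorff_space_def)
      have "eventually (\<lambda>n. f n \<in> ?I \<and> \<gamma>1 (f n) \<in> U) sequentially" "eventually (\<lambda>n. f n \<in> ?I \<and> \<gamma>2 (f n) \<in> V) sequentially"
        using seq[OF geodesic_eventually_in[OF g(1) t0 UV(1,3)]] seq[OF geodesic_eventually_in[OF g(2) t0 UV(2,4)]] by auto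
      then have "eventually (\<lambda>n. False) sequentially"
        by eventually_elim (use eventually_nhds_x_imp_x[OF feq] UV(5) in \<open>auto simp: disjnt_iff\<close>)
      then show False by simp
    qed
    \<comment> \<open>The chart at \<open>p\<close> may not reach the limit point, so velocities are
      compared in a chart around that point.\<close>
    define c where "c = chart_at M (\<gamma>1 t0)"
    have c: "c \<in> atlas M" "\<gamma>1 t0 \<in> chart_dom c"
      using chart_at_atlas[OF top[OF g(1)]] by (auto simp: c_def)
    have dom: "openin (space_top M) (chart_dom c)" using atlas_chart[OF c(1)] by (simp add: is_chart_def)
    obtain v1 where v1: "\<And>t. t \<in> ?I \<Longrightarrow> \<gamma>1 t \<in> chart_dom c \<Longrightarrow>
        ((chart_map c \<circ> \<gamma>1) has_vector_derivative v1 t) (at t) \<and>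
        (v1 has_vector_derivative - christoffel_vec (metric M c) (chart_map c (\<gamma>1 t)) (v1 t) (v1 t)) (at t)"
      using geodesic_velocity[OF g(1) c(1)] by blast
    obtain v2 where v2: "\<And>t. t \<in> ?I \<Longrightarrow> \<gamma>2 t \<in> chart_dom c \<Longrightarrow>
        ((chart_map c \<circ> \<gamma>2) has_vector_derivative v2 t) (at t) \<and>
        (v2 has_vector_derivative - christoffel_vec (metric M c) (chart_map c (\<gamma>2 t)) (v2 t) (v2 t)) (at t)"
      using geodesic_velocity[OF g(2) c(1)] by blast
    note v = v1 v2
    have c2: "\<gamma>2 t0 \<in> chart_dom c" using c(2) eq by simp
    have "eventually (\<lambda>n. f n \<in> ?I \<and> \<gamma>1 (f n) \<in> chart_dom c) sequentially"
      "eventually (\<lambda>n. f n \<in> ?I \<and> \<gamma>2 (f n) \<in> chart_dom c) sequentially"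
      using seq[OF geodesic_eventually_in[OF g(1) t0 dom c(2)]] seq[OF geodesic_eventually_in[OF g(2) t0 dom c2]] by auto
    then have "eventually (\<lambda>n. v1 (f n) = v2 (f n)) sequentially"
    proof eventually_elim
      case (elim n)
      have "((chart_map c \<circ> \<gamma>2) has_vector_derivative v1 (f n)) (at (f n))"
        by (rule has_vector_derivative_transform_nhds[OF conjunct1[OF v(1)]])
          (use elim in \<open>simp, simp, simp add: eventually_mono[OF feq[of n]]\<close>)
      from vector_derivative_unique_at[OF this conjunct1[OF v(2)]] elim show ?case by simp
    qed
    moreover have l1: "(\<lambda>n. v1 (f n)) \<longlonglongrightarrow> v1 t0"
      by (rule isCont_tendsto_compose[OF has_vector_derivative_continuous[OF conjunct2[OF v(1)[OF t0 c(2)]]] f(2)])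
    moreover have l2: "(\<lambda>n. v2 (f n)) \<longlonglongrightarrow> v2 t0"
      by (rule isCont_tendsto_compose[OF has_vector_derivative_continuous[OF conjunct2[OF v(2)[OF t0 c2]]] f(2)])
    ultimately have "v1 t0 = v2 t0"
      using LIMSEQ_unique[OF Lim_transform_eventually[OF l1] l2] by simp
    then have "eventually (\<lambda>s. \<gamma>1 s = \<gamma>2 s) (nhds t0)"
      using v(1)[OF t0 c(2)] v(2)[OF t0 c2]
      by (intro geodesic_locally_unique[OF c(1) g t0 eq c(2)]) auto
    then show "t0 \<in> S" using t0 by (simp add: S_def)
  qed
  moreover have "connected ?I" by simp
  ultimately have "S = ?I" unfolding connected_clopen by blast
  then have "t \<in> S" using t by simp
  then show ?thesis unfolding S_def mem_Collect_eq using eventually_nhds_x_imp_x by blast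
qed

section \<open>The exponential map along rays\<close>

lemma geodesic_on_subset: "geodesic_on M \<gamma> I \<Longrightarrow> I' \<subseteq> I \<Longrightarrow> geodesic_on M \<gamma> I'"
  unfolding geodesic_on_def
  using continuous_map_from_subtopology_mono[of euclidean I "space_top M" \<gamma> I'] by blast

lemma exp_map_eq:
  assumes p: "p \<in> topspace (space_top M)" and q: "exp_rel M p \<xi> q"
  shows "exp_map M p \<xi> = q"
  unfolding exp_map_def
proof (rule the_equality, rule q)
  fix q' assume q': "exp_rel M p \<xi> q'"
  from q obtain \<gamma>1 a b where 1: "a < 0" "1 < b" "geodesic_on M \<gamma>1 {a<..<b}" "\<gamma>1 0 = p"
    "((chart_map (chart_at M p) \<circ> \<gamma>1) has_vector_derivative \<xi>) (at 0)" "\<gamma>1 1 = q"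
    unfolding exp_rel_def by blast
  from q' obtain \<gamma>2 a' b' where 2: "a' < 0" "1 < b'" "geodesic_on M \<gamma>2 {a'<..<b'}" "\<gamma>2 0 = p"
    "((chart_map (chart_at M p) \<circ> \<gamma>2) has_vector_derivative \<xi>) (at 0)" "\<gamma>2 1 = q'"
    unfolding exp_rel_def by blast
  have "\<gamma>1 1 = \<gamma>2 1"
    by (rule geodesic_unique[OF p, where a = "max a a'" and b = "min b b'" and \<xi> = \<xi>])
      (use 1 2 in \<open>auto intro: geodesic_on_subset\<close>)
  then show "q' = q" using 1 2 by simp
qed

lemma geodesic_scale:
  assumes g: "geodesic_on M \<gamma> {a<..<b}" and sub: "\<And>s. s \<in> I \<Longrightarrow> t * s \<in> {a<..<b}"
  shows "geodesic_on M (\<lambda>s. \<gamma> (t * s)) I"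
  unfolding geodesic_on_def
proof (intro conjI ballI)
  have "continuous_map (top_of_set I) (top_of_set {a<..<b}) (\<lambda>s. t * s)"
    using sub by (auto intro!: continuous_intros)
  from continuous_map_compose[OF this, of "space_top M" \<gamma>] g
  show "continuous_map (top_of_set I) (space_top M) (\<lambda>s. \<gamma> (t * s))"
    by (simp add: geodesic_on_def o_def)
  fix c assume c: "c \<in> atlas M"
  interpret coordinate_metric "chart_im c" "metric M c" by (rule coordinate_metric_chart[OF c])
  obtain v where v: "\<And>t. t \<in> {a<..<b} \<Longrightarrow> \<gamma> t \<in> chart_dom c \<Longrightarrow>
      ((chart_map c \<circ> \<gamma>) has_vector_derivative v t) (at t) \<and>
      (v has_vector_derivative - \<Gamma> (chart_map c (\<gamma> t)) (v t) (v t)) (at t)"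
    using geodesic_velocity[OF g c] by blast
  have l: "((\<lambda>s. t * s) has_vector_derivative t) (at s)" for s
    by (auto simp: has_vector_derivative_def intro!: derivative_eq_intros)
  have chain: "((\<lambda>s. h (t * s)) has_vector_derivative t *\<^sub>R h') (at s)"
    if "(h has_vector_derivative h') (at (t * s))" for h :: "real \<Rightarrow> real^'n" and h' s
    using vector_diff_chain_at[OF l that] by (simp add: o_def)
  show "\<exists>v. \<forall>s\<in>I. \<gamma> (t * s) \<in> chart_dom c \<longrightarrow>
     ((chart_map c \<circ> (\<lambda>s. \<gamma> (t * s))) has_vector_derivative v s) (at s) \<and>
     (v has_vector_derivative - \<Gamma> (chart_map c (\<gamma> (t * s))) (v s) (v s)) (at s)"
  proof (intro exI[of _ "\<lambda>s. t *\<^sub>R v (t * s)"] ballI impI conjI)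
    fix s assume s: "s \<in> I" "\<gamma> (t * s) \<in> chart_dom c"
    note vs = v[OF sub[OF s(1)] s(2)]
    show "((chart_map c \<circ> (\<lambda>s. \<gamma> (t * s))) has_vector_derivative t *\<^sub>R v (t * s)) (at s)"
      using chain[OF conjunct1[OF vs]] by (simp add: o_def)
    show "((\<lambda>s. t *\<^sub>R v (t * s)) has_vector_derivative
       - \<Gamma> (chart_map c (\<gamma> (t * s))) (t *\<^sub>R v (t * s)) (t *\<^sub>R v (t * s))) (at s)"
      using bounded_linear.has_vector_derivative[OF bounded_linear_scaleR_right chain[OF conjunct2[OF vs]], of t]
      by (simp add: christoffel_linear)
  qed
qed

lemma exp_map_ray:
  assumes p: "p \<in> topspace (space_top M)" and g: "geodesic_on M \<gamma> {a<..<b}" "a < 0" "0 < b" "\<gamma> 0 = p"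
    "((chart_map (chart_at M p) \<circ> \<gamma>) has_vector_derivative \<xi>) (at 0)" and t: "t \<in> {a<..<b}"
  shows "exp_map M p (t *\<^sub>R \<xi>) = \<gamma> t"
proof (rule exp_map_eq[OF p])
  \<comment> \<open>\<open>exp_rel\<close> demands a geodesic on an open interval that contains both
    0 and 1, so the rescaled parameter needs room beyond both ends.\<close>
  have "\<exists>e>0. \<forall>s. - e < s \<and> s < 1 + e \<longrightarrow> t * s \<in> {a<..<b}"
  proof -
    have o: "open ((\<lambda>s. t * s) -` {a<..<b})" by (intro open_vimage continuous_intros)
    obtain e1 where e1: "e1 > 0" "ball 0 e1 \<subseteq> (\<lambda>s. t * s) -` {a<..<b}" 
      by (rule openE[OF o, of 0]) (use g in auto)
    obtain e2 where e2: "e2 > 0" "ball 1 e2 \<subseteq> (\<lambda>s. t * s) -` {a<..<b}" 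
      by (rule openE[OF o, of 1]) (use t in auto)
    have mem: "t * s \<in> {a<..<b}" if "- min e1 e2 < s" "s < 1 + min e1 e2" for s
    proof (cases "0 \<le> s \<and> s \<le> 1")
      case True
      have "t * s = (1 - s) * 0 + s * t" by simp
      moreover have "(1 - s) *\<^sub>R 0 + s *\<^sub>R t \<in> {a<..<b}"
        using True g t by (intro convexD[OF convex_real_interval(8)]) auto
      ultimately show ?thesis by (simp add: mult.commute)
    next
      case False
      then have "s \<in> ball 0 e1 \<or> s \<in> ball 1 e2" using that by (auto simp: dist_real_def)
      then show ?thesis using e1 e2 by auto
    qed
    then show ?thesis using e1 e2 by (intro exI[of _ "min e1 e2"]) auto
  qed
  then obtain e where e: "e > 0" "\<And>s. - e < s \<Longrightarrow> s < 1 + e \<Longrightarrow> t * s \<in> {a<..<b}" by auto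
  have "geodesic_on M (\<lambda>s. \<gamma> (t * s)) {- e<..<1 + e}"
    by (rule geodesic_scale[OF g(1)]) (use e in auto)
  moreover have "((chart_map (chart_at M p) \<circ> (\<lambda>s. \<gamma> (t * s))) has_vector_derivative t *\<^sub>R \<xi>) (at 0)"
  proof -
    have "((\<lambda>s. t * s) has_vector_derivative t) (at 0)"
      by (auto simp: has_vector_derivative_def intro!: derivative_eq_intros)
    from vector_diff_chain_at[OF this, of "chart_map (chart_at M p) \<circ> \<gamma>" \<xi>] g(5)
    show ?thesis by (simp add: o_def)
  qed
  ultimately show "exp_rel M p (t *\<^sub>R \<xi>) (\<gamma> t)"
    unfolding exp_rel_def using g(4) e(1)
    by (intro exI[of _ "\<lambda>s. \<gamma> (t * s)"] exI[of _ "- e"] exI[of _ "1 + e"]) auto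
qed

end

subsection \<open>Normal coordinates read in a chart of the atlas\<close>

lemma congruence_entry: "(transpose L ** g ** L) $ i $ j = column i L \<bullet> (g *v column j L)"
  for L g :: "real^'n^'n"
  unfolding matrix_mul_assoc[symmetric]
  by (simp add: matrix_matrix_mult_def transpose_def inner_vec_def matrix_vector_mult_def column_def)

lemma congruence_inner: "x \<bullet> ((transpose L ** g ** L) *v y) = (L *v x) \<bullet> (g *v (L *v y))"
  for L g :: "real^'n^'n"
  by (metis dot_lmul_matrix inner_commute matrix_vector_mul_assoc transpose_matrix_vector)

context
  fixes M :: "('a, 'n::finite) riemannian" and p :: 'a
  assumes M: "riemannian_manifold M" and p: "p \<in> topspace (space_top M)"
begin

abbreviation (input) "metric_at \<equiv> metric M (chart_at M p) (chart_map (chart_at M p) p)"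

lemma inner_at_frame:
  assumes "orthonormal_frame M p L"
  shows "transpose L ** metric_at ** L = mat 1"
  using assms
  by (simp add: vec_eq_iff congruence_entry orthonormal_frame_def inner_at_def mat_def)

lemma norm_at_frame:
  assumes "orthonormal_frame M p L"
  shows "norm_at M p (L *v x) = norm x"
  using congruence_inner[of x L metric_at x] inner_at_frame[OF assms]
  by (simp add: norm_at_def inner_at_def norm_eq_sqrt_inner)

lemma norm_at_scaleR: "norm_at M p (r *\<^sub>R v) = \<bar>r\<bar> * norm_at M p v"
proof -
  have "inner_at M p (r *\<^sub>R v) (r *\<^sub>R v) = r\<^sup>2 * inner_at M p v v"
    by (simp add: inner_at_def matrix_vector_mult_scaleR power2_eq_square)
  then show ?thesis by (simp add: norm_at_def real_sqrt_mult)
qed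

lemma det_frame:
  assumes "orthonormal_frame M p L"
  shows "(det L)\<^sup>2 * det metric_at = 1"
  using arg_cong[OF inner_at_frame[OF assms], of det] by (simp add: det_mul power2_eq_square mult_ac)

lemma normal_chart_facts:
  assumes "normal_coordinates M p L \<delta>" "x \<in> ball 0 \<delta>"
  shows "exp_map M p (L *v x) \<in> chart_dom (normal_chart M p L \<delta>)"
    "chart_map (normal_chart M p L \<delta>) (exp_map M p (L *v x)) = x"
    "chart_inv (normal_chart M p L \<delta>) x = exp_map M p (L *v x)"
    "transition (normal_chart M p L \<delta>) d x = chart_map d (exp_map M p (L *v x))"
proof -
  show 1: "exp_map M p (L *v x) \<in> chart_dom (normal_chart M p L \<delta>)"
    using assms(2) by (auto simp: normal_chart_def)
  have "inj_on (\<lambda>x. exp_map M p (L *v x)) (ball 0 \<delta>)"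
    using assms(1) by (simp add: normal_coordinates_def)
  from inv_into_f_f[OF this assms(2)]
  show 2: "chart_map (normal_chart M p L \<delta>) (exp_map M p (L *v x)) = x"
    by (simp add: normal_chart_def)
  have "is_chart (space_top M) (normal_chart M p L \<delta>)"
    using assms(1) by (simp add: normal_coordinates_def smooth_chart_def)
  from chart_inv_chart_map[OF this 1]
  show 3: "chart_inv (normal_chart M p L \<delta>) x = exp_map M p (L *v x)" by (simp add: 2)
  then show "transition (normal_chart M p L \<delta>) d x = chart_map d (exp_map M p (L *v x))"
    by (simp add: transition_def)
qed

lemma normal_ray:
  assumes "normal_coordinates M p L \<delta>" "x \<in> ball 0 \<delta>"
  shows "\<exists>\<gamma> a b. a < 0 \<and> 1 < b \<and> geodesic_on M \<gamma> {a<..<b} \<and> \<gamma> 0 = p \<and>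
    ((chart_map (chart_at M p) \<circ> \<gamma>) has_vector_derivative L *v x) (at 0) \<and>
    (\<forall>t\<in>{a<..<b}. exp_map M p (L *v (t *\<^sub>R x)) = \<gamma> t)"
proof -
  obtain q where "exp_rel M p (L *v x) q"
    using assms unfolding normal_coordinates_def by blast
  then obtain \<gamma> a b where g: "a < 0" "1 < b" "geodesic_on M \<gamma> {a<..<b}" "\<gamma> 0 = p"
    "((chart_map (chart_at M p) \<circ> \<gamma>) has_vector_derivative L *v x) (at 0)"
    unfolding exp_rel_def by blast
  have b: "0 < b" using g(2) by simp
  have "exp_map M p (L *v (t *\<^sub>R x)) = \<gamma> t" if "t \<in> {a<..<b}" for t
    using exp_map_ray[OF M p g(3,1) b g(4,5) that] by (simp add: matrix_vector_mult_scaleR)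
  then show ?thesis using g by blast
qed

lemma exp_map_origin:
  assumes "normal_coordinates M p L \<delta>" "0 < \<delta>"
  shows "exp_map M p 0 = p"
proof -
  have "0 \<in> ball (0 :: real^'n) \<delta>" using assms by simp
  from normal_ray[OF assms(1) this]
  obtain \<gamma> a b where "a < 0" "1 < b" "\<gamma> 0 = p" "\<forall>t\<in>{a<..<b}. exp_map M p (L *v (t *\<^sub>R 0)) = \<gamma> t"
    by blast
  then show ?thesis by (auto dest: bspec[of _ _ 0])
qed

lemma metric_transform:
  assumes "c \<in> atlas M" "d \<in> atlas M" "q \<in> chart_dom c" "q \<in> chart_dom d"
  shows "metric M c (chart_map c q) = transpose (jacobian (transition c d) (chart_map c q)) **
    metric M d (chart_map d q) ** jacobian (transition c d) (chart_map c q)"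
  using M assms unfolding riemannian_manifold_def by blast

lemma transition_differentiable:
  assumes "c \<in> atlas M" "d \<in> atlas M" "q \<in> chart_dom c" "q \<in> chart_dom d"
  shows "transition c d differentiable (at (chart_map c q))"
proof (rule smooth_on_differentiable)
  have "compatible c d"
    using M assms(1,2) unfolding riemannian_manifold_def smooth_manifold_def by blast
  then show "smooth_on (chart_map c ` (chart_dom c \<inter> chart_dom d)) (transition c d)"
    by (simp add: compatible_def)
qed (use assms in auto)

context
  fixes c :: "('a, 'n) chart" and L :: "real^'n^'n" and \<delta> :: real
  assumes c: "c \<in> atlas M" "p \<in> chart_dom c" and nc: "normal_coordinates M p L \<delta>" and pos: "0 < \<delta>"
begin

text \<open>This becomes the \<open>E\<close> of \<open>exponential_coordinates\<close>. As a
  transition map out of the normal chart it is smooth by compatibility of charts.\<close>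

definition exp_chart where "exp_chart = transition (normal_chart M p L \<delta>) c"

text \<open>The image of the ball of normal coordinates may leave the chart \<open>c\<close>; this
  is the part of the ball whose image stays inside.\<close>

definition exp_dom where "exp_dom = {x \<in> ball 0 \<delta>. exp_map M p (L *v x) \<in> chart_dom c}"

lemma exp_chart_eq: "x \<in> ball 0 \<delta> \<Longrightarrow> exp_chart x = chart_map c (exp_map M p (L *v x))"
  unfolding exp_chart_def by (rule normal_chart_facts(4)[OF nc])

lemma exp_dom_eq: "exp_dom = chart_map (normal_chart M p L \<delta>) ` (chart_dom (normal_chart M p L \<delta>) \<inter> chart_dom c)"
proof (intro equalityI subsetI)
  fix x assume "x \<in> exp_dom"
  then have "x \<in> ball 0 \<delta>" "exp_map M p (L *v x) \<in> chart_dom c" by (auto simp: exp_dom_def)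
  then show "x \<in> chart_map (normal_chart M p L \<delta>) ` (chart_dom (normal_chart M p L \<delta>) \<inter> chart_dom c)"
    using normal_chart_facts(1,2)[OF nc, of x] by (intro image_eqI[of _ _ "exp_map M p (L *v x)"]) auto
next
  fix x assume "x \<in> chart_map (normal_chart M p L \<delta>) ` (chart_dom (normal_chart M p L \<delta>) \<inter> chart_dom c)"
  then obtain q where q: "q \<in> chart_dom (normal_chart M p L \<delta>)" "q \<in> chart_dom c"
    "x = chart_map (normal_chart M p L \<delta>) q" by auto
  from q(1) obtain y where y: "y \<in> ball 0 \<delta>" "q = exp_map M p (L *v y)" by (auto simp: normal_chart_def)
  then have "x = y" using q(3) normal_chart_facts(2)[OF nc y(1)] by simp
  then show "x \<in> exp_dom" using y q(2) by (simp add: exp_dom_def)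
qed

lemma is_chart_normal: "is_chart (space_top M) (normal_chart M p L \<delta>)"
  using nc by (simp add: normal_coordinates_def smooth_chart_def)

lemma open_exp_dom: "open exp_dom"
  unfolding exp_dom_eq using atlas_chart[OF M c(1)] by (intro open_chart_image[OF is_chart_normal]) (simp add: is_chart_def)

lemma smooth_exp_chart: "smooth_on exp_dom exp_chart"
  using nc c(1) unfolding exp_dom_eq exp_chart_def
  by (simp add: normal_coordinates_def smooth_chart_def compatible_def)

lemma exp_chart_in: "x \<in> exp_dom \<Longrightarrow> exp_chart x \<in> chart_im c"
  by (auto simp: exp_dom_def exp_chart_eq chart_im_def)

lemma origin_in_exp_dom: "0 \<in> exp_dom"
  using pos c(2) exp_map_origin[OF nc pos] by (simp add: exp_dom_def)

lemma exp_chart_origin: "exp_chart 0 = chart_map c p"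
  using pos by (simp add: exp_chart_eq exp_map_origin[OF nc pos])

lemma exp_chart_jacobian: "x \<in> exp_dom \<Longrightarrow> jacobian exp_chart x *v w = frechet_derivative exp_chart (at x) w"
  by (rule jacobian_vector_mult[OF smooth_on_differentiable[OF smooth_exp_chart]])

lemma ray_in_exp_dom_open: "open {t. t *\<^sub>R x \<in> exp_dom}"
  using open_vimage[OF open_exp_dom, of "\<lambda>t. t *\<^sub>R x"] by (simp add: vimage_def continuous_intros)

lemma scaled_curve: "((\<lambda>s. s *\<^sub>R x) has_vector_derivative x) (at t)" for x :: "real^'n"
  using has_vector_derivative_affine[of 0 x t] by simp

text \<open>By the description of rays in \<open>normal_ray\<close>, the curve
  \<open>t \<mapsto> exp_chart (t x)\<close> is near \<open>t = 1\<close> the coordinate expression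
  of a geodesic; its geodesic equation at \<open>t = 1\<close> is the claim.\<close>

lemma exp_chart_radial:
  assumes x: "x \<in> exp_dom"
  shows "frechet_derivative (jacobian exp_chart) (at x) x *v x +
    christoffel_vec (metric M c) (exp_chart x) (jacobian exp_chart x *v x) (jacobian exp_chart x *v x) = 0"
proof -
  have xb: "x \<in> ball 0 \<delta>" using x by (simp add: exp_dom_def)
  obtain \<gamma> a b where g: "a < 0" "1 < b" "geodesic_on M \<gamma> {a<..<b}"
    and ex: "\<And>t. t \<in> {a<..<b} \<Longrightarrow> exp_map M p (L *v (t *\<^sub>R x)) = \<gamma> t"
    using normal_ray[OF nc xb] by blast
  define W where "W = {t. t *\<^sub>R x \<in> exp_dom} \<inter> {a<..<b}"
  have oW: "open W" unfolding W_def by (intro open_Int ray_in_exp_dom_open open_greaterThanLessThan)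
  have W1: "1 \<in> W" using x g by (simp add: W_def)
  have EW: "exp_chart (t *\<^sub>R x) = chart_map c (\<gamma> t)" "\<gamma> t \<in> chart_dom c" if "t \<in> W" for t
    using that ex[of t] exp_chart_eq[of "t *\<^sub>R x"] by (auto simp: W_def exp_dom_def)
  obtain v where v: "\<And>t. t \<in> {a<..<b} \<Longrightarrow> \<gamma> t \<in> chart_dom c \<Longrightarrow>
      ((chart_map c \<circ> \<gamma>) has_vector_derivative v t) (at t) \<and>
      (v has_vector_derivative - christoffel_vec (metric M c) (chart_map c (\<gamma> t)) (v t) (v t)) (at t)"
    using geodesic_velocity[OF M g(3) c(1)] by blast
  have vW: "v t = jacobian exp_chart (t *\<^sub>R x) *v x" if t: "t \<in> W" for t
  proof -
    have tU: "t *\<^sub>R x \<in> exp_dom" using t by (simp add: W_def)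
    have "((\<lambda>s. exp_chart (s *\<^sub>R x)) has_vector_derivative frechet_derivative exp_chart (at (t *\<^sub>R x)) x) (at t)"
      by (rule has_vector_derivative_compose_differentiable[OF smooth_on_differentiable[OF smooth_exp_chart tU] scaled_curve])
    moreover have "eventually (\<lambda>s. exp_chart (s *\<^sub>R x) = (chart_map c \<circ> \<gamma>) s) (nhds t)"
      using eventually_nhds_in_open[OF oW t] by eventually_elim (simp add: EW)
    ultimately have "((chart_map c \<circ> \<gamma>) has_vector_derivative frechet_derivative exp_chart (at (t *\<^sub>R x)) x) (at t)"
      by (rule has_vector_derivative_transform_nhds)
    moreover have "((chart_map c \<circ> \<gamma>) has_vector_derivative v t) (at t)"
      using v[of t] EW(2)[OF t] t by (simp add: W_def)
    ultimately have "frechet_derivative exp_chart (at (t *\<^sub>R x)) x = v t" by (rule vector_derivative_unique_at)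
    then show ?thesis by (simp add: exp_chart_jacobian[OF tU])
  qed
  have "(v has_vector_derivative - christoffel_vec (metric M c) (chart_map c (\<gamma> 1)) (v 1) (v 1)) (at 1)"
    using v[of 1] EW(2)[OF W1] W1 by (simp add: W_def)
  moreover have "eventually (\<lambda>s. v s = jacobian exp_chart (s *\<^sub>R x) *v x) (nhds 1)"
    using eventually_nhds_in_open[OF oW W1] by eventually_elim (rule vW)
  ultimately have d1: "((\<lambda>s. jacobian exp_chart (s *\<^sub>R x) *v x) has_vector_derivative
      - christoffel_vec (metric M c) (chart_map c (\<gamma> 1)) (v 1) (v 1)) (at 1)"
    by (rule has_vector_derivative_transform_nhds)
  have "jacobian exp_chart differentiable (at (1 *\<^sub>R x))"
    using smooth_on_differentiable[OF smooth_on_jacobian[OF open_exp_dom smooth_exp_chart] x] by simp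
  from bounded_linear.has_vector_derivative[OF bounded_linear_matrix_vector_mult_left
      has_vector_derivative_compose_differentiable[OF this scaled_curve]]
  have "((\<lambda>s. jacobian exp_chart (s *\<^sub>R x) *v x) has_vector_derivative
     frechet_derivative (jacobian exp_chart) (at (1 *\<^sub>R x)) x *v x) (at 1)" .
  from vector_derivative_unique_at[OF this d1] show ?thesis
    using EW(1)[OF W1] vW[OF W1] by simp
qed

text \<open>The differential of the exponential map at the origin is the identity. The frame
  \<open>L\<close> and the transition from \<open>chart_at M p\<close>, in whose components tangent
  vectors are given, account for the right-hand side. Rays supply the identity on the ball,
  linearity elsewhere.\<close>

lemma jacobian_origin:
  "jacobian exp_chart 0 = jacobian (transition (chart_at M p) c) (chart_map (chart_at M p) p) ** L"
proof (rule matrix_eq[THEN iffD2], rule allI)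
  fix w :: "real^'n"
  define d where "d = chart_at M p"
  have d: "d \<in> atlas M" "p \<in> chart_dom d" using chart_at_atlas[OF M p] by (auto simp: d_def)
  have Td: "transition d c differentiable (at (chart_map d p))"
    by (rule transition_differentiable[OF d(1) c(1) d(2) c(2)])
  have ball: "jacobian exp_chart 0 *v x = jacobian (transition d c) (chart_map d p) *v (L *v x)" if x: "x \<in> ball 0 \<delta>" for x
  proof -
    obtain \<gamma> a b where g: "a < 0" "1 < b" "geodesic_on M \<gamma> {a<..<b}" "\<gamma> 0 = p"
      "((chart_map d \<circ> \<gamma>) has_vector_derivative L *v x) (at 0)"
      and ex: "\<And>t. t \<in> {a<..<b} \<Longrightarrow> exp_map M p (L *v (t *\<^sub>R x)) = \<gamma> t"
      unfolding d_def using normal_ray[OF nc x] by blast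
    have a0: "0 \<in> {a<..<b}" using g by simp
    have dom: "openin (space_top M) (chart_dom d)" using atlas_chart[OF M d(1)] by (simp add: is_chart_def)
    have "((\<lambda>s. exp_chart (s *\<^sub>R x)) has_vector_derivative frechet_derivative exp_chart (at (0 *\<^sub>R x)) x) (at 0)"
      by (rule has_vector_derivative_compose_differentiable[OF smooth_on_differentiable[OF smooth_exp_chart] scaled_curve])
        (simp add: origin_in_exp_dom)
    moreover have "eventually (\<lambda>s. exp_chart (s *\<^sub>R x) = transition d c ((chart_map d \<circ> \<gamma>) s)) (nhds 0)"
    proof -
      have "eventually (\<lambda>s. s \<in> {a<..<b} \<and> \<gamma> s \<in> chart_dom d) (nhds 0)"
        by (rule geodesic_eventually_in[OF M g(3) a0 dom]) (use g d in simp)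
      moreover have "eventually (\<lambda>s. s \<in> {t. t *\<^sub>R x \<in> exp_dom}) (nhds 0)"
        by (rule eventually_nhds_in_open[OF ray_in_exp_dom_open]) (simp add: origin_in_exp_dom)
      ultimately show ?thesis
      proof eventually_elim
        case (elim s)
        then have "exp_chart (s *\<^sub>R x) = chart_map c (\<gamma> s)" using exp_chart_eq[of "s *\<^sub>R x"] ex[of s] by (simp add: exp_dom_def)
        then show ?case
          using elim chart_inv_chart_map[OF atlas_chart[OF M d(1)]] by (simp add: transition_def)
      qed
    qed
    ultimately have "((\<lambda>s. transition d c ((chart_map d \<circ> \<gamma>) s)) has_vector_derivative frechet_derivative exp_chart (at (0 *\<^sub>R x)) x) (at 0)"
      by (rule has_vector_derivative_transform_nhds)
    moreover have "((\<lambda>s. transition d c ((chart_map d \<circ> \<gamma>) s)) has_vector_derivative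
        frechet_derivative (transition d c) (at ((chart_map d \<circ> \<gamma>) 0)) (L *v x)) (at 0)"
      by (rule has_vector_derivative_compose_differentiable[OF _ g(5)]) (use Td g in simp)
    ultimately have "frechet_derivative exp_chart (at (0 *\<^sub>R x)) x =
        frechet_derivative (transition d c) (at ((chart_map d \<circ> \<gamma>) 0)) (L *v x)"
      by (rule vector_derivative_unique_at)
    then show ?thesis
      using g(4) by (simp add: exp_chart_jacobian[OF origin_in_exp_dom] jacobian_vector_mult[OF Td])
  qed
  \<comment> \<open>Scales \<open>w\<close> into the ball; the summand 1 covers
    \<open>w = 0\<close>.\<close>
  define r where "r = \<delta> / (2 * (norm w + 1))"
  have nw: "norm w + 1 > 0" by (simp add: add_nonneg_pos)
  have r: "r > 0" using pos nw by (simp add: r_def)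
  have "norm (r *\<^sub>R w) \<le> r * (norm w + 1)" using r by simp
  also have "\<dots> = \<delta> / 2" using nw by (simp add: r_def field_simps)
  also have "\<dots> < \<delta>" using pos by simp
  finally have "r *\<^sub>R w \<in> ball 0 \<delta>" by simp
  from ball[OF this] r
  show "jacobian exp_chart 0 *v w = (jacobian (transition (chart_at M p) c) (chart_map (chart_at M p) p) ** L) *v w"
    by (simp add: matrix_vector_mult_scaleR d_def matrix_vector_mul_assoc)
qed

lemma orthonormal_exp_chart: "transpose (jacobian exp_chart 0) ** metric M c (exp_chart 0) ** jacobian exp_chart 0 = mat 1"
proof -
  let ?T = "jacobian (transition (chart_at M p) c) (chart_map (chart_at M p) p)"
  have "transpose (jacobian exp_chart 0) ** metric M c (exp_chart 0) ** jacobian exp_chart 0 =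
     transpose L ** (transpose ?T ** metric M c (chart_map c p) ** ?T) ** L"
    by (simp only: jacobian_origin exp_chart_origin matrix_transpose_mul matrix_mul_assoc)
  also have "\<dots> = transpose L ** metric_at ** L"
    by (simp only: metric_transform[OF chart_at_atlas(1)[OF M p] c(1) chart_at_atlas(2)[OF M p] c(2)])
  also have "\<dots> = mat 1"
    using nc by (intro inner_at_frame) (simp add: normal_coordinates_def)
  finally show ?thesis .
qed

text \<open>\<open>has_density\<close> is free to use a frame \<open>L'\<close> and a radius of its
  own. Its coordinates differ from those of \<open>L\<close> by
  \<open>B = L\<^sup>-\<^sup>1 L'\<close>, and \<open>(det B)\<^sup>2 = 1\<close> as both frames are
  orthonormal, so the determinant is the same.\<close>

lemma density_in_chart:
  assumes x: "x \<in> exp_dom" and d: "has_density M p (L *v x) \<rho>"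
  shows "norm x ^ (CARD('n) - 1) * sqrt (det (transpose (jacobian exp_chart x) ** metric M c (exp_chart x) ** jacobian exp_chart x)) = \<rho>"
proof -
  from d obtain L' \<delta>' x' where nc': "normal_coordinates M p L' \<delta>'" and x': "x' \<in> ball 0 \<delta>'"
    and eq: "L *v x = L' *v x'"
    and \<rho>: "\<rho> = norm_at M p (L *v x) ^ (CARD('n) - 1) * sqrt (det (metric_in M (normal_chart M p L' \<delta>') x'))"
    unfolding has_density_def by blast
  have fr: "orthonormal_frame M p L" "orthonormal_frame M p L'"
    using nc nc' by (auto simp: normal_coordinates_def)
  have dL: "det L \<noteq> 0" using det_frame[OF fr(1)] by auto
  define B where "B = matrix_inv L ** L'"
  have LB: "L *v (B *v y) = L' *v y" for y
    by (simp add: B_def matrix_vector_mul_assoc matrix_mul_assoc matrix_inv_mult[OF dL])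
  have Bx: "B *v x' = x"
    using eq by (simp add: B_def matrix_inv_mult[OF dL] flip: matrix_vector_mul_assoc)
      (metis eq matrix_inv_mult(2)[OF dL] matrix_vector_mul_assoc matrix_vector_mul_lid)
  have "det L * det B = det L'"
    by (simp add: B_def matrix_mul_assoc matrix_inv_mult[OF dL] flip: det_mul)
  then have "(det L)\<^sup>2 * det metric_at * (det B)\<^sup>2 = (det L')\<^sup>2 * det metric_at"
    by (simp add: power_mult_distrib flip: \<open>det L * det B = det L'\<close>)
  then have detB: "(det B)\<^sup>2 = 1" using det_frame[OF fr(1)] det_frame[OF fr(2)] by simp
  define q where "q = exp_map M p (L *v x)"
  have q: "q \<in> chart_dom c" using x by (simp add: exp_dom_def q_def)
  have Ex: "exp_chart x = chart_map c q" using x by (simp add: exp_chart_eq exp_dom_def q_def)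
  have qt: "q \<in> topspace (space_top M)"
    using q atlas_chart[OF M c(1)] by (auto simp: is_chart_def dest: openin_subset)
  \<comment> \<open>\<open>metric_in\<close> evaluates the metric in the chart chosen at
    \<open>q\<close>, hence the extra transition from \<open>c\<close> to \<open>d\<close>.\<close>
  define d where "d = chart_at M q"
  have d: "d \<in> atlas M" "q \<in> chart_dom d" using chart_at_atlas[OF M qt] by (auto simp: d_def)
  let ?n = "normal_chart M p L' \<delta>'"
  have inv: "chart_inv ?n x' = q" using normal_chart_facts(3)[OF nc' x'] by (simp add: q_def eq)
  let ?T = "jacobian (transition c d) (chart_map c q)"
  have Td: "transition c d differentiable (at (exp_chart x))"
    unfolding Ex by (rule transition_differentiable[OF c(1) d(1) q d(2)])
  have Ed: "exp_chart differentiable (at x)" by (rule smooth_on_differentiable[OF smooth_exp_chart x])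
  have hB: "((*v) B has_derivative (*v) B) (at x')"
    by (rule bounded_linear_imp_has_derivative) simp
  have hE: "((\<lambda>y. exp_chart (B *v y)) has_derivative (\<lambda>h. frechet_derivative exp_chart (at x) (B *v h))) (at x')"
    using diff_chain_at[OF hB, of exp_chart "frechet_derivative exp_chart (at x)"] Ed
    by (simp add: Bx o_def frechet_derivative_works)
  have hT: "((\<lambda>y. transition c d (exp_chart (B *v y))) has_derivative
     (\<lambda>h. frechet_derivative (transition c d) (at (exp_chart x)) (frechet_derivative exp_chart (at x) (B *v h)))) (at x')"
    using diff_chain_at[OF hE, of "transition c d" "frechet_derivative (transition c d) (at (exp_chart x))"] Td
    by (simp add: Bx o_def frechet_derivative_works)
  have op: "open (ball 0 \<delta>' \<inter> (*v) B -` exp_dom)"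
    by (intro open_Int open_ball open_vimage open_exp_dom linear_continuous_on) simp
  have "(transition ?n d has_derivative
     (\<lambda>h. frechet_derivative (transition c d) (at (exp_chart x)) (frechet_derivative exp_chart (at x) (B *v h)))) (at x')"
  proof (rule has_derivative_transform_within_open[OF hT op])
    show "x' \<in> ball 0 \<delta>' \<inter> (*v) B -` exp_dom" using x' x by (simp add: Bx)
    fix y assume y: "y \<in> ball 0 \<delta>' \<inter> (*v) B -` exp_dom"
    then have "exp_chart (B *v y) = chart_map c (exp_map M p (L' *v y))" "exp_map M p (L' *v y) \<in> chart_dom c"
      using exp_chart_eq[of "B *v y"] by (auto simp: exp_dom_def LB)
    then show "transition c d (exp_chart (B *v y)) = transition ?n d y"
      using y normal_chart_facts(4)[OF nc', of y d] chart_inv_chart_map[OF atlas_chart[OF M c(1)]]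
      by (simp add: transition_def)
  qed
  from frechet_derivative_at[OF this, symmetric]
  have "frechet_derivative (transition ?n d) (at x') =
     (\<lambda>h. frechet_derivative (transition c d) (at (exp_chart x)) (frechet_derivative exp_chart (at x) (B *v h)))" .
  also have "\<dots> = (\<lambda>h. (?T ** jacobian exp_chart x ** B) *v h)"
    by (simp only: exp_chart_jacobian[OF x, symmetric] Ex jacobian_vector_mult[OF Td[unfolded Ex], symmetric]
        matrix_vector_mul_assoc matrix_mul_assoc)
  finally have "jacobian (transition ?n d) x' = ?T ** jacobian exp_chart x ** B"
    unfolding jacobian_def[of "transition ?n d"] by simp
  moreover have "metric M c (chart_map c q) = transpose ?T ** metric M d (chart_map d q) ** ?T"
    by (rule metric_transform[OF c(1) d(1) q d(2)])
  ultimately have "metric_in M ?n x' = transpose B ** (transpose (jacobian exp_chart x) ** metric M c (exp_chart x) ** jacobian exp_chart x) ** B"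
    by (simp add: metric_in_def Let_def inv Ex matrix_transpose_mul matrix_mul_assoc flip: d_def)
  then have "det (metric_in M ?n x') = det (transpose (jacobian exp_chart x) ** metric M c (exp_chart x) ** jacobian exp_chart x)"
    using detB by (simp add: det_mul power2_eq_square mult_ac)
  then show ?thesis by (simp add: \<rho> norm_at_frame[OF fr(1)])
qed

end

section \<open>Exponential coordinates at every point of a harmonic space\<close>

text \<open>Harmonicity yields normal coordinates only through the density of some nonzero vector,
  so a vector whose norm is half the radius of harmonicity is used to extract them. Positivity of
  the density makes the Jacobian regular away from the origin.\<close>

lemma exponential_coordinates_exist:
  assumes c: "c \<in> atlas M" "p \<in> chart_dom c" and harm: "harmonic_with_density M f"
    and fpos: "\<And>r. 0 < r \<Longrightarrow> r < 1 \<Longrightarrow> f r > 0"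
  shows "\<exists>E \<delta>. exponential_coordinates (chart_im c) (metric M c) E \<delta> \<and> E 0 = chart_map c p \<and>
    (\<forall>x. 0 < norm x \<longrightarrow> norm x < \<delta> \<longrightarrow> norm x ^ (CARD('n) - 1) *
      sqrt (det (transpose (jacobian E x) ** metric M c (E x) ** jacobian E x)) = f (norm x))"
proof -
  from harm p obtain \<delta>h where \<delta>h: "\<delta>h > 0"
    and dens: "\<And>\<xi>. 0 < norm_at M p \<xi> \<Longrightarrow> norm_at M p \<xi> < \<delta>h \<Longrightarrow> has_density M p \<xi> (f (norm_at M p \<xi>))"
    unfolding harmonic_with_density_def by blast
  interpret d: coordinate_metric "chart_im (chart_at M p)" "metric M (chart_at M p)"
    by (rule coordinate_metric_chart[OF M chart_at_atlas(1)[OF M p]])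
  obtain v :: "real^'n" where v: "v \<noteq> 0"
    by (metis axis_eq_0_iff zero_neq_one)
  have "chart_map (chart_at M p) p \<in> chart_im (chart_at M p)"
    using chart_at_atlas(2)[OF M p] by (simp add: chart_im_def)
  then have nv: "norm_at M p v > 0"
    using d.positive_metric v by (simp add: norm_at_def inner_at_def)
  define \<xi> where "\<xi> = (\<delta>h / (2 * norm_at M p v)) *\<^sub>R v"
  have "norm_at M p \<xi> = \<bar>\<delta>h / (2 * norm_at M p v)\<bar> * norm_at M p v"
    unfolding \<xi>_def by (rule norm_at_scaleR)
  then have "norm_at M p \<xi> = \<delta>h / 2" using nv \<delta>h by simp
  then have "has_density M p \<xi> (f (norm_at M p \<xi>))" using dens[of \<xi>] \<delta>h by simp
  then obtain L \<delta>1 and y :: "real^'n" where nc: "normal_coordinates M p L \<delta>1" and "y \<in> ball 0 \<delta>1"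
    unfolding has_density_def by blast
  then have \<delta>1: "0 < \<delta>1" by (metis ball_eq_empty emptyE not_le)
  note facts = c nc \<delta>1
  let ?E = "exp_chart c L \<delta>1" and ?U = "exp_dom c L \<delta>1"
  obtain r where r: "r > 0" "ball 0 r \<subseteq> ?U"
    using openE[OF open_exp_dom[OF facts] origin_in_exp_dom[OF facts]] by blast
  \<comment> \<open>The three bounds ensure that the ball stays in the chart, that \<open>f\<close>
    is positive and that the density formula holds.\<close>
  define \<delta> where "\<delta> = min r (min 1 \<delta>h)"
  have \<delta>: "\<delta> > 0" "\<delta> \<le> 1" "\<delta> \<le> \<delta>h" "ball 0 \<delta> \<subseteq> ?U" using r \<delta>h by (auto simp: \<delta>_def)
  have fr: "orthonormal_frame M p L" using nc by (simp add: normal_coordinates_def)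
  have density: "norm x ^ (CARD('n) - 1) * sqrt (det (transpose (jacobian ?E x) ** metric M c (?E x) ** jacobian ?E x)) = f (norm x)"
    if "0 < norm x" "norm x < \<delta>" for x
    using density_in_chart[OF facts, of x "f (norm x)"] dens[of "L *v x"] norm_at_frame[OF fr, of x] that \<delta> by auto
  interpret G: coordinate_metric "chart_im c" "metric M c" by (rule coordinate_metric_chart[OF M c(1)])
  have "exponential_coordinates (chart_im c) (metric M c) ?E \<delta>"
  proof unfold_locales
    show "smooth_on (ball 0 \<delta>) ?E" by (rule smooth_on_subset[OF smooth_exp_chart[OF facts] \<delta>(4)])
    show "?E ` ball 0 \<delta> \<subseteq> chart_im c" using exp_chart_in[OF facts] \<delta>(4) by blast
    fix x :: "real^'n" assume x: "x \<in> ball 0 \<delta>"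
    then have "x \<in> ?U" using \<delta>(4) by blast
    from exp_chart_radial[OF facts this]
    show "frechet_derivative (jacobian ?E) (at x) x *v x +
        christoffel_vec (metric M c) (?E x) (jacobian ?E x *v x) (jacobian ?E x *v x) = 0" .
    show "det (jacobian ?E x) \<noteq> 0"
    \<comment> \<open>At the origin the density gives no information; there the orthonormality of
      the frame shows regularity.\<close>
    proof (cases "x = 0")
      case True
      then show ?thesis using arg_cong[OF orthonormal_exp_chart[OF facts], of det] by (auto simp: det_mul)
    next
      case False
      then have "f (norm x) > 0" using x \<delta> by (intro fpos) auto
      then show ?thesis using density[of x] False x by (auto simp: det_mul)
    qed
  qed (use \<delta>(1) orthonormal_exp_chart[OF facts] in auto)
  then show ?thesis using density exp_chart_origin[OF facts] by blast
qed

end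

subsection \<open>The eigenvalue bound\<close>

context exponential_coordinates
begin

lemma origin_isometry: "(J 0 *v a) \<bullet> (G (E 0) *v (J 0 *v b)) = a \<bullet> b"
  using congruence_inner[of a "J 0" "G (E 0)" b] by (simp add: orthonormal_origin)

lemma regular_origin: "det (J 0) \<noteq> 0"
  using regular[of 0] radius by simp

lemma origin_in_domain: "E 0 \<in> \<Omega>"
  using exp_in_domain[of 0] radius by simp

lemma unit_preimage:
  assumes "v \<bullet> (G (E 0) *v v) = 1"
  shows "norm (matrix_inv (J 0) *v v) = 1" "J 0 *v (matrix_inv (J 0) *v v) = v"
proof -
  show 1: "J 0 *v (matrix_inv (J 0) *v v) = v"
    by (simp add: matrix_vector_mul_assoc matrix_inv_mult[OF regular_origin])
  have "(matrix_inv (J 0) *v v) \<bullet> (matrix_inv (J 0) *v v) = 1"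
    using origin_isometry[of "matrix_inv (J 0) *v v" "matrix_inv (J 0) *v v"] assms by (simp add: 1)
  then show "norm (matrix_inv (J 0) *v v) = 1" by (simp add: norm_eq_1)
qed

lemma radial_unit_speed:
  assumes u: "norm u = 1" and t: "0 < t" "t < \<delta>"
  shows "(J (t *\<^sub>R u) *v u) \<bullet> (G (E (t *\<^sub>R u)) *v (J (t *\<^sub>R u) *v u)) = 1"
proof -
  define v where "v = (\<lambda>s. J (s *\<^sub>R u) *v u)"
  define e where "e = (\<lambda>s. v s \<bullet> (G (E (s *\<^sub>R u)) *v v s))"
  have b: "s *\<^sub>R u \<in> ball 0 \<delta>" if "0 \<le> s" "s \<le> t" for s using that t u by simp
  have c: "((\<lambda>s. E (s *\<^sub>R u)) has_vector_derivative v s) (at s)" if "0 \<le> s" "s \<le> t" for s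
    using ray_derivative[OF smooth_exp b[OF that]] by (simp add: v_def J_mult[OF b[OF that]])
  have v: "(v has_vector_derivative J1 u (s *\<^sub>R u) *v u) (at s)" if "0 \<le> s" "s \<le> t" for s
    using bounded_linear.has_vector_derivative[OF bounded_linear_matrix_vector_mult_left
        ray_derivative[OF smooth_J b[OF that]]] by (simp add: v_def[abs_def] J1_def)
  \<comment> \<open>The derivative is computed only for \<open>s > 0\<close>, since
    \<open>radial_acceleration\<close> excludes the origin; continuity carries the constant to the
    end point 0.\<close>
  have "e t = e 0"
  proof (rule DERIV_isconst_end[OF t(1)])
    show "continuous_on {0..t} e"
    proof (rule continuous_at_imp_continuous_on, rule ballI)
      fix s assume "s \<in> {0..t}"
      then have s: "0 \<le> s" "s \<le> t" by auto
      have "((\<lambda>s. G (E (s *\<^sub>R u))) has_vector_derivative DG (E (s *\<^sub>R u)) (v s)) (at s)"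
        by (rule has_vector_derivative_compose_differentiable[OF
              smooth_on_differentiable[OF smooth_metric exp_in_domain[OF b[OF s]]] c[OF s]])
      from bounded_bilinear.has_vector_derivative[OF bounded_bilinear_inner v[OF s]
          has_vector_derivative_matrix_vector_mult[OF this v[OF s]]]
      show "isCont e s" unfolding e_def by (rule has_vector_derivative_continuous)
    qed
    fix s assume s: "0 < s" "s < t"
    have "(v has_vector_derivative - \<Gamma> (E (s *\<^sub>R u)) (v s) (v s)) (at s)"
      using v[of s] radial_acceleration[OF b, of s] s by (simp add: v_def)
    from geodesic_speed_constant[OF c _ this] s b[of s] exp_in_domain
    show "(e has_real_derivative 0) (at s)" by (simp add: e_def)
  qed
  moreover have "e 0 = 1"
    using origin_isometry[of u u] u by (simp add: e_def v_def norm_eq_1)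
  ultimately show ?thesis by (simp add: e_def v_def)
qed

lemma curvature_matrix_origin_mult:
  assumes "J 0 *v u = \<xi>"
  shows "curvature_matrix u 0 *v w = jacobi (E 0) \<xi> w"
  using curvature_mult[of 0 u w] radius assms by simp

text \<open>In chart coordinates the Jacobi operator is self-adjoint for the metric, but its matrix
  need not be symmetric. Conjugation with the isometry \<open>J 0\<close> yields a symmetric matrix
  \<open>S\<close> with the same traces, to which \<open>eigenvalue_trace_inequality\<close>
  applies.\<close>

lemma jacobi_eigenvalue_inequality:
  assumes u: "norm u = 1" "J 0 *v u = \<xi>"
    and \<eta>: "\<eta> \<noteq> 0" "\<xi> \<bullet> (G (E 0) *v \<eta>) = 0" "jacobi (E 0) \<xi> \<eta> = \<mu> *\<^sub>R \<eta>"
  shows "(trace (curvature_matrix u 0) - \<mu>)\<^sup>2 \<le>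
    (trace (curvature_matrix u 0 ** curvature_matrix u 0) - \<mu>\<^sup>2) * (real CARD('n) - 2)"
proof -
  let ?Q = "matrix_inv (J 0)" and ?R = "curvature_matrix u 0"
  note inv = matrix_inv_mult[OF regular_origin]
  note R = curvature_matrix_origin_mult[OF u(2)]
  have JQ: "J 0 *v (?Q *v w) = w" and QJ: "?Q *v (J 0 *v w) = w" for w
    by (simp_all add: matrix_vector_mul_assoc inv)
  define S where "S = ?Q ** ?R ** J 0"
  have S: "S *v a = ?Q *v jacobi (E 0) \<xi> (J 0 *v a)" for a
    by (simp add: S_def R flip: matrix_vector_mul_assoc)
  have sym: "transpose S = S"
  proof (rule matrix_eq[THEN iffD2], rule allI, rule vector_eq_ldot[THEN iffD1], rule allI)
    fix a b
    have "a \<bullet> (S *v b) = (J 0 *v a) \<bullet> (G (E 0) *v jacobi (E 0) \<xi> (J 0 *v b))" for a b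
      using origin_isometry[of a "S *v b"] by (simp add: S JQ)
    moreover have "(J 0 *v a) \<bullet> (G (E 0) *v jacobi (E 0) \<xi> (J 0 *v b)) =
        (J 0 *v b) \<bullet> (G (E 0) *v jacobi (E 0) \<xi> (J 0 *v a))"
      using jacobi_self_adjoint[OF origin_in_domain, of \<xi> "J 0 *v b" "J 0 *v a"] by (simp add: inner_commute)
    ultimately have "a \<bullet> (S *v b) = b \<bullet> (S *v a)" by simp
    moreover have "a \<bullet> (transpose S *v b) = b \<bullet> (S *v a)"
      by (metis dot_lmul_matrix inner_commute transpose_matrix_vector)
    ultimately show "a \<bullet> (transpose S *v b) = a \<bullet> (S *v b)" by simp
  qed
  define z where "z = ?Q *v \<eta>"
  have Jz: "J 0 *v z = \<eta>" by (simp add: z_def JQ)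
  have z0: "z \<noteq> 0" using Jz \<eta>(1) by auto
  define y where "y = (1 / norm z) *\<^sub>R z"
  have "(trace S - \<mu>)\<^sup>2 \<le> (trace (S ** S) - \<mu>\<^sup>2) * (real CARD('n) - 2)"
  proof (rule eigenvalue_trace_inequality[OF sym])
    show "u \<bullet> u = 1" using u(1) by (simp add: norm_eq_1)
    show "S *v u = 0" using u(2) jacobi_self[OF origin_in_domain] by (simp add: S)
    show "y \<bullet> y = 1" using z0 by (simp add: y_def dot_square_norm power2_eq_square)
    have "S *v z = \<mu> *\<^sub>R z" 
      by (simp only: S Jz \<eta>(3) matrix_vector_mult_scaleR) (simp add: z_def)
    then show "S *v y = \<mu> *\<^sub>R y" by (simp add: y_def matrix_vector_mult_scaleR)
    have "u \<bullet> z = 0" using origin_isometry[of u z] u(2) \<eta>(2) Jz by simp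
    then show "u \<bullet> y = 0" by (simp add: y_def)
  qed
  moreover have "trace S = trace ?R"
    unfolding S_def by (subst trace_mul_sym) (simp add: matrix_mul_assoc inv)
  moreover have "trace (S ** S) = trace (?R ** ?R)"
  proof -
    have "S ** S = ?Q ** (?R ** (J 0 ** ?Q) ** ?R) ** J 0" by (simp add: S_def matrix_mul_assoc)
    then have "S ** S = ?Q ** (?R ** ?R) ** J 0" by (simp add: inv)
    then show ?thesis by (simp only: trace_mul_sym[of _ "J 0"]) (simp add: matrix_mul_assoc inv)
  qed
  ultimately show ?thesis by simp
qed

end

section \<open>From the two traces to the bound on one eigenvalue\<close>

text \<open>With \<open>a = N + 3 k\<close> and \<open>b = N + 15 k\<close>, multiplying by
  \<open>N\<close> and completing the square in \<open>l\<close> turns the hypothesis into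
  \<open>(N l - a)\<^sup>2 \<le> (N - 1) (N b - a\<^sup>2)\<close>, and
  \<open>N b - a\<^sup>2 = 9 k (N - k)\<close>.\<close>

lemma mean_deviation_bound:
  fixes N k l :: real
  assumes N: "N > 1" and ineq: "(N + 3 * k - l)\<^sup>2 \<le> (N + 15 * k - l\<^sup>2) * (N - 1)"
  shows "\<bar>l - (N + 3 * k) / N\<bar> \<le> 3 * (N - 1) / N * sqrt (k * (N - k) / (N - 1))"
proof -
  have "N * ((N + 3 * k - l)\<^sup>2) \<le> N * ((N + 15 * k - l\<^sup>2) * (N - 1))"
    using ineq N by simp
  then have "(N * l - (N + 3 * k))\<^sup>2 \<le> 9 * (N - 1) * (k * (N - k))"
    by (simp add: power2_eq_square algebra_simps)
  also have "\<dots> = (3 * (N - 1))\<^sup>2 * (k * (N - k) / (N - 1))"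
  proof -
    have "9 * d * a = (3 * d)\<^sup>2 * (a / d)" if "d \<noteq> 0" for d a :: real
      using that by (simp add: power2_eq_square)
    note * = this
    show ?thesis by (rule *) (use N in simp)
  qed
  finally have "sqrt ((N * l - (N + 3 * k))\<^sup>2) \<le> sqrt ((3 * (N - 1))\<^sup>2 * (k * (N - k) / (N - 1)))"
    by (rule real_sqrt_le_mono)
  then have "\<bar>N * l - (N + 3 * k)\<bar> \<le> 3 * (N - 1) * sqrt (k * (N - k) / (N - 1))"
    unfolding real_sqrt_mult real_sqrt_abs using N by simp
  then have "\<bar>N * l - (N + 3 * k)\<bar> / N \<le> 3 * (N - 1) * sqrt (k * (N - k) / (N - 1)) / N"
    using N by (intro divide_right_mono) auto
  moreover have "l - (N + 3 * k) / N = (N * l - (N + 3 * k)) / N" using N by (simp add: diff_divide_distrib)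
  then have "\<bar>l - (N + 3 * k) / N\<bar> = \<bar>N * l - (N + 3 * k)\<bar> / N" using N by (simp add: abs_divide)
  ultimately show ?thesis by simp
qed

lemma model_density_pos: "0 < r \<Longrightarrow> r < 1 \<Longrightarrow> model_density \<epsilon> (int N + 1) k r > 0"
  by (simp add: model_density_eq msin_pos mcos_pos)

text \<open>The chart \<open>c\<close> is kept while the base point moves: exponential coordinates
  are set up at the point with coordinates \<open>x\<close> but read in \<open>c\<close>. The trace
  formula can therefore be applied at the points of a ray that starts elsewhere.\<close>

lemma ricci_trace:
  fixes M :: "('a, 'n::finite) riemannian"
  assumes M: "riemannian_manifold M" and harm: "harmonic_with_density M (model_density \<epsilon> (int N + 1) k)"
    and \<epsilon>: "\<epsilon> \<in> {1, -1}" and c: "c \<in> atlas M" and x: "x \<in> chart_im c" and v: "v \<bullet> (metric M c x *v v) = 1"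
  shows "trace (matrix (coordinate_metric.jacobi (metric M c) x v)) = of_int \<epsilon> * (real N + 3 * of_int k)"
proof -
  from x obtain q where q: "q \<in> chart_dom c" "x = chart_map c q" by (auto simp: chart_im_def)
  have qt: "q \<in> topspace (space_top M)"
    using q atlas_chart[OF M c] by (auto simp: is_chart_def dest: openin_subset)
  obtain E \<delta> where e: "exponential_coordinates (chart_im c) (metric M c) E \<delta>" and E0: "E 0 = chart_map c q"
    and dens: "\<forall>x. 0 < norm x \<longrightarrow> norm x < \<delta> \<longrightarrow> norm x ^ (CARD('n) - 1) *
      sqrt (det (transpose (jacobian E x) ** metric M c (E x) ** jacobian E x)) = model_density \<epsilon> (int N + 1) k (norm x)"
    using exponential_coordinates_exist[OF M qt c q(1) harm model_density_pos] by blast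
  interpret exponential_coordinates "chart_im c" "metric M c" E \<delta> by (rule e)
  have v0: "v \<bullet> (metric M c (E 0) *v v) = 1" using v q(2) E0 by simp
  have "trace (curvature_matrix (matrix_inv (J 0) *v v) 0) = of_int \<epsilon> * (real N + 3 * of_int k)"
    by (rule trace_curvature[OF \<epsilon> unit_preimage(1)[OF v0]]) (use dens in auto)
  then show ?thesis
    by (simp add: curvature_matrix_def unit_preimage(2)[OF v0] E0 q(2))
qed

theorem theorem1p9:
  fixes M :: "('a, 'n::finite) riemannian"
    and \<epsilon> m k :: int and p :: 'a and \<xi> :: "real^'n" and \<mu> :: real
  assumes "\<epsilon> \<in> {1, -1}"
    and "m > 2"
    and "riemannian_manifold M"
    and "harmonic_with_density M (model_density \<epsilon> m k)"
    and "p \<in> topspace (space_top M)"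
    and "norm_at M p \<xi> = 1"
    and "reduced_jacobi_eigenvalue M p \<xi> \<mu>"
  shows "(of_int m + 3 * of_int k - 1) / (of_int m - 1) - error_term m k \<le> of_int \<epsilon> * \<mu> \<and>
         of_int \<epsilon> * \<mu> \<le> (of_int m + 3 * of_int k - 1) / (of_int m - 1) + error_term m k"
proof -
  \<comment> \<open>The exponent \<open>m - 1\<close> of the model density as a natural number; it
    is identified with the dimension minus one through \<open>dimension_eq\<close>.\<close>
  define N where "N = nat (m - 1)"
  have m: "m = int N + 1" and N: "N > 1" using assms(2) by (auto simp: N_def)
  note sign = assms(1) and M = assms(3) and p = assms(5)
  note harm = assms(4)[unfolded m]
  define c where "c = chart_at M p"
  have c: "c \<in> atlas M" "p \<in> chart_dom c" using chart_at_atlas[OF M p] by (auto simp: c_def)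
  obtain E \<delta> where e: "exponential_coordinates (chart_im c) (metric M c) E \<delta>" and E0: "E 0 = chart_map c p"
    and dens: "\<forall>x. 0 < norm x \<longrightarrow> norm x < \<delta> \<longrightarrow> norm x ^ (CARD('n) - 1) *
      sqrt (det (transpose (jacobian E x) ** metric M c (E x) ** jacobian E x)) = model_density \<epsilon> (int N + 1) k (norm x)"
    using exponential_coordinates_exist[OF M p c harm model_density_pos] by blast
  interpret exponential_coordinates "chart_im c" "metric M c" E \<delta> by (rule e)
  have inner: "inner_at M p a b = a \<bullet> (metric M c (E 0) *v b)" for a b
    by (simp add: inner_at_def E0 c_def)
  have v0: "\<xi> \<bullet> (metric M c (E 0) *v \<xi>) = 1" using assms(6) by (simp add: norm_at_def inner)
  define u where "u = matrix_inv (J 0) *v \<xi>"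
  have u: "norm u = 1" "J 0 *v u = \<xi>" using unit_preimage[OF v0] by (auto simp: u_def)
  from assms(7) obtain \<eta> where \<eta>: "\<eta> \<noteq> 0" "inner_at M p \<xi> \<eta> = 0" "jacobi_op M p \<xi> \<eta> = \<mu> *\<^sub>R \<eta>"
    unfolding reduced_jacobi_eigenvalue_def by blast
  have "jacobi_op M p \<xi> \<eta> = jacobi (E 0) \<xi> \<eta>"
    using curvature_field_eq_jacobi[OF origin_in_domain, of \<eta> \<xi>]
    by (simp add: jacobi_op_def curvature_at_def E0 c_def)
  then have ineq: "(trace (curvature_matrix u 0) - \<mu>)\<^sup>2 \<le>
      (trace (curvature_matrix u 0 ** curvature_matrix u 0) - \<mu>\<^sup>2) * (real CARD('n) - 2)"
    using \<eta> inner by (intro jacobi_eigenvalue_inequality[OF u]) auto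
  have d: "0 < norm x \<Longrightarrow> norm x < \<delta> \<Longrightarrow> norm x ^ (CARD('n) - 1) *
      sqrt (det (transpose (J x) ** metric M c (E x) ** J x)) = model_density \<epsilon> (int N + 1) k (norm x)" for x
    using dens by blast
  have tr: "trace (curvature_matrix u 0) = of_int \<epsilon> * (real N + 3 * of_int k)"
    by (rule trace_curvature[OF sign u(1) d])
  have tr2: "trace (curvature_matrix u 0 ** curvature_matrix u 0) = real N + 15 * of_int k"
  proof (rule trace_curvature_squared[OF sign u(1) d])
    fix t assume t: "0 < t" "t < \<delta>"
    then have "t *\<^sub>R u \<in> ball 0 \<delta>" using u(1) by simp
    \<comment> \<open>The point on the ray takes the role of a new base point, and the radial
      velocity is a unit vector there.\<close>
    from ricci_trace[OF M harm sign c(1) exp_in_domain[OF this] radial_unit_speed[OF u(1) t]]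
    show "trace (curvature_matrix u (t *\<^sub>R u)) = of_int \<epsilon> * (real N + 3 * of_int k)"
      by (simp add: curvature_matrix_def)
  qed
  have dim: "real CARD('n) - 2 = real N - 1"
    using dimension_eq[OF sign u(1) d] N by simp
  have e2: "(of_int \<epsilon> :: real) * of_int \<epsilon> = 1" using sign by auto
  \<comment> \<open>Since \<open>\<epsilon>\<^sup>2 = 1\<close>, passing to
    \<open>\<epsilon> \<mu>\<close> removes the sign from the inequality and treats the two models
    alike.\<close>
  define l where "l = of_int \<epsilon> * \<mu>"
  have \<mu>: "\<mu> = of_int \<epsilon> * l" using e2 by (simp add: l_def flip: mult.assoc)
  have "(of_int \<epsilon> * (real N + 3 * of_int k) - \<mu>)\<^sup>2 = (real N + 3 * of_int k - l)\<^sup>2" "\<mu>\<^sup>2 = l\<^sup>2"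
    using sign by (auto simp: \<mu> power2_eq_square algebra_simps)
  then have "(real N + 3 * of_int k - l)\<^sup>2 \<le> (real N + 15 * of_int k - l\<^sup>2) * (real N - 1)"
    using ineq by (simp add: tr tr2 dim)
  from mean_deviation_bound[OF _ this] N
  have "\<bar>l - (real N + 3 * of_int k) / real N\<bar> \<le>
      3 * (real N - 1) / real N * sqrt (of_int k * (real N - of_int k) / (real N - 1))" by simp
  moreover have "error_term m k = 3 * (real N - 1) / real N * sqrt (of_int k * (real N - of_int k) / (real N - 1))"
    by (simp add: error_term_def m algebra_simps)
  moreover have "(of_int m + 3 * of_int k - 1) / (of_int m - 1) = (real N + 3 * of_int k) / real N"
    by (simp add: m)
  ultimately show ?thesis unfolding l_def by (simp add: abs_le_iff)
qed

end
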